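(* Let $\eta>0$ and let $\widehat A=\operatorname{Op}^{\mathrm W}_\eta(a)$ be a self-adjoint trace-class operator on $L^2(\mathbb{R}^n)$. Then $\widehat A\ge0$ if and only if $$\int_{\mathbb{R}^{2n}}F_{\sigma,\eta}a(z)\left(\int_{\mathbb{R}^{2n}}e^{-\frac{i}{2\eta}\sigma(z,z')}c(z'-z)\overline{c(z')}\,dz'\right)dz\ \ge\ 0\qquad\text{for all }c\in L^2(\mathbb{R}^{2n}).$$
   Context: Points of $\mathbb{R}^{2n}$ are written $z=(x,p)$; $\sigma(z,z')=p\cdot x'-p'\cdot x$ for $z=(x,p)$, $z'=(x',p')$. $W_\eta(\psi,\phi)(x,p)=(2\pi\eta)^{-n}\int_{\mathbb{R}^n}e^{-\frac{i}{\eta}p\cdot y}\psi(x+\tfrac12y)\overline{\phi(x-\tfrac12y)}\,dy$; $\operatorname{Op}^{\mathrm W}_\eta(a)$ is defined by $\langle\operatorname{Op}^{\mathrm W}_\eta(a)\psi,\overline\phi\rangle=\langle a,W_\eta(\psi,\phi)\rangle$ for Schwartz $\psi,\phi$ (for a self-adjoint trace-class operator the symbol $a$ is real and lies in $L^2(\mathbb{R}^{2n})$). $F_{\sigma,\eta}a(z)=(2\pi\eta)^{-n}\int_{\mathbb{R}^{2n}}e^{-\frac{i}{\eta}\sigma(z,z')}a(z')\,dz'$ (extended to $L^2$ by continuity). $\widehat A\ge0$ means $(\widehat A\psi|\psi)_{L^2}\ge0$ for all $\psi$. *)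

theory Defs
  imports "HOL-Analysis.Analysis"
begin

type_synonym 'n phase = "(real^'n) \<times> (real^'n)"

definition sympl :: "'n::finite phase \<Rightarrow> 'n phase \<Rightarrow> real" where
  "sympl z z' = snd z \<bullet> fst z' - snd z' \<bullet> fst z"

definition L2 :: "('a::euclidean_space \<Rightarrow> complex) \<Rightarrow> bool" where
  "L2 f \<longleftrightarrow> f \<in> borel_measurable lborel \<and> integrable lborel (\<lambda>x. (norm (f x))\<^sup>2)"

definition inner_L2 :: "('a::euclidean_space \<Rightarrow> complex) \<Rightarrow> ('a \<Rightarrow> complex) \<Rightarrow> complex" where
  "inner_L2 f g = (\<integral>x. f x * cnj (g x) \<partial>lborel)"

definition orthonormal_seq :: "(nat \<Rightarrow> ('a::euclidean_space \<Rightarrow> complex)) \<Rightarrow> bool" where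
  "orthonormal_seq e \<longleftrightarrow> (\<forall>i. L2 (e i)) \<and>
     (\<forall>i j. inner_L2 (e i) (e j) = (if i = j then 1 else 0))"

definition wigner :: "real \<Rightarrow> (real^'n::finite \<Rightarrow> complex) \<Rightarrow> (real^'n \<Rightarrow> complex)
    \<Rightarrow> 'n phase \<Rightarrow> complex" where
  "wigner \<eta> \<psi> \<phi> z =
     complex_of_real ((2 * pi * \<eta>) powr (- real CARD('n))) *
     (\<integral>y. exp (- \<i> * complex_of_real ((snd z \<bullet> y) / \<eta>)) *
            \<psi> (fst z + (1/2) *\<^sub>R y) * cnj (\<phi> (fst z - (1/2) *\<^sub>R y)) \<partial>lborel)"

text \<open>The sesquilinear form (Op(a) psi | phi) = <a, W(psi,phi)>\<close>
definition weyl_form :: "real \<Rightarrow> ('n::finite phase \<Rightarrow> real) \<Rightarrow> (real^'n \<Rightarrow> complex)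
    \<Rightarrow> (real^'n \<Rightarrow> complex) \<Rightarrow> complex" where
  "weyl_form \<eta> a \<psi> \<phi> = (\<integral>z. complex_of_real (a z) * wigner \<eta> \<psi> \<phi> z \<partial>lborel)"

text \<open>Trace class, via the trace norm sup_{(e_i),(f_i) orthonormal} sum |(A e_i | f_i)|\<close>
definition weyl_trace_class :: "real \<Rightarrow> ('n::finite phase \<Rightarrow> real) \<Rightarrow> bool" where
  "weyl_trace_class \<eta> a \<longleftrightarrow> (\<exists>C. \<forall>e f. orthonormal_seq e \<longrightarrow> orthonormal_seq f \<longrightarrow>
      (\<forall>N. (\<Sum>i<N. cmod (weyl_form \<eta> a (e i) (f i))) \<le> C))"

definition nonneg_c :: "complex \<Rightarrow> bool" where
  "nonneg_c w \<longleftrightarrow> Im w = 0 \<and> 0 \<le> Re w"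

definition weyl_nonneg :: "real \<Rightarrow> ('n::finite phase \<Rightarrow> real) \<Rightarrow> bool" where
  "weyl_nonneg \<eta> a \<longleftrightarrow> (\<forall>\<psi>. L2 \<psi> \<longrightarrow> nonneg_c (weyl_form \<eta> a \<psi> \<psi>))"

definition sympl_FT :: "real \<Rightarrow> ('n::finite phase \<Rightarrow> complex) \<Rightarrow> 'n phase \<Rightarrow> complex" where
  "sympl_FT \<eta> a z = complex_of_real ((2 * pi * \<eta>) powr (- real CARD('n))) *
     (\<integral>z'. exp (- \<i> * complex_of_real (sympl z z' / \<eta>)) * a z' \<partial>lborel)"

text \<open>Extension to L2 by continuity: b is the L2-limit of the transforms of the truncations\<close>
definition is_sympl_FT_L2 :: "real \<Rightarrow> ('n::finite phase \<Rightarrow> complex) \<Rightarrow> ('n phase \<Rightarrow> complex) \<Rightarrow> bool" where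
  "is_sympl_FT_L2 \<eta> a b \<longleftrightarrow> L2 b \<and>
     (\<lambda>k::nat. \<integral>z. (norm (sympl_FT \<eta> (\<lambda>w. indicator (cball 0 (real k)) w * a w) z - b z))\<^sup>2 \<partial>lborel)
       \<longlonglongrightarrow> 0"

definition sympl_FT_L2 :: "real \<Rightarrow> ('n::finite phase \<Rightarrow> complex) \<Rightarrow> 'n phase \<Rightarrow> complex" where
  "sympl_FT_L2 \<eta> a = (SOME b. is_sympl_FT_L2 \<eta> a b)"

definition twisted_corr :: "real \<Rightarrow> ('n::finite phase \<Rightarrow> complex) \<Rightarrow> 'n phase \<Rightarrow> complex" where
  "twisted_corr \<eta> c z = (\<integral>z'. exp (- \<i> * complex_of_real (sympl z z' / (2 * \<eta>))) *
        c (z' - z) * cnj (c z') \<partial>lborel)"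

end

theory Submission
  imports Defs "HOL-Probability.Characteristic_Functions"
begin

text \<open>
  A function \<open>c\<close> in L2 on phase space is the twisted symbol of a Hilbert-Schmidt operator with some
  kernel \<open>k\<close>, and its twisted correlation is the superposition over \<open>u\<close> of the ambiguity
  functions of the slices \<open>k(u, _)\<close>. Since the symplectic Fourier transform exchanges ambiguity and
  Wigner functions, pairing it with the transform of \<open>a\<close> gives
  \<open>\<integral>\<^sub>u (A \<psi>\<^sub>u | \<psi>\<^sub>u) du\<close> with \<open>\<psi>\<^sub>u\<close> the conjugate of \<open>k(u, _)\<close>, i.e. a trace of
  \<open>A\<close> against a positive operator. This yields one implication; rank-one kernels yield the other.
  The identity is proved for bounded compactly supported \<open>k\<close>, where only Plancherel's theorem for
  integrable functions is needed, and the general case follows by density: under L2 convergence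
  of \<open>c\<close> (or \<open>\<psi>\<close>) the correlations (or Wigner functions) converge uniformly and stay bounded
  in L2, hence converge weakly.
\<close>

section \<open>Square-integrable functions\<close>

text \<open>By Cauchy-Schwarz a twisted correlation of L2 functions is bounded, but pairing it with
  an L2 function requires more, since phase space has infinite measure. The missing L2 bound comes
  from the operator side: up to a partial Fourier transform and a conjugation, the correlation is
  the kernel of K*K for the operator K with kernel \<open>k\<close>, and the Hilbert-Schmidt norm of
  K*K is at most the square of that of K. Differences are estimated only in the sup norm, where both
  quadratic maps are easily seen to be continuous; the L2 bound then turns uniform into weak
  convergence. The slices are conjugated because the transform that comes out of the twisted
  correlation has the phase sign opposite to that in the Wigner function. All Fourier analysis rests
  on the norm identity of Plancherel. Inversion enters only once, in the density of the symbols, and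
  is extracted from that identity by expanding the square of a distance.\<close>

definition norm_L2 :: "('a::euclidean_space \<Rightarrow> complex) \<Rightarrow> real" where
  "norm_L2 f = sqrt (\<integral>x. (norm (f x))\<^sup>2 \<partial>lborel)"

lemma norm_L2_nonneg [simp]: "0 \<le> norm_L2 f"
  by (simp add: norm_L2_def)

lemma norm_L2_square: "(norm_L2 f)\<^sup>2 = (\<integral>x. (norm (f x))\<^sup>2 \<partial>lborel)"
  by (simp add: norm_L2_def)

lemma L2_measurable [measurable_dest]: "L2 f \<Longrightarrow> f \<in> borel_measurable borel"
  by (simp add: L2_def)

lemma L2_integrable: "L2 f \<Longrightarrow> integrable lborel (\<lambda>x. (norm (f x))\<^sup>2)"
  by (simp add: L2_def)

lemma L2I: "f \<in> borel_measurable borel \<Longrightarrow> integrable lborel (\<lambda>x. (norm (f x))\<^sup>2) \<Longrightarrow> L2 f"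
  by (simp add: L2_def)

lemma measurable_cnj [measurable (raw)]:
  "f \<in> borel_measurable M \<Longrightarrow> (\<lambda>x. cnj (f x)) \<in> borel_measurable M"
  by (rule measurable_compose[OF _ borel_measurable_continuous_onI[OF continuous_on_cnj[OF continuous_on_id]]])

lemma L2_bound:
  fixes f g :: "'a::euclidean_space \<Rightarrow> complex"
  assumes "L2 f" "g \<in> borel_measurable borel" "\<And>x. norm (g x) \<le> C * norm (f x)"
  shows "L2 g"
proof (rule L2I)
  show "integrable lborel (\<lambda>x. (norm (g x))\<^sup>2)"
  proof (rule Bochner_Integration.integrable_bound)
    show "integrable lborel (\<lambda>x. C\<^sup>2 * (norm (f x))\<^sup>2)"
      using L2_integrable[OF assms(1)] by simp
    show "AE x in lborel. norm ((norm (g x))\<^sup>2) \<le> norm (C\<^sup>2 * (norm (f x))\<^sup>2)"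
      using power_mono[OF assms(3) norm_ge_zero, where n=2] by (auto simp: power_mult_distrib)
  qed (use assms in measurable)
qed (use assms in auto)

lemma sum_power2_norm_le: "(norm (a + b :: complex))\<^sup>2 \<le> 2 * (norm a)\<^sup>2 + 2 * (norm b)\<^sup>2"
proof -
  have "(norm (a + b))\<^sup>2 \<le> (norm a + norm b)\<^sup>2"
    by (intro power_mono norm_triangle_ineq) auto
  also have "\<dots> \<le> 2 * (norm a)\<^sup>2 + 2 * (norm b)\<^sup>2"
    using sum_squares_bound[of "norm a" "norm b"] by (simp add: power2_sum)
  finally show ?thesis .
qed

lemma L2_add:
  assumes "L2 f" "L2 g" shows "L2 (\<lambda>x. f x + g x)"
proof (rule L2I)
  show "integrable lborel (\<lambda>x. (norm (f x + g x))\<^sup>2)"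
  proof (rule Bochner_Integration.integrable_bound)
    show "integrable lborel (\<lambda>x. 2 * (norm (f x))\<^sup>2 + 2 * (norm (g x))\<^sup>2)"
      using L2_integrable[OF assms(1)] L2_integrable[OF assms(2)] by simp
    show "AE x in lborel. norm ((norm (f x + g x))\<^sup>2) \<le> norm (2 * (norm (f x))\<^sup>2 + 2 * (norm (g x))\<^sup>2)"
      using sum_power2_norm_le by (intro AE_I2) (auto intro: order_trans)
  qed (use assms in measurable)
qed (use assms in measurable)

lemma L2_cmult: "L2 f \<Longrightarrow> L2 (\<lambda>x. c * f x)"
  by (rule L2_bound[where C="norm c" and f=f]) (auto simp: norm_mult)

lemma L2_cnj: "L2 f \<Longrightarrow> L2 (\<lambda>x. cnj (f x))"
  by (rule L2_bound[where C=1 and f=f]) (auto simp: L2_def)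

lemma L2_diff: "L2 f \<Longrightarrow> L2 g \<Longrightarrow> L2 (\<lambda>x. f x - g x)"
  using L2_add[of f "\<lambda>x. (-1) * g x"] L2_cmult[of g "-1"] by simp

lemma norm_L2_cong: "(\<And>x. norm (f x) = norm (g x)) \<Longrightarrow> norm_L2 f = norm_L2 g"
  by (simp add: norm_L2_def)

lemma norm_L2_cmult: "norm_L2 (\<lambda>x. c * f x) = norm c * norm_L2 f"
  by (simp add: norm_L2_def norm_mult power_mult_distrib real_sqrt_mult)

text \<open>\<open>norm_L2\<close> is 0 on a measurable function whose square is not integrable, so
  monotonicity rests on \<open>g\<close> being in L2, which then puts \<open>f\<close> there as
  well.\<close>

lemma norm_L2_mono:
  assumes "L2 g" "f \<in> borel_measurable borel" "\<And>x. norm (f x) \<le> norm (g x)"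
  shows "norm_L2 f \<le> norm_L2 g"
proof -
  have "L2 f"
    by (rule L2_bound[where C=1, OF assms(1,2)]) (use assms(3) in auto)
  then show ?thesis
    unfolding norm_L2_def using assms
    by (intro real_sqrt_le_mono integral_mono L2_integrable power_mono) auto
qed

lemma L2_mult_integrable:
  assumes "L2 f" "L2 g" shows "integrable lborel (\<lambda>x. f x * g x)"
proof (rule Bochner_Integration.integrable_bound)
  show "integrable lborel (\<lambda>x. (norm (f x))\<^sup>2 + (norm (g x))\<^sup>2)"
    using L2_integrable[OF assms(1)] L2_integrable[OF assms(2)] by simp
  have "norm (f x) * norm (g x) \<le> (norm (f x))\<^sup>2 + (norm (g x))\<^sup>2" for x
    using sum_squares_bound[of "norm (f x)" "norm (g x)"]
      mult_nonneg_nonneg[OF norm_ge_zero[of "f x"] norm_ge_zero[of "g x"]] by linarith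
  then show "AE x in lborel. norm (f x * g x) \<le> norm ((norm (f x))\<^sup>2 + (norm (g x))\<^sup>2)"
    by (auto simp: norm_mult intro: order_trans)
qed (use assms in measurable)

lemma norm_L2_Cauchy_Schwarz:
  assumes "L2 f" "L2 g"
  shows "(\<integral>x. norm (f x) * norm (g x) \<partial>lborel) \<le> norm_L2 f * norm_L2 g"
proof -
  let ?I = "\<integral>x. norm (f x) * norm (g x) \<partial>lborel"
  have [measurable]: "f \<in> borel_measurable borel" "g \<in> borel_measurable borel"
    using assms by auto
  have int: "integrable lborel (\<lambda>x. norm (f x) * norm (g x))"
    using integrable_norm[OF L2_mult_integrable[OF assms]] by (simp add: norm_mult)
  have I0: "0 \<le> ?I" by simp
  have sq: "(\<integral>\<^sup>+x. ennreal (norm (h x))^2 \<partial>lborel) = ennreal ((norm_L2 h)\<^sup>2)" if "L2 h" for h :: "'a \<Rightarrow> complex"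
    unfolding norm_L2_square
    by (subst nn_integral_eq_integral[symmetric, OF L2_integrable[OF that]]) (auto simp: ennreal_power)
  have "ennreal (?I\<^sup>2) = (\<integral>\<^sup>+x. ennreal (norm (f x)) * ennreal (norm (g x)) \<partial>lborel)\<^sup>2"
    using nn_integral_eq_integral[OF int] I0
    by (simp add: ennreal_mult[symmetric] ennreal_power)
  also have "\<dots> \<le> (\<integral>\<^sup>+x. ennreal (norm (f x))^2 \<partial>lborel) * (\<integral>\<^sup>+x. ennreal (norm (g x))^2 \<partial>lborel)"
    by (rule Cauchy_Schwarz_nn_integral) auto
  also have "\<dots> = ennreal ((norm_L2 f * norm_L2 g)\<^sup>2)"
    by (simp add: sq assms ennreal_mult[symmetric] power_mult_distrib)
  finally have "?I\<^sup>2 \<le> (norm_L2 f * norm_L2 g)\<^sup>2"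
    by (subst (asm) ennreal_le_iff) auto
  then show ?thesis
    by (rule power2_le_imp_le) auto
qed

lemma norm_integral_mult_le:
  assumes "L2 f" "L2 g"
  shows "norm (\<integral>x. f x * g x \<partial>lborel) \<le> norm_L2 f * norm_L2 g"
  using integral_norm_bound[of lborel "\<lambda>x. f x * g x"] norm_L2_Cauchy_Schwarz[OF assms]
  by (simp add: norm_mult)

lemma norm_L2_triangle:
  assumes "L2 f" "L2 g"
  shows "norm_L2 (\<lambda>x. f x + g x) \<le> norm_L2 f + norm_L2 g"
proof (rule power2_le_imp_le)
  have int: "integrable lborel (\<lambda>x. norm (f x) * norm (g x))"
    using integrable_norm[OF L2_mult_integrable[OF assms]] by (simp add: norm_mult)
  have "(norm_L2 (\<lambda>x. f x + g x))\<^sup>2 \<le>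
      (\<integral>x. (norm (f x))\<^sup>2 + (norm (g x))\<^sup>2 + 2 * (norm (f x) * norm (g x)) \<partial>lborel)"
    unfolding norm_L2_square
  proof (rule integral_mono)
    fix x
    have "(norm (f x + g x))\<^sup>2 \<le> (norm (f x) + norm (g x))\<^sup>2"
      by (intro power_mono norm_triangle_ineq) auto
    then show "(norm (f x + g x))\<^sup>2 \<le> (norm (f x))\<^sup>2 + (norm (g x))\<^sup>2 + 2 * (norm (f x) * norm (g x))"
      by (simp add: power2_sum algebra_simps)
  qed (use int L2_integrable[OF assms(1)] L2_integrable[OF assms(2)] L2_integrable[OF L2_add[OF assms]] in auto)
  also have "\<dots> = (norm_L2 f)\<^sup>2 + (norm_L2 g)\<^sup>2 + 2 * (\<integral>x. norm (f x) * norm (g x) \<partial>lborel)"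
    using int L2_integrable[OF assms(1)] L2_integrable[OF assms(2)] by (simp add: norm_L2_square)
  also have "\<dots> \<le> (norm_L2 f)\<^sup>2 + (norm_L2 g)\<^sup>2 + 2 * (norm_L2 f * norm_L2 g)"
    using norm_L2_Cauchy_Schwarz[OF assms] by simp
  finally show "(norm_L2 (\<lambda>x. f x + g x))\<^sup>2 \<le> (norm_L2 f + norm_L2 g)\<^sup>2"
    by (simp add: power2_sum algebra_simps)
qed simp

lemma norm_L2_minus_commute: "norm_L2 (\<lambda>x. f x - g x) = norm_L2 (\<lambda>x. g x - f x)"
  by (rule norm_L2_cong) (simp add: norm_minus_commute)

lemma norm_L2_triangle_diff:
  assumes "L2 f" "L2 g" "L2 h"
  shows "norm_L2 (\<lambda>x. f x - h x) \<le> norm_L2 (\<lambda>x. f x - g x) + norm_L2 (\<lambda>x. g x - h x)"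
  using norm_L2_triangle[of "\<lambda>x. f x - g x" "\<lambda>x. g x - h x"] assms by (simp add: L2_diff)

lemma norm_L2_le_add_diff:
  assumes "L2 f" "L2 g"
  shows "norm_L2 f \<le> norm_L2 g + norm_L2 (\<lambda>x. f x - g x)"
  using norm_L2_triangle[of g "\<lambda>x. f x - g x"] assms by (simp add: L2_diff)

lemma tendsto_norm_L2:
  assumes "\<And>n. L2 (f n)" "L2 g" "(\<lambda>n. norm_L2 (\<lambda>x. f n x - g x)) \<longlonglongrightarrow> 0"
  shows "(\<lambda>n. norm_L2 (f n)) \<longlonglongrightarrow> norm_L2 g"
proof (rule LIMSEQ_I)
  fix e :: real assume "e > 0"
  then obtain N where N: "\<And>n. n \<ge> N \<Longrightarrow> norm_L2 (\<lambda>x. f n x - g x) < e"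
    using LIMSEQ_D[OF assms(3)] by force
  have "norm (norm_L2 (f n) - norm_L2 g) < e" if "n \<ge> N" for n
    using norm_L2_le_add_diff[OF assms(1)[of n] assms(2)]
      norm_L2_le_add_diff[OF assms(2) assms(1)[of n]] N[OF that]
      norm_L2_minus_commute[of "f n" g] by (auto simp: abs_le_iff)
  then show "\<exists>N. \<forall>n\<ge>N. norm (norm_L2 (f n) - norm_L2 g) < e" by blast
qed

lemma tendsto_integral_mult_L2:
  assumes "\<And>n. L2 (f n)" "L2 g" "L2 h" "(\<lambda>n. norm_L2 (\<lambda>x. f n x - g x)) \<longlonglongrightarrow> 0"
  shows "(\<lambda>n. \<integral>x. f n x * h x \<partial>lborel) \<longlonglongrightarrow> (\<integral>x. g x * h x \<partial>lborel)"
proof (rule LIM_zero_cancel, rule Lim_null_comparison)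
  have "norm ((\<integral>x. f n x * h x \<partial>lborel) - (\<integral>x. g x * h x \<partial>lborel))
      = norm (\<integral>x. (f n x - g x) * h x \<partial>lborel)" for n
    using L2_mult_integrable[OF assms(1,3)] L2_mult_integrable[OF assms(2,3)]
    by (simp add: left_diff_distrib)
  then show "\<forall>\<^sub>F n in sequentially. norm ((\<integral>x. f n x * h x \<partial>lborel) - (\<integral>x. g x * h x \<partial>lborel))
      \<le> norm_L2 (\<lambda>x. f n x - g x) * norm_L2 h"
    using norm_integral_mult_le[OF L2_diff[OF assms(1,2)] assms(3)] by auto
  show "(\<lambda>n. norm_L2 (\<lambda>x. f n x - g x) * norm_L2 h) \<longlonglongrightarrow> 0"
    using tendsto_mult_right[OF assms(4), of "norm_L2 h"] by simp
qed

text \<open>Fatou's lemma for the squared norms. Only pointwise convergence is assumed, so the bound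
  passes to limits that are not known to be limits in norm; this serves both completeness and weak
  convergence.\<close>

lemma L2_Fatou:
  assumes "\<And>n. L2 (f n)" "g \<in> borel_measurable borel" "AE x in lborel. (\<lambda>n. f n x) \<longlonglongrightarrow> g x"
    and bd: "\<And>n. norm_L2 (f n) \<le> B"
  shows "L2 g" "norm_L2 g \<le> B"
proof -
  have [measurable]: "f n \<in> borel_measurable borel" for n
    using assms(1)[of n] by auto
  note [measurable] = assms(2)
  have B0: "0 \<le> B" using bd[of 0] norm_L2_nonneg[of "f 0"] by linarith
  have "(\<integral>\<^sup>+x. ennreal ((norm (g x))\<^sup>2) \<partial>lborel) = (\<integral>\<^sup>+x. liminf (\<lambda>n. ennreal ((norm (f n x))\<^sup>2)) \<partial>lborel)"
  proof (rule nn_integral_cong_AE)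
    show "AE x in lborel. ennreal ((norm (g x))\<^sup>2) = liminf (\<lambda>n. ennreal ((norm (f n x))\<^sup>2))"
      using assms(3)
    proof eventually_elim
      fix x assume "(\<lambda>n. f n x) \<longlonglongrightarrow> g x"
      then have "(\<lambda>n. ennreal ((norm (f n x))\<^sup>2)) \<longlonglongrightarrow> ennreal ((norm (g x))\<^sup>2)"
        by (intro tendsto_ennrealI tendsto_intros)
      from lim_imp_Liminf[OF sequentially_bot this]
      show "ennreal ((norm (g x))\<^sup>2) = liminf (\<lambda>n. ennreal ((norm (f n x))\<^sup>2))" by simp
    qed
  qed
  also have "\<dots> \<le> liminf (\<lambda>n. \<integral>\<^sup>+x. ennreal ((norm (f n x))\<^sup>2) \<partial>lborel)"
    by (rule nn_integral_liminf) measurable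
  also have "\<dots> \<le> liminf (\<lambda>n::nat. ennreal (B\<^sup>2))"
  proof (rule Liminf_mono, rule always_eventually, rule allI)
    fix n
    have "(\<integral>\<^sup>+x. ennreal ((norm (f n x))\<^sup>2) \<partial>lborel) = ennreal ((norm_L2 (f n))\<^sup>2)"
      unfolding norm_L2_square by (rule nn_integral_eq_integral[OF L2_integrable[OF assms(1)]]) auto
    also have "\<dots> \<le> ennreal (B\<^sup>2)"
      using bd[of n] by (intro ennreal_leI power_mono) auto
    finally show "(\<integral>\<^sup>+x. ennreal ((norm (f n x))\<^sup>2) \<partial>lborel) \<le> ennreal (B\<^sup>2)" .
  qed
  also have "\<dots> = ennreal (B\<^sup>2)"
    by (intro Liminf_const) auto
  finally have *: "(\<integral>\<^sup>+x. ennreal ((norm (g x))\<^sup>2) \<partial>lborel) \<le> ennreal (B\<^sup>2)" .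
  show "L2 g"
  proof (rule L2I)
    show "integrable lborel (\<lambda>x. (norm (g x))\<^sup>2)"
      by (rule integrableI_nonneg) (use * in \<open>auto intro: le_less_trans\<close>)
  qed (rule assms)
  then have "ennreal ((norm_L2 g)\<^sup>2) \<le> ennreal (B\<^sup>2)"
    using * nn_integral_eq_integral[OF L2_integrable[OF \<open>L2 g\<close>]] by (simp add: norm_L2_square)
  then have "(norm_L2 g)\<^sup>2 \<le> B\<^sup>2"
    by (subst (asm) ennreal_le_iff) auto
  then show "norm_L2 g \<le> B"
    using B0 by (rule power2_le_imp_le)
qed

text \<open>The working class of the proof. Its members are in L1 and in L2, so Plancherel and
  Fubini apply at once, and it is stable under sections, shears, tensor products and integrating out
  a variable. Continuity is not demanded, so plain truncations belong to it and it is dense in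
  L2.\<close>

definition bounded_cs :: "('a::euclidean_space \<Rightarrow> complex) \<Rightarrow> bool" where
  "bounded_cs f \<longleftrightarrow> f \<in> borel_measurable borel \<and>
     (\<exists>M R. \<forall>x. norm (f x) \<le> M \<and> (R < norm x \<longrightarrow> f x = 0))"

lemma bounded_csI:
  assumes "f \<in> borel_measurable borel" "\<And>x. norm (f x) \<le> M" "\<And>x. R < norm x \<Longrightarrow> f x = 0"
  shows "bounded_cs f"
  using assms unfolding bounded_cs_def by blast

lemma bounded_csE:
  assumes "bounded_cs f"
  obtains M R where "f \<in> borel_measurable borel" "0 \<le> M" "0 \<le> R" "\<And>x. norm (f x) \<le> M"
    "\<And>x. R < norm x \<Longrightarrow> f x = 0"
proof -
  obtain M R where *: "f \<in> borel_measurable borel" "\<And>x. norm (f x) \<le> M" "\<And>x. R < norm x \<Longrightarrow> f x = 0"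
    using assms unfolding bounded_cs_def by blast
  have "0 \<le> M" using *(2)[of undefined] norm_ge_zero[of "f undefined"] by linarith
  then show ?thesis using that[of M "max R 0"] * by simp
qed

lemma bounded_cs_measurable [measurable_dest]: "bounded_cs f \<Longrightarrow> f \<in> borel_measurable borel"
  by (simp add: bounded_cs_def)

lemma bounded_cs_integrable:
  assumes "bounded_cs f" shows "integrable lborel f"
proof -
  obtain M R where *: "f \<in> borel_measurable borel" "0 \<le> M" "\<And>x. norm (f x) \<le> M"
    "\<And>x. R < norm x \<Longrightarrow> f x = 0"
    using assms by (rule bounded_csE) blast
  have "integrable lborel (\<lambda>x::'a. indicator (cball 0 R) x *\<^sub>R M)"
    by (rule borel_integrable_compact) auto
  then show ?thesis
  proof (rule Bochner_Integration.integrable_bound)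
    show "AE x in lborel. norm (f x) \<le> norm (indicator (cball 0 R) x *\<^sub>R M)"
      using * by (intro AE_I2) (auto simp: indicator_def)
  qed (use * in auto)
qed

lemma bounded_cs_mult_bounded:
  assumes "bounded_cs f" "g \<in> borel_measurable borel" "\<And>x. norm (g x) \<le> C"
  shows "bounded_cs (\<lambda>x. g x * f x)"
proof -
  obtain M R where *: "f \<in> borel_measurable borel" "0 \<le> M" "\<And>x. norm (f x) \<le> M"
    "\<And>x. R < norm x \<Longrightarrow> f x = 0"
    using assms(1) by (rule bounded_csE) blast
  have "0 \<le> C" using assms(3)[of undefined] norm_ge_zero[of "g undefined"] by linarith
  then show ?thesis
    using assms * by (intro bounded_csI[where M="C * M" and R=R]) (auto simp: norm_mult intro!: mult_mono)
qed

lemma bounded_cs_mult: "bounded_cs f \<Longrightarrow> bounded_cs g \<Longrightarrow> bounded_cs (\<lambda>x. f x * g x)"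
  by (metis bounded_csE bounded_cs_mult_bounded)

lemma bounded_cs_cnj: "bounded_cs f \<Longrightarrow> bounded_cs (\<lambda>x. cnj (f x))"
  by (erule bounded_csE, rule bounded_csI) (auto intro: measurable_cnj)

lemma bounded_cs_L2:
  assumes "bounded_cs f" shows "L2 f"
proof (rule L2I)
  have "integrable lborel (\<lambda>x. f x * cnj (f x))"
    by (intro bounded_cs_integrable bounded_cs_mult bounded_cs_cnj assms)
  then have "integrable lborel (\<lambda>x. norm (f x * cnj (f x)))"
    by (rule integrable_norm)
  then show "integrable lborel (\<lambda>x. (norm (f x))\<^sup>2)"
    by (simp add: norm_mult power2_eq_square)
qed (use assms in auto)

text \<open>Argument and value are both cut, which makes the result bounded with bounded support.
  The cut in \<open>is_sympl_FT_L2\<close> restricts the argument alone and may leave an unbounded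
  function.\<close>

definition L2_trunc :: "nat \<Rightarrow> ('a::euclidean_space \<Rightarrow> complex) \<Rightarrow> 'a \<Rightarrow> complex" where
  "L2_trunc n f x = (if norm x \<le> real n \<and> norm (f x) \<le> real n then f x else 0)"

lemma bounded_cs_L2_trunc:
  assumes [measurable]: "f \<in> borel_measurable borel"
  shows "bounded_cs (L2_trunc n f)"
  by (rule bounded_csI[where M=n and R=n]) (auto simp: L2_trunc_def[abs_def])

lemma L2_dominated_tendsto:
  assumes "L2 f" "\<And>n. g n \<in> borel_measurable borel"
    and le: "\<And>n x. norm (g n x) \<le> norm (f x)"
    and lim: "\<And>x. (\<lambda>n. g n x) \<longlonglongrightarrow> f x"
  shows "(\<lambda>n. norm_L2 (\<lambda>x. g n x - f x)) \<longlonglongrightarrow> 0"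
proof -
  have [measurable]: "f \<in> borel_measurable borel" using assms by auto
  note [measurable] = assms(2)
  have "(\<lambda>n. \<integral>x. (norm (g n x - f x))\<^sup>2 \<partial>lborel) \<longlonglongrightarrow> (\<integral>x. 0 \<partial>(lborel::'a measure))"
  proof (rule integral_dominated_convergence)
    show "integrable lborel (\<lambda>x. 4 * (norm (f x))\<^sup>2)"
      using L2_integrable[OF assms(1)] by simp
    show "AE x in lborel. (\<lambda>n. (norm (g n x - f x))\<^sup>2) \<longlonglongrightarrow> 0"
    proof (rule AE_I2)
      fix x
      have "(\<lambda>n. (norm (g n x - f x))\<^sup>2) \<longlonglongrightarrow> (norm (f x - f x))\<^sup>2"
        by (intro tendsto_intros lim)
      then show "(\<lambda>n. (norm (g n x - f x))\<^sup>2) \<longlonglongrightarrow> 0" by simp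
    qed
    fix n
    have "(norm (g n x - f x))\<^sup>2 \<le> 4 * (norm (f x))\<^sup>2" for x
    proof -
      have "norm (g n x - f x) \<le> 2 * norm (f x)"
        using norm_triangle_ineq4[of "g n x" "f x"] le[of n x] by linarith
      from power_mono[OF this norm_ge_zero, of 2] show ?thesis by (simp add: power_mult_distrib)
    qed
    then show "AE x in lborel. norm ((norm (g n x - f x))\<^sup>2) \<le> 4 * (norm (f x))\<^sup>2" by simp
  qed measurable
  then have "(\<lambda>n. sqrt (\<integral>x. (norm (g n x - f x))\<^sup>2 \<partial>lborel)) \<longlonglongrightarrow> sqrt 0"
    by (intro tendsto_intros) simp
  then show ?thesis unfolding norm_L2_def by simp
qed

lemma norm_L2_trunc_tendsto:
  assumes "L2 f"
  shows "(\<lambda>n. norm_L2 (\<lambda>x. L2_trunc n f x - f x)) \<longlonglongrightarrow> 0"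
proof (rule L2_dominated_tendsto[OF assms])
  show "L2_trunc n f \<in> borel_measurable borel" for n
    using bounded_cs_L2_trunc[OF L2_measurable[OF assms], of n] by auto
  show "norm (L2_trunc n f x) \<le> norm (f x)" for n x
    by (simp add: L2_trunc_def)
  fix x
  obtain N :: nat where N: "max (norm x) (norm (f x)) \<le> real N"
    using real_arch_simple by blast
  have "\<forall>\<^sub>F n in sequentially. L2_trunc n f x = f x"
    using N by (intro eventually_sequentiallyI[of N]) (auto simp: L2_trunc_def)
  then show "(\<lambda>n. L2_trunc n f x) \<longlonglongrightarrow> f x"
    by (rule tendsto_eventually)
qed

text \<open>Uniform convergence handles the pairing with an integrable function, and the L2 bound
  makes replacing \<open>f\<close> by an integrable truncation cheap uniformly in \<open>n\<close>.
  Neither ingredient suffices alone.\<close>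

lemma L2_weak_convergence:
  assumes f: "L2 f" and g: "\<And>n. L2 (g n)" and bd: "\<And>n. norm_L2 (g n) \<le> B"
    and h [measurable]: "h \<in> borel_measurable borel"
    and unif: "\<And>n x. norm (g n x - h x) \<le> e n" and e: "e \<longlonglongrightarrow> 0"
  shows "L2 h" "(\<lambda>n. \<integral>x. f x * g n x \<partial>lborel) \<longlonglongrightarrow> (\<integral>x. f x * h x \<partial>lborel)"
proof -
  have "(\<lambda>n. g n x - h x) \<longlonglongrightarrow> 0" for x
    by (rule Lim_null_comparison[OF always_eventually e]) (use unif in auto)
  then have ptw: "(\<lambda>n. g n x) \<longlonglongrightarrow> h x" for x
    by (rule LIM_zero_cancel)
  have ae: "AE x in lborel. (\<lambda>n. g n x) \<longlonglongrightarrow> h x"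
    using ptw by simp
  note h2 = L2_Fatou[OF g h ae bd]
  show "L2 h" by (rule h2)
  have B0: "0 \<le> B" using bd[of 0] norm_L2_nonneg[of "g 0"] by linarith
  have e0: "0 \<le> e n" for n
    using unif[of n undefined] norm_ge_zero[of "g n undefined - h undefined"] by linarith
  have fm [measurable]: "f \<in> borel_measurable borel" using f by auto
  \<comment> \<open>The cut-off \<open>m\<close> is independent of \<open>n\<close>. The discarded
    tail of \<open>f\<close> is paired with \<open>g n - h\<close>, whose norm is at most
    \<open>2 * B\<close> because Fatou gives \<open>h\<close> the bound \<open>B\<close>
    too.\<close>
  have key: "norm ((\<integral>x. f x * g n x \<partial>lborel) - (\<integral>x. f x * h x \<partial>lborel))
      \<le> norm_L2 (\<lambda>x. L2_trunc m f x - f x) * (2 * B) + (\<integral>x. norm (L2_trunc m f x) \<partial>lborel) * e n" for n m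
  proof -
    let ?t = "L2_trunc m f"
    have t: "bounded_cs ?t" by (rule bounded_cs_L2_trunc) simp
    have t2: "L2 ?t" by (rule bounded_cs_L2[OF t])
    have [measurable]: "?t \<in> borel_measurable borel" using t by auto
    have [measurable]: "g n \<in> borel_measurable borel" using g[of n] by auto
    have gh: "L2 (\<lambda>x. g n x - h x)" by (rule L2_diff[OF g h2(1)])
    have nn: "norm_L2 (\<lambda>x. g n x - h x) \<le> 2 * B"
      using norm_L2_triangle[OF g[of n] L2_cmult[OF h2(1), of "-1"]] bd[of n] h2(2)
        norm_L2_cmult[of "-1" h] by simp
    have "(\<integral>x. f x * g n x \<partial>lborel) - (\<integral>x. f x * h x \<partial>lborel) = (\<integral>x. f x * (g n x - h x) \<partial>lborel)"
      using L2_mult_integrable[OF f g] L2_mult_integrable[OF f h2(1)] by (simp add: right_diff_distrib)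
    also have "\<dots> = (\<integral>x. ?t x * (g n x - h x) - (?t x - f x) * (g n x - h x) \<partial>lborel)"
      by (simp add: algebra_simps)
    also have "\<dots> = (\<integral>x. ?t x * (g n x - h x) \<partial>lborel) - (\<integral>x. (?t x - f x) * (g n x - h x) \<partial>lborel)"
      using L2_mult_integrable[OF t2 gh] L2_mult_integrable[OF L2_diff[OF t2 f] gh]
      by (rule Bochner_Integration.integral_diff)
    finally have eq: "(\<integral>x. f x * g n x \<partial>lborel) - (\<integral>x. f x * h x \<partial>lborel) =
        (\<integral>x. ?t x * (g n x - h x) \<partial>lborel) - (\<integral>x. (?t x - f x) * (g n x - h x) \<partial>lborel)" .
    have "norm ((\<integral>x. f x * g n x \<partial>lborel) - (\<integral>x. f x * h x \<partial>lborel)) \<le>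
        norm (\<integral>x. ?t x * (g n x - h x) \<partial>lborel) + norm (\<integral>x. (?t x - f x) * (g n x - h x) \<partial>lborel)"
      unfolding eq by (rule norm_triangle_ineq4)
    also have "norm (\<integral>x. ?t x * (g n x - h x) \<partial>lborel) \<le> (\<integral>x. norm (?t x) * e n \<partial>lborel)"
    proof (rule Bochner_Integration.integral_norm_bound_integral)
      show "integrable lborel (\<lambda>x. norm (?t x) * e n)"
        using bounded_cs_integrable[OF t] by simp
      show "norm (?t x * (g n x - h x)) \<le> norm (?t x) * e n" for x
        using unif[of n x] by (auto simp: norm_mult intro!: mult_left_mono)
    qed (rule L2_mult_integrable[OF t2 gh])
    also have "norm (\<integral>x. (?t x - f x) * (g n x - h x) \<partial>lborel)
        \<le> norm_L2 (\<lambda>x. ?t x - f x) * norm_L2 (\<lambda>x. g n x - h x)"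
      by (rule norm_integral_mult_le[OF L2_diff[OF t2 f] gh])
    also have "\<dots> \<le> norm_L2 (\<lambda>x. ?t x - f x) * (2 * B)"
      using nn by (intro mult_left_mono) auto
    finally show ?thesis by simp
  qed
  show "(\<lambda>n. \<integral>x. f x * g n x \<partial>lborel) \<longlonglongrightarrow> (\<integral>x. f x * h x \<partial>lborel)"
  proof (rule LIMSEQ_I)
    fix r :: real assume r: "r > 0"
    have "(\<lambda>m. norm_L2 (\<lambda>x. L2_trunc m f x - f x) * (2 * B)) \<longlonglongrightarrow> 0 * (2 * B)"
      by (intro tendsto_intros norm_L2_trunc_tendsto f)
    then obtain m where m: "norm_L2 (\<lambda>x. L2_trunc m f x - f x) * (2 * B) < r / 2"
      using order_tendstoD(2)[of _ 0 sequentially "r/2"] r by (force simp: eventually_sequentially)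
    have "(\<lambda>n. (\<integral>x. norm (L2_trunc m f x) \<partial>lborel) * e n) \<longlonglongrightarrow> (\<integral>x. norm (L2_trunc m f x) \<partial>lborel) * 0"
      by (intro tendsto_intros e)
    then have "\<forall>\<^sub>F n in sequentially. (\<integral>x. norm (L2_trunc m f x) \<partial>lborel) * e n < r / 2"
      using order_tendstoD(2)[of _ 0 sequentially "r/2"] r by simp
    then obtain N where N: "\<And>n. n \<ge> N \<Longrightarrow> (\<integral>x. norm (L2_trunc m f x) \<partial>lborel) * e n < r / 2"
      by (auto simp: eventually_sequentially)
    have "norm ((\<integral>x. f x * g n x \<partial>lborel) - (\<integral>x. f x * h x \<partial>lborel)) < r" if "n \<ge> N" for n
      using key[of n m] m N[OF that] by linarith
    then show "\<exists>N. \<forall>n\<ge>N. norm ((\<integral>x. f x * g n x \<partial>lborel) - (\<integral>x. f x * h x \<partial>lborel)) < r"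
      by blast
  qed
qed

section \<open>Affine changes of variables in Lebesgue integrals\<close>

lemma lborel_integrable_affine:
  fixes f :: "'a::euclidean_space \<Rightarrow> 'b::{banach, second_countable_topology}"
  assumes f: "integrable lborel f" and c: "c \<noteq> 0"
  shows "integrable lborel (\<lambda>x. f (t + c *\<^sub>R x))"
proof -
  have [measurable]: "f \<in> borel_measurable borel" using f by auto
  have "integrable (density (distr lborel borel (\<lambda>x. t + c *\<^sub>R x)) (\<lambda>_. ennreal (\<bar>c\<bar>^DIM('a)))) f"
    using f lborel_affine[OF c, of t] by simp
  then have "integrable lborel (\<lambda>x. (\<bar>c\<bar>^DIM('a)) *\<^sub>R f (t + c *\<^sub>R x))"
    by (subst (asm) integrable_density) (auto simp: integrable_distr_eq)
  then have "integrable lborel (\<lambda>x. inverse (\<bar>c\<bar>^DIM('a)) *\<^sub>R (\<bar>c\<bar>^DIM('a)) *\<^sub>R f (t + c *\<^sub>R x))"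
    by (rule integrable_scaleR_right)
  then show ?thesis using c by simp
qed

lemma lborel_integrable_affine_iff:
  fixes f :: "'a::euclidean_space \<Rightarrow> 'b::{banach, second_countable_topology}"
  assumes c: "c \<noteq> 0"
  shows "integrable lborel (\<lambda>x. f (t + c *\<^sub>R x)) \<longleftrightarrow> integrable lborel f"
  using lborel_integrable_affine[OF _ c, of f t]
    lborel_integrable_affine[of "\<lambda>x. f (t + c *\<^sub>R x)" "1/c" "- (1/c) *\<^sub>R t"] c
  by (auto simp: algebra_simps)

lemma lborel_integral_affine:
  fixes f :: "'a::euclidean_space \<Rightarrow> 'b::{banach, second_countable_topology}"
  assumes c: "c \<noteq> 0"
  shows "(\<integral>x. f x \<partial>lborel) = \<bar>c\<bar>^DIM('a) *\<^sub>R (\<integral>x. f (t + c *\<^sub>R x) \<partial>lborel)"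
proof cases
  assume f[measurable]: "integrable lborel f" then show ?thesis
    using c f f[THEN borel_measurable_integrable] lborel_integrable_affine[OF f c, of t]
    by (subst lborel_affine[OF c, of t]) (simp add: integral_density integral_distr)
next
  \<comment> \<open>Here both integrals take the default value 0.\<close>
  assume "\<not> integrable lborel f" with c show ?thesis
    by (simp add: lborel_integrable_affine_iff not_integrable_integral_eq)
qed

lemma lborel_integral_translate:
  fixes f :: "'a::euclidean_space \<Rightarrow> 'b::{banach, second_countable_topology}"
  shows "(\<integral>x. f (x + t) \<partial>lborel) = (\<integral>x. f x \<partial>lborel)"
  using lborel_integral_affine[of 1 f t] by (simp add: add.commute)

lemma lborel_integrable_translate:
  fixes f :: "'a::euclidean_space \<Rightarrow> 'b::{banach, second_countable_topology}"
  shows "integrable lborel f \<Longrightarrow> integrable lborel (\<lambda>x. f (x + t))"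
  using lborel_integrable_affine[of f 1 t] by (simp add: add.commute)

lemma lborel_integral_reflect:
  fixes f :: "'a::euclidean_space \<Rightarrow> 'b::{banach, second_countable_topology}"
  shows "(\<integral>x. f (- x) \<partial>lborel) = (\<integral>x. f x \<partial>lborel)"
  using lborel_integral_affine[of "-1" f 0] by simp

lemma L2_translate: "L2 f \<Longrightarrow> L2 (\<lambda>x. f (x + t))"
  using lborel_integrable_translate[of "\<lambda>x. (norm (f x))\<^sup>2" t] by (auto simp: L2_def)

lemma norm_L2_translate: "norm_L2 (\<lambda>x. f (x + t)) = norm_L2 f"
  unfolding norm_L2_def using lborel_integral_translate[of "\<lambda>x. (norm (f x))\<^sup>2" t] by simp

section \<open>Continuity of translations and the Gaussian\<close>

text \<open>The functions whose translates converge in L1 form a closed set: the error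
  \<open>f - g\<close> enters twice, once translated, and translation preserves its L1 norm.\<close>

lemma translate_L1_approx:
  fixes f :: "'a::euclidean_space \<Rightarrow> complex"
  assumes f: "integrable lborel f"
    and approx: "\<And>e. e > 0 \<Longrightarrow> \<exists>g. integrable lborel g \<and> (\<integral>x. norm (f x - g x) \<partial>lborel) < e \<and>
      (\<lambda>n. \<integral>x. norm (g (x + t n) - g x) \<partial>lborel) \<longlonglongrightarrow> 0"
  shows "(\<lambda>n. \<integral>x. norm (f (x + t n) - f x) \<partial>lborel) \<longlonglongrightarrow> 0"
proof (rule LIMSEQ_I)
  fix e :: real assume e: "e > 0"
  then obtain g where g: "integrable lborel g" "(\<integral>x. norm (f x - g x) \<partial>lborel) < e / 4"
    "(\<lambda>n. \<integral>x. norm (g (x + t n) - g x) \<partial>lborel) \<longlonglongrightarrow> 0"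
    using approx[of "e/4"] by auto
  obtain N where N: "\<And>n. n \<ge> N \<Longrightarrow> (\<integral>x. norm (g (x + t n) - g x) \<partial>lborel) < e / 2"
    using LIMSEQ_D[OF g(3), of "e/2"] e by auto
  have "norm ((\<integral>x. norm (f (x + t n) - f x) \<partial>lborel) - 0) < e" if n: "n \<ge> N" for n
  proof -
    let ?d = "\<lambda>x. norm (f x - g x)"
    have d: "integrable lborel ?d" using f g by auto
    have "(\<integral>x. norm (f (x + t n) - f x) \<partial>lborel) \<le>
       (\<integral>x. ?d (x + t n) + norm (g (x + t n) - g x) + ?d x \<partial>lborel)"
    proof (rule integral_mono)
      show "integrable lborel (\<lambda>x. norm (f (x + t n) - f x))"
        using f lborel_integrable_translate[OF f] by auto
      show "integrable lborel (\<lambda>x. ?d (x + t n) + norm (g (x + t n) - g x) + ?d x)"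
        using d lborel_integrable_translate[OF d] g(1) lborel_integrable_translate[OF g(1)] by auto
      fix x
      have "f (x + t n) - f x = (f (x + t n) - g (x + t n)) + (g (x + t n) - g x) - (f x - g x)"
        by simp
      also have "norm \<dots> \<le> norm (f (x + t n) - g (x + t n)) + norm (g (x + t n) - g x) + norm (f x - g x)"
        by (intro order_trans[OF norm_triangle_ineq4] add_right_mono norm_triangle_ineq)
      finally show "norm (f (x + t n) - f x) \<le> ?d (x + t n) + norm (g (x + t n) - g x) + ?d x" .
    qed
    also have "\<dots> = (\<integral>x. ?d x \<partial>lborel) + (\<integral>x. norm (g (x + t n) - g x) \<partial>lborel) + (\<integral>x. ?d x \<partial>lborel)"
      using d lborel_integrable_translate[OF d] g(1) lborel_integrable_translate[OF g(1)]
        lborel_integral_translate[of ?d "t n"]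
      by simp
    also have "\<dots> < e" using g(2) N[OF n] by simp
    finally show ?thesis by simp
  qed
  then show "\<exists>N. \<forall>n\<ge>N. norm ((\<integral>x. norm (f (x + t n) - f x) \<partial>lborel) - 0) < e" by blast
qed

text \<open>Points near the boundary cause no trouble: the L1 distance of the two indicators is
  twice the measure of \<open>U\<close> minus twice the measure of its overlap with the translate,
  and the overlap involves only points of \<open>U\<close>, which stay in the open set under small
  shifts.\<close>

lemma translate_L1_tendsto_open:
  fixes U :: "'a::euclidean_space set" and c :: complex
  assumes U: "open U" "emeasure lborel U < \<infinity>" and t: "t \<longlonglongrightarrow> 0"
  shows "(\<lambda>n. \<integral>x. norm (indicator U (x + t n) *\<^sub>R c - indicator U x *\<^sub>R c) \<partial>lborel) \<longlonglongrightarrow> 0"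
proof -
  let ?i = "indicator U :: 'a \<Rightarrow> real"
  have [measurable]: "U \<in> sets borel" using U by auto
  have i: "integrable lborel ?i" using U by simp
  have ii: "integrable lborel (\<lambda>x. ?i x * ?i (x + t n))" for n
    by (rule Bochner_Integration.integrable_bound[OF i]) (auto simp: indicator_def)
  have lim: "(\<lambda>n. \<integral>x. ?i x * ?i (x + t n) \<partial>lborel) \<longlonglongrightarrow> (\<integral>x. ?i x \<partial>lborel)"
  proof (rule integral_dominated_convergence[where w="?i"])
    show "AE x in lborel. (\<lambda>n. ?i x * ?i (x + t n)) \<longlonglongrightarrow> ?i x"
    proof (rule AE_I2)
      fix x
      show "(\<lambda>n. ?i x * ?i (x + t n)) \<longlonglongrightarrow> ?i x"
      proof (cases "x \<in> U")
        case True
        have "(\<lambda>n. x + t n) \<longlonglongrightarrow> x + 0" by (intro tendsto_intros t)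
        then have "\<forall>\<^sub>F n in sequentially. x + t n \<in> U"
          using topological_tendstoD[of _ x sequentially U] U True by simp
        then have "\<forall>\<^sub>F n in sequentially. ?i x * ?i (x + t n) = ?i x"
          by eventually_elim (simp add: True)
        then show ?thesis by (rule tendsto_eventually)
      qed simp
    qed
  qed (use i in \<open>auto simp: indicator_def\<close>)
  have "(\<integral>x. norm (?i (x + t n) *\<^sub>R c - ?i x *\<^sub>R c) \<partial>lborel) =
     norm c * (2 * (\<integral>x. ?i x \<partial>lborel) - 2 * (\<integral>x. ?i x * ?i (x + t n) \<partial>lborel))" for n
  proof -
    have "(\<integral>x. norm (?i (x + t n) *\<^sub>R c - ?i x *\<^sub>R c) \<partial>lborel) =
       (\<integral>x. norm c * (?i (x + t n) + ?i x - 2 * (?i x * ?i (x + t n))) \<partial>lborel)"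
      by (intro Bochner_Integration.integral_cong) (auto simp: indicator_def)
    also have "\<dots> = norm c * (\<integral>x. ?i (x + t n) + ?i x - 2 * (?i x * ?i (x + t n)) \<partial>lborel)"
      by (rule Bochner_Integration.integral_mult_right_zero)
    also have "(\<integral>x. ?i (x + t n) + ?i x - 2 * (?i x * ?i (x + t n)) \<partial>lborel) =
       (\<integral>x. ?i (x + t n) \<partial>lborel) + (\<integral>x. ?i x \<partial>lborel) - 2 * (\<integral>x. ?i x * ?i (x + t n) \<partial>lborel)"
      using i ii[of n] lborel_integrable_translate[OF i, of "t n"] by simp
    also have "(\<integral>x. ?i (x + t n) \<partial>lborel) = (\<integral>x. ?i x \<partial>lborel)"
      by (rule lborel_integral_translate)
    finally show ?thesis by simp
  qed
  moreover have "(\<lambda>n. norm c * (2 * (\<integral>x. ?i x \<partial>lborel) - 2 * (\<integral>x. ?i x * ?i (x + t n) \<partial>lborel)))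
     \<longlonglongrightarrow> norm c * (2 * (\<integral>x. ?i x \<partial>lborel) - 2 * (\<integral>x. ?i x \<partial>lborel))"
    by (intro tendsto_intros lim)
  ultimately show ?thesis by simp
qed

text \<open>Outer regularity approximates a measurable set of finite measure from outside by an open
  one, for which the claim is known; linearity and closure under L1 limits give the rest.\<close>

lemma translate_L1_tendsto:
  fixes f :: "'a::euclidean_space \<Rightarrow> complex"
  assumes "integrable lborel f" and t: "t \<longlonglongrightarrow> 0"
  shows "(\<lambda>n. \<integral>x. norm (f (x + t n) - f x) \<partial>lborel) \<longlonglongrightarrow> 0"
  using assms(1)
proof (induct rule: integrable_induct)
  case (base A c)
  have [measurable]: "A \<in> sets borel" using base by simp
  show ?case
  proof (rule translate_L1_approx)
    show "integrable lborel (\<lambda>x. indicator A x *\<^sub>R c)"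
      using base by (auto intro!: integrable_scaleR_left)
    fix e :: real assume e: "e > 0"
    \<comment> \<open>The summand 1 keeps the quotient meaningful when \<open>c\<close> is
      0.\<close>
    define e' where "e' = e / (norm c + 1)"
    have e': "e' > 0" using e by (simp add: e'_def add_nonneg_pos)
    obtain U where U: "open U" "A \<subseteq> U" "emeasure lborel (U - A) < ennreal e'"
      using outer_regular_lborel[of A e'] e' by auto
    have [measurable]: "U \<in> sets borel" using U by auto
    have "U = A \<union> (U - A)" using U by auto
    then have "emeasure lborel U \<le> emeasure lborel A + emeasure lborel (U - A)"
      using emeasure_subadditive[of A lborel "U - A"] by auto
    also have "\<dots> < \<infinity>"
      using base U(3) by (auto simp: less_top[symmetric] intro: order.strict_trans)
    finally have Ufin: "emeasure lborel U < \<infinity>" .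
    have "emeasure lborel (U - A) = ennreal (measure lborel (U - A))"
      by (rule emeasure_eq_ennreal_measure) (use U(3) in auto)
    then have m: "measure lborel (U - A) < e'"
      using U(3) by (simp add: ennreal_less_iff)
    have "(\<integral>x. norm (indicator A x *\<^sub>R c - indicator U x *\<^sub>R c) \<partial>lborel) = (\<integral>x. norm c * indicator (U - A) x \<partial>lborel)"
      using U(2) by (intro Bochner_Integration.integral_cong) (auto simp: indicator_def)
    also have "\<dots> = norm c * measure lborel (U - A)"
      by simp
    also have "\<dots> \<le> norm c * e'" using m by (intro mult_left_mono) auto
    also have "\<dots> < e"
      using e by (simp add: e'_def field_simps add_pos_nonneg)
    finally have "(\<integral>x. norm (indicator A x *\<^sub>R c - indicator U x *\<^sub>R c) \<partial>lborel) < e" .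
    moreover have "integrable lborel (\<lambda>x. indicator U x *\<^sub>R c)"
      using Ufin by (auto intro!: integrable_scaleR_left)
    ultimately show "\<exists>g. integrable lborel g \<and> (\<integral>x. norm (indicator A x *\<^sub>R c - g x) \<partial>lborel) < e \<and>
      (\<lambda>n. \<integral>x. norm (g (x + t n) - g x) \<partial>lborel) \<longlonglongrightarrow> 0"
      using translate_L1_tendsto_open[OF U(1) Ufin t, of c] by blast
  qed
next
  case (add f g)
  show ?case
  proof (rule Lim_null_comparison)
    show "\<forall>\<^sub>F n in sequentially. norm (\<integral>x. norm (f (x + t n) + g (x + t n) - (f x + g x)) \<partial>lborel) \<le>
      (\<integral>x. norm (f (x + t n) - f x) \<partial>lborel) + (\<integral>x. norm (g (x + t n) - g x) \<partial>lborel)"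
    proof (rule always_eventually, rule allI)
      fix n
      have i: "integrable lborel (\<lambda>x. f (x + t n) - f x)" "integrable lborel (\<lambda>x. g (x + t n) - g x)"
        using add(1,3) lborel_integrable_translate[OF add(1), of "t n"]
          lborel_integrable_translate[OF add(3), of "t n"] by auto
      have "(\<integral>x. norm (f (x + t n) + g (x + t n) - (f x + g x)) \<partial>lborel) \<le>
        (\<integral>x. norm (f (x + t n) - f x) + norm (g (x + t n) - g x) \<partial>lborel)"
      proof (rule integral_mono)
        show "integrable lborel (\<lambda>x. norm (f (x + t n) + g (x + t n) - (f x + g x)))"
          using Bochner_Integration.integrable_add[OF i] by (intro integrable_norm) (simp add: algebra_simps)
        show "norm (f (x + t n) + g (x + t n) - (f x + g x)) \<le> norm (f (x + t n) - f x) + norm (g (x + t n) - g x)" for x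
          using norm_triangle_ineq[of "f (x + t n) - f x" "g (x + t n) - g x"] by (simp add: algebra_simps)
      qed (use i in auto)
      then show "norm (\<integral>x. norm (f (x + t n) + g (x + t n) - (f x + g x)) \<partial>lborel) \<le>
        (\<integral>x. norm (f (x + t n) - f x) \<partial>lborel) + (\<integral>x. norm (g (x + t n) - g x) \<partial>lborel)"
        using i by simp
    qed
    show "(\<lambda>n. (\<integral>x. norm (f (x + t n) - f x) \<partial>lborel) + (\<integral>x. norm (g (x + t n) - g x) \<partial>lborel)) \<longlonglongrightarrow> 0"
      using tendsto_add[OF add(2,4)] by simp
  qed
next
  case (lim f s)
  show ?case
  proof (rule translate_L1_approx[OF lim(5)])
    fix e :: real assume e: "e > 0"
    have [measurable]: "f \<in> borel_measurable borel" "\<And>i. s i \<in> borel_measurable borel"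
      using lim by auto
    have "(\<lambda>i. \<integral>x. norm (f x - s i x) \<partial>lborel) \<longlonglongrightarrow> (\<integral>x. 0 \<partial>(lborel :: 'a measure))"
    \<comment> \<open>The simple approximants are bounded by \<open>2 * norm (f x)\<close>, which
      together with \<open>f\<close> itself makes 3.\<close>
    proof (rule integral_dominated_convergence[where w="\<lambda>x. 3 * norm (f x)"])
      show "AE x in lborel. (\<lambda>i. norm (f x - s i x)) \<longlonglongrightarrow> 0"
      proof (rule AE_I2)
        fix x
        have "(\<lambda>i. norm (f x - s i x)) \<longlonglongrightarrow> norm (f x - f x)"
          by (intro tendsto_intros lim(3)) simp
        then show "(\<lambda>i. norm (f x - s i x)) \<longlonglongrightarrow> 0" by simp
      qed
      show "AE x in lborel. norm (norm (f x - s i x)) \<le> 3 * norm (f x)" for i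
      proof (rule AE_I2)
        fix x :: 'a
        show "norm (norm (f x - s i x)) \<le> 3 * norm (f x)"
          using norm_triangle_ineq4[of "f x" "s i x"] lim(4)[of x i] by simp
      qed
    qed (use lim in auto)
    then obtain i where "(\<integral>x. norm (f x - s i x) \<partial>lborel) < e"
      using order_tendstoD(2)[of _ 0 sequentially e] e by (force simp: eventually_sequentially)
    then show "\<exists>g. integrable lborel g \<and> (\<integral>x. norm (f x - g x) \<partial>lborel) < e \<and>
      (\<lambda>n. \<integral>x. norm (g (x + t n) - g x) \<partial>lborel) \<longlonglongrightarrow> 0"
      using lim(1,2) by blast
  qed
qed

text \<open>Scaled so that \<open>ft 1\<close> reproduces it up to the factor
  \<open>sqrt (2 * pi) ^ DIM('a)\<close>. It serves as a damping factor in Plancherel's theorem and,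
  being nowhere zero, as a weight that can be divided out again.\<close>

definition gauss :: "'a::euclidean_space \<Rightarrow> real" where
  "gauss x = exp (- (norm x)\<^sup>2 / 2)"

lemma gauss_pos: "0 < gauss x" and gauss_le_1: "gauss x \<le> 1"
  by (simp_all add: gauss_def)

lemma gauss_measurable [measurable]: "gauss \<in> borel_measurable borel"
  unfolding gauss_def[abs_def] by measurable

text \<open>Up to \<open>sqrt (2 * pi)\<close> this Gaussian is the standard normal density, so its
  transform is the characteristic function of the normal distribution.\<close>

lemma gauss_fourier_real:
  "integrable lborel (\<lambda>x::real. cis (t * x) * complex_of_real (exp (- x\<^sup>2 / 2)))"
  "(\<integral>x. cis (t * x) * complex_of_real (exp (- x\<^sup>2 / 2)) \<partial>lborel) =
     complex_of_real (sqrt (2 * pi) * exp (- t\<^sup>2 / 2))"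
proof -
  have c: "complex_of_real (exp (- x\<^sup>2 / 2)) = complex_of_real (sqrt (2 * pi)) * complex_of_real (std_normal_density x)" for x
    unfolding of_real_mult[symmetric] by (simp add: std_normal_density_def)
  have d: "integrable lborel std_normal_density"
    by (simp add: integrable_normal_density)
  have int: "integrable lborel (\<lambda>x. std_normal_density x *\<^sub>R cis (t * x))"
  proof (rule Bochner_Integration.integrable_bound[OF d])
    show "(\<lambda>x. std_normal_density x *\<^sub>R cis (t * x)) \<in> borel_measurable lborel"
      unfolding cis_conv_exp by measurable
  qed auto
  have "(\<integral>x. std_normal_density x *\<^sub>R cis (t * x) \<partial>lborel) = char std_normal_distribution t"
    unfolding char_def cis_conv_exp
    by (subst integral_density) (auto simp: normal_density_nonneg mult_ac)
  also have "\<dots> = complex_of_real (exp (- t\<^sup>2 / 2))"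
    by (simp add: char_std_normal_distribution)
  finally have I: "(\<integral>x. std_normal_density x *\<^sub>R cis (t * x) \<partial>lborel) = complex_of_real (exp (- t\<^sup>2 / 2))" .
  have e: "(\<lambda>x. cis (t * x) * complex_of_real (exp (- x\<^sup>2 / 2))) =
     (\<lambda>x. complex_of_real (sqrt (2 * pi)) * (std_normal_density x *\<^sub>R cis (t * x)))"
    unfolding c by (auto simp: scaleR_conv_of_real mult_ac)
  show "integrable lborel (\<lambda>x::real. cis (t * x) * complex_of_real (exp (- x\<^sup>2 / 2)))"
    unfolding e using int by (rule integrable_mult_right)
  show "(\<integral>x. cis (t * x) * complex_of_real (exp (- x\<^sup>2 / 2)) \<partial>lborel) =
     complex_of_real (sqrt (2 * pi) * exp (- t\<^sup>2 / 2))"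
    unfolding e Bochner_Integration.integral_mult_right_zero I by simp
qed

lemma gauss_eq_prod: "gauss x = (\<Prod>b\<in>Basis. exp (- (x \<bullet> b)\<^sup>2 / 2))"
proof -
  have "(norm x)\<^sup>2 = (\<Sum>b\<in>Basis. (x \<bullet> b)\<^sup>2)"
    unfolding power2_norm_eq_inner by (subst euclidean_inner) (simp add: power2_eq_square)
  then show ?thesis
    unfolding gauss_def by (subst exp_sum[symmetric]) (simp_all add: sum_negf sum_divide_distrib)
qed

lemma cis_sum: "finite A \<Longrightarrow> cis (sum f A) = (\<Prod>a\<in>A. cis (f a))"
  by (induct A rule: finite_induct) (auto simp: cis_mult[symmetric])

text \<open>Phase and Gaussian both factor over the coordinates, and \<open>lborel\<close> is the
  image of the product of the coordinate measures.\<close>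

lemma gauss_fourier:
  fixes \<xi> :: "'a::euclidean_space"
  shows "integrable lborel (\<lambda>x. cis (\<xi> \<bullet> x) * complex_of_real (gauss x))" (is ?A)
    "(\<integral>x. cis (\<xi> \<bullet> x) * complex_of_real (gauss x) \<partial>lborel) =
       complex_of_real (sqrt (2 * pi) ^ DIM('a) * gauss \<xi>)" (is ?B)
proof -
  interpret P: product_sigma_finite "\<lambda>_::'a. lborel::real measure" by standard
  let ?S = "\<lambda>f::'a \<Rightarrow> real. \<Sum>b\<in>Basis. f b *\<^sub>R b"
  let ?F = "\<lambda>x::'a. cis (\<xi> \<bullet> x) * complex_of_real (gauss x)"
  let ?g = "\<lambda>b y. cis ((\<xi> \<bullet> b) * y) * complex_of_real (exp (- y\<^sup>2 / 2))"
  have [measurable]: "?F \<in> borel_measurable borel"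
    unfolding cis_conv_exp by measurable
  have eq: "?F (?S f) = (\<Prod>b\<in>Basis. ?g b (f b))" for f
  proof -
    have "cis (\<xi> \<bullet> ?S f) = (\<Prod>b\<in>Basis. cis ((\<xi> \<bullet> b) * f b))"
      by (subst cis_sum[symmetric]) (auto simp: inner_sum_right mult.commute)
    moreover have "complex_of_real (gauss (?S f)) = (\<Prod>b\<in>Basis. complex_of_real (exp (- (f b)\<^sup>2 / 2)))"
      unfolding gauss_eq_prod of_real_prod by (intro prod.cong) (auto simp: inner_sum_left_Basis)
    ultimately show ?thesis by (simp add: prod.distrib)
  qed
  have i: "integrable (Pi\<^sub>M Basis (\<lambda>_::'a. lborel)) (\<lambda>f. \<Prod>b\<in>Basis. ?g b (f b))"
    by (rule P.product_integrable_prod[OF finite_Basis gauss_fourier_real(1)])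
  show ?A
    by (subst lborel_eq, subst integrable_distr_eq) (use i in \<open>simp_all only: eq\<close>, measurable)
  have "(\<integral>x. ?F x \<partial>lborel) = (\<integral>f. (\<Prod>b\<in>Basis. ?g b (f b)) \<partial>(Pi\<^sub>M Basis (\<lambda>_::'a. lborel)))"
    by (subst lborel_eq, subst integral_distr) (simp_all only: eq, measurable)
  also have "\<dots> = (\<Prod>b\<in>Basis. integral\<^sup>L lborel (?g b))"
    by (rule P.product_integral_prod[OF finite_Basis gauss_fourier_real(1)])
  also have "\<dots> = (\<Prod>b\<in>Basis. complex_of_real (sqrt (2 * pi) * exp (- (\<xi> \<bullet> b)\<^sup>2 / 2)))"
    by (intro prod.cong refl gauss_fourier_real(2))
  also have "\<dots> = complex_of_real (sqrt (2 * pi) ^ DIM('a) * gauss \<xi>)"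
    unfolding gauss_eq_prod by (simp add: prod.distrib del: of_real_exp)
  finally show ?B .
qed

section \<open>The Fourier transform on integrable functions\<close>

lemma measurable_cis [measurable]: "cis \<in> borel_measurable borel"
  unfolding cis_conv_exp[abs_def] by measurable

section \<open>The Gaussian as an L2 weight and the completeness of L2\<close>

lemma integrable_gauss: "integrable lborel (\<lambda>x::'a::euclidean_space. complex_of_real (gauss x))"
  using gauss_fourier(1)[of 0] by simp

lemma integral_gauss: "(\<integral>x. complex_of_real (gauss (x::'a::euclidean_space)) \<partial>lborel) = sqrt (2 * pi) ^ DIM('a)"
  using gauss_fourier(2)[of "0::'a"] by (simp add: gauss_def)

lemma L2_gauss: "L2 (\<lambda>x::'a::euclidean_space. complex_of_real (gauss x))"
proof (rule L2I)
  show "integrable lborel (\<lambda>x::'a. (norm (complex_of_real (gauss x)))\<^sup>2)"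
  proof (rule Bochner_Integration.integrable_bound[OF integrable_gauss])
    have "(gauss x)\<^sup>2 \<le> gauss x" for x :: 'a
      using mult_left_mono[OF gauss_le_1[of x], of "gauss x"] gauss_pos[of x] by (simp add: power2_eq_square)
    then show "AE x in lborel. norm ((norm (complex_of_real (gauss x)))\<^sup>2) \<le> norm (complex_of_real (gauss (x::'a)))"
      by (intro AE_I2) (auto intro: order_trans[OF _ abs_ge_self])
  qed measurable
qed measurable

text \<open>Multiplication by the strictly positive Gaussian turns L2-Cauchy sequences into L1-Cauchy ones.\<close>

lemma L2_complete:
  fixes s :: "nat \<Rightarrow> 'a::euclidean_space \<Rightarrow> complex"
  assumes s: "\<And>n. L2 (s n)"
    and cauchy: "\<And>e. e > 0 \<Longrightarrow> \<exists>N. \<forall>i\<ge>N. \<forall>j\<ge>N. norm_L2 (\<lambda>x. s i x - s j x) < e"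
  obtains g where "L2 g" "(\<lambda>n. norm_L2 (\<lambda>x. s n x - g x)) \<longlonglongrightarrow> 0"
proof -
  have sm [measurable]: "s n \<in> borel_measurable borel" for n using s[of n] by auto
  let ?w = "\<lambda>x::'a. complex_of_real (gauss x)"
  define u where "u n x = s n x * ?w x" for n x
  have u_int: "integrable lborel (u n)" for n
    unfolding u_def[abs_def] by (rule L2_mult_integrable[OF s L2_gauss])
  have u_cauchy: "\<exists>N. \<forall>i\<ge>N. \<forall>j\<ge>N. (\<integral>x. norm (u i x - u j x) \<partial>lborel) < e" if e: "e > 0" for e
  proof -
    define C where "C = norm_L2 ?w + 1"
    have C: "C > 0" unfolding C_def by (simp add: add_nonneg_pos)
    obtain N where N: "\<And>i j. i \<ge> N \<Longrightarrow> j \<ge> N \<Longrightarrow> norm_L2 (\<lambda>x. s i x - s j x) < e / C"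
      using cauchy[of "e / C"] e C by auto
    have "(\<integral>x. norm (u i x - u j x) \<partial>lborel) < e" if ij: "i \<ge> N" "j \<ge> N" for i j
    proof -
      have "(\<integral>x. norm (u i x - u j x) \<partial>lborel) = (\<integral>x. norm (s i x - s j x) * norm (?w x) \<partial>lborel)"
        by (simp only: u_def left_diff_distrib[symmetric] norm_mult)
      also have "\<dots> \<le> norm_L2 (\<lambda>x. s i x - s j x) * norm_L2 ?w"
        by (rule norm_L2_Cauchy_Schwarz[OF L2_diff[OF s s] L2_gauss])
      also have "\<dots> \<le> norm_L2 (\<lambda>x. s i x - s j x) * C"
        by (intro mult_left_mono) (auto simp: C_def)
      also have "\<dots> < e" using N[OF ij] C by (simp add: field_simps)
      finally show ?thesis .
    qed
    then show ?thesis by blast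
  qed
  obtain r where r: "strict_mono r" "AE x in lborel. Cauchy (\<lambda>i. u (r i) x)"
    using cauchy_L1_AE_cauchy_subseq[OF u_int u_cauchy] by blast
  \<comment> \<open>Where the subsequence diverges the value of \<open>lim\<close> is unspecified;
    this happens only on a null set, because the weight never vanishes.\<close>
  define g where "g x = lim (\<lambda>i. s (r i) x)" for x
  have gm [measurable]: "g \<in> borel_measurable borel"
    unfolding g_def[abs_def] by measurable
  have conv: "AE x in lborel. (\<lambda>i. s (r i) x) \<longlonglongrightarrow> g x"
    using r(2)
  proof eventually_elim
    fix x assume "Cauchy (\<lambda>i. u (r i) x)"
    then obtain l where l: "(\<lambda>i. u (r i) x) \<longlonglongrightarrow> l"
      using Cauchy_convergent_iff convergent_def by blast
    have "(\<lambda>i. u (r i) x / ?w x) \<longlonglongrightarrow> l / ?w x"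
      by (intro tendsto_divide l tendsto_const) (use gauss_pos[of x] in simp)
    moreover have "u (r i) x / ?w x = s (r i) x" for i
      using gauss_pos[of x] by (simp add: u_def)
    ultimately have "convergent (\<lambda>i. s (r i) x)" by (auto simp: convergent_def)
    then show "(\<lambda>i. s (r i) x) \<longlonglongrightarrow> g x"
      by (simp add: g_def convergent_LIMSEQ_iff)
  qed
  have key: "\<exists>N. \<forall>n\<ge>N. L2 (\<lambda>x. s n x - g x) \<and> norm_L2 (\<lambda>x. s n x - g x) \<le> e" if e: "e > 0" for e
  proof -
    obtain N where N: "\<And>i j. i \<ge> N \<Longrightarrow> j \<ge> N \<Longrightarrow> norm_L2 (\<lambda>x. s i x - s j x) < e"
      using cauchy[OF e] by auto
    have "L2 (\<lambda>x. s n x - g x) \<and> norm_L2 (\<lambda>x. s n x - g x) \<le> e" if n: "n \<ge> N" for n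
    proof -
      \<comment> \<open>Fatou is applied along the subsequence with \<open>n\<close> fixed; shifting
        the index by \<open>N\<close> keeps every second index in the Cauchy range.\<close>
      have rN: "r (i + N) \<ge> N" for i
        using seq_suble[OF r(1), of "i + N"] by linarith
      have 1: "L2 (\<lambda>x. s n x - s (r (i + N)) x)" for i
        by (rule L2_diff[OF s s])
      have 2: "AE x in lborel. (\<lambda>i. s n x - s (r (i + N)) x) \<longlonglongrightarrow> s n x - g x"
        using conv
      proof eventually_elim
        fix x assume "(\<lambda>i. s (r i) x) \<longlonglongrightarrow> g x"
        then show "(\<lambda>i. s n x - s (r (i + N)) x) \<longlonglongrightarrow> s n x - g x"
          by (intro tendsto_intros LIMSEQ_ignore_initial_segment)
      qed
      have 3: "norm_L2 (\<lambda>x. s n x - s (r (i + N)) x) \<le> e" for i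
        using N[OF n rN[of i]] by simp
      have 4: "(\<lambda>x. s n x - g x) \<in> borel_measurable borel" by measurable
      show ?thesis using L2_Fatou[OF 1 4 2 3] by simp
    qed
    then show ?thesis by blast
  qed
  obtain N where "L2 (\<lambda>x. s N x - g x)" using key[of 1] by auto
  then have "L2 (\<lambda>x. s N x - (s N x - g x))" by (rule L2_diff[OF s])
  then have "L2 g" by simp
  moreover have "(\<lambda>n. norm_L2 (\<lambda>x. s n x - g x)) \<longlonglongrightarrow> 0"
  proof (rule LIMSEQ_I)
    fix e :: real assume "e > 0"
    then obtain N where "\<forall>n\<ge>N. norm_L2 (\<lambda>x. s n x - g x) \<le> e / 2"
      using key[of "e/2"] by auto
    then show "\<exists>N. \<forall>n\<ge>N. norm (norm_L2 (\<lambda>x. s n x - g x) - 0) < e"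
      using \<open>e > 0\<close> by (intro exI[of _ N]) force
  qed
  ultimately show ?thesis using that by blast
qed

lemma integrable_prod_bounded:
  fixes f :: "'a::euclidean_space \<Rightarrow> complex" and g :: "'b::euclidean_space \<Rightarrow> complex"
  assumes f: "integrable lborel f" and g: "integrable lborel g"
    and k [measurable]: "k \<in> borel_measurable (borel \<Otimes>\<^sub>M borel)" and bd: "\<And>z. norm (k z) \<le> 1"
  shows "integrable (lborel \<Otimes>\<^sub>M lborel) (\<lambda>(x, y). k (x, y) * (f x * g y))"
proof (rule Bochner_Integration.integrable_bound)
  have [measurable]: "f \<in> borel_measurable borel" "g \<in> borel_measurable borel" using f g by auto
  show "integrable (lborel \<Otimes>\<^sub>M lborel) (\<lambda>(x, y). f x * g y)"
  proof (rule lborel_pair.Fubini_integrable)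
    show "integrable lborel (\<lambda>x. \<integral>y. norm (case (x, y) of (x, y) \<Rightarrow> f x * g y) \<partial>lborel)"
      using f by (simp add: norm_mult)
    show "AE x in lborel. integrable lborel (\<lambda>y. case (x, y) of (x, y) \<Rightarrow> f x * g y)"
      using g by simp
  qed measurable
  show "AE z in lborel \<Otimes>\<^sub>M lborel. norm (case z of (x, y) \<Rightarrow> k (x, y) * (f x * g y)) \<le> norm (case z of (x, y) \<Rightarrow> f x * g y)"
    using bd by (intro AE_I2) (auto simp: norm_mult intro!: mult_left_le_one_le)
  show "(\<lambda>(x, y). k (x, y) * (f x * g y)) \<in> borel_measurable (lborel \<Otimes>\<^sub>M lborel)"
    by measurable
qed

text \<open>No normalising factor, and a signed scale \<open>s\<close>: the proof needs both
  \<open>1 / \<eta>\<close> and \<open>- 1 / \<eta>\<close>, and conjugation passes from one to the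
  other.\<close>

definition ft :: "real \<Rightarrow> ('a::euclidean_space \<Rightarrow> complex) \<Rightarrow> 'a \<Rightarrow> complex" where
  "ft s f \<xi> = (\<integral>x. cis (s * (\<xi> \<bullet> x)) * f x \<partial>lborel)"

lemma ft_measurable [measurable]:
  assumes [measurable]: "f \<in> borel_measurable borel"
  shows "ft s f \<in> borel_measurable borel"
  unfolding ft_def[abs_def] by measurable

lemma integrable_cis_mult:
  assumes "integrable lborel f" and [measurable]: "g \<in> borel_measurable borel"
  shows "integrable lborel (\<lambda>x::'a::euclidean_space. cis (g x) * f x)"
proof (rule Bochner_Integration.integrable_bound[OF assms(1)])
  have [measurable]: "f \<in> borel_measurable borel" using assms by auto
  show "(\<lambda>x. cis (g x) * f x) \<in> borel_measurable lborel" by measurable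
qed (auto simp: norm_mult)

lemma ft_bounded: "norm (ft s f \<xi>) \<le> (\<integral>x. norm (f x) \<partial>lborel)"
  using integral_norm_bound[of lborel "\<lambda>x. cis (s * (\<xi> \<bullet> x)) * f x"]
  by (simp add: ft_def norm_mult)

text \<open>The phase is symmetric in the two variables and has modulus 1, so Fubini applies to
  integrable \<open>h\<close> and \<open>g\<close>. This formula moves a transform from one factor
  to the other without inversion.\<close>

lemma ft_mult_formula:
  assumes h: "integrable lborel h" and g: "integrable lborel g"
  shows "(\<integral>\<xi>. ft s h \<xi> * g \<xi> \<partial>lborel) = (\<integral>t. h t * ft s g t \<partial>lborel)"
proof -
  have int: "integrable (lborel \<Otimes>\<^sub>M lborel) (\<lambda>(t, \<xi>). cis (s * (\<xi> \<bullet> t)) * (h t * g \<xi>))"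
    using integrable_prod_bounded[OF h g, of "\<lambda>z. cis (s * (snd z \<bullet> fst z))"] by simp
  have "(\<integral>\<xi>. ft s h \<xi> * g \<xi> \<partial>lborel) = (\<integral>\<xi>. \<integral>t. cis (s * (\<xi> \<bullet> t)) * (h t * g \<xi>) \<partial>lborel \<partial>lborel)"
    unfolding ft_def by (simp add: mult.assoc flip: Bochner_Integration.integral_mult_left_zero)
  also have "\<dots> = (\<integral>t. \<integral>\<xi>. cis (s * (\<xi> \<bullet> t)) * (h t * g \<xi>) \<partial>lborel \<partial>lborel)"
    by (rule lborel_pair.Fubini_integral[OF int])
  also have "\<dots> = (\<integral>t. h t * ft s g t \<partial>lborel)"
  proof (rule Bochner_Integration.integral_cong[OF refl])
    fix t
    have "(\<integral>\<xi>. cis (s * (\<xi> \<bullet> t)) * (h t * g \<xi>) \<partial>lborel) = (\<integral>\<xi>. h t * (cis (s * (t \<bullet> \<xi>)) * g \<xi>) \<partial>lborel)"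
      by (simp add: mult_ac inner_commute)
    then show "(\<integral>\<xi>. cis (s * (\<xi> \<bullet> t)) * (h t * g \<xi>) \<partial>lborel) = h t * ft s g t"
      by (simp add: ft_def)
  qed
  finally show ?thesis .
qed

lemma ft_gauss_scaled:
  assumes d: "d > 0"
  shows "ft s (\<lambda>\<xi>. complex_of_real (gauss (d *\<^sub>R \<xi>))) (t::'a::euclidean_space) =
    complex_of_real ((sqrt (2 * pi) / d) ^ DIM('a) * gauss ((s / d) *\<^sub>R t))"
proof -
  have "complex_of_real (sqrt (2 * pi) ^ DIM('a) * gauss ((s / d) *\<^sub>R t)) =
     (\<integral>x. cis (((s / d) *\<^sub>R t) \<bullet> x) * complex_of_real (gauss x) \<partial>lborel)"
    by (rule gauss_fourier(2)[symmetric])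
  also have "\<dots> = \<bar>d\<bar>^DIM('a) *\<^sub>R (\<integral>x. cis (((s / d) *\<^sub>R t) \<bullet> (0 + d *\<^sub>R x)) * complex_of_real (gauss (0 + d *\<^sub>R x)) \<partial>lborel)"
    by (rule lborel_integral_affine) (use d in simp)
  also have "\<dots> = d^DIM('a) *\<^sub>R ft s (\<lambda>\<xi>. complex_of_real (gauss (d *\<^sub>R \<xi>))) t"
    using d by (simp add: ft_def)
  finally have "ft s (\<lambda>\<xi>. complex_of_real (gauss (d *\<^sub>R \<xi>))) t =
     complex_of_real (sqrt (2 * pi) ^ DIM('a) * gauss ((s / d) *\<^sub>R t)) / complex_of_real (d ^ DIM('a))"
    using d by (simp add: scaleR_conv_of_real)
  then show ?thesis by (simp add: power_divide)
qed

text \<open>Its transform is the squared modulus of the transform of \<open>f\<close>, and its value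
  at 0 is the squared norm of \<open>f\<close>. Plancherel's identity thus becomes Fourier inversion
  for this function at the single point 0.\<close>

definition autocorr :: "('a::euclidean_space \<Rightarrow> complex) \<Rightarrow> 'a \<Rightarrow> complex" where
  "autocorr f t = (\<integral>y. f (y + t) * cnj (f y) \<partial>lborel)"

lemma autocorr_integrable_prod:
  fixes f :: "'a::euclidean_space \<Rightarrow> complex"
  assumes f: "integrable lborel f"
  shows "integrable (lborel \<Otimes>\<^sub>M lborel) (\<lambda>(y, t). f (y + t) * cnj (f y))"
proof (rule lborel_pair.Fubini_integrable)
  have [measurable]: "f \<in> borel_measurable borel" using f by auto
  show "(\<lambda>(y, t). f (y + t) * cnj (f y)) \<in> borel_measurable (lborel \<Otimes>\<^sub>M lborel)"
    by measurable
  have tr: "(\<integral>t. norm (f (y + t)) \<partial>lborel) = (\<integral>t. norm (f t) \<partial>lborel)" for y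
    using lborel_integral_translate[of "\<lambda>t. norm (f t)" y] by (simp add: add.commute)
  show "integrable lborel (\<lambda>y. \<integral>t. norm (case (y, t) of (y, t) \<Rightarrow> f (y + t) * cnj (f y)) \<partial>lborel)"
    using f by (simp add: norm_mult tr)
  show "AE y in lborel. integrable lborel (\<lambda>t. case (y, t) of (y, t) \<Rightarrow> f (y + t) * cnj (f y))"
    using lborel_integrable_translate[OF f] by (simp add: add.commute)
qed

lemma autocorr_integrable:
  assumes f: "integrable lborel f"
  shows "integrable lborel (autocorr f)"
  unfolding autocorr_def[abs_def] by (rule lborel_pair.integrable_snd[OF autocorr_integrable_prod[OF f]])

text \<open>After Fubini, translating \<open>t\<close> by \<open>y\<close> splits the phase, and the
  double integral becomes the product of \<open>ft s f\<close> and its conjugate.\<close>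

lemma ft_autocorr:
  fixes f :: "'a::euclidean_space \<Rightarrow> complex"
  assumes f: "integrable lborel f"
  shows "ft s (autocorr f) \<xi> = complex_of_real ((norm (ft s f \<xi>))\<^sup>2)"
proof -
  have [measurable]: "f \<in> borel_measurable borel" using f by auto
  have int: "integrable (lborel \<Otimes>\<^sub>M lborel) (\<lambda>(y, t). cis (s * (\<xi> \<bullet> t)) * (f (y + t) * cnj (f y)))"
  proof (rule Bochner_Integration.integrable_bound[OF autocorr_integrable_prod[OF f]])
    show "AE z in lborel \<Otimes>\<^sub>M lborel. norm (case z of (y, t) \<Rightarrow> cis (s * (\<xi> \<bullet> t)) * (f (y + t) * cnj (f y)))
        \<le> norm (case z of (y, t) \<Rightarrow> f (y + t) * cnj (f y))"
      by (intro AE_I2) (auto simp: norm_mult)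
  qed measurable
  have "ft s (autocorr f) \<xi> = (\<integral>t. \<integral>y. cis (s * (\<xi> \<bullet> t)) * (f (y + t) * cnj (f y)) \<partial>lborel \<partial>lborel)"
    by (simp add: ft_def autocorr_def)
  also have "\<dots> = (\<integral>y. \<integral>t. cis (s * (\<xi> \<bullet> t)) * (f (y + t) * cnj (f y)) \<partial>lborel \<partial>lborel)"
    by (rule lborel_pair.Fubini_integral[OF int])
  also have "\<dots> = (\<integral>y. cnj (cis (s * (\<xi> \<bullet> y)) * f y) * ft s f \<xi> \<partial>lborel)"
  proof (rule Bochner_Integration.integral_cong[OF refl])
    fix y
    have "ft s f \<xi> = (\<integral>t. cis (s * (\<xi> \<bullet> (t + y))) * f (t + y) \<partial>lborel)"
      unfolding ft_def by (rule lborel_integral_translate[symmetric])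
    then have "cnj (cis (s * (\<xi> \<bullet> y)) * f y) * ft s f \<xi> =
       (\<integral>t. cnj (cis (s * (\<xi> \<bullet> y)) * f y) * (cis (s * (\<xi> \<bullet> (t + y))) * f (t + y)) \<partial>lborel)"
      by simp
    also have "\<dots> = (\<integral>t. cis (s * (\<xi> \<bullet> t)) * (f (y + t) * cnj (f y)) \<partial>lborel)"
    proof (rule Bochner_Integration.integral_cong[OF refl])
      fix t
      have "cis (s * (\<xi> \<bullet> (t + y))) = cis (s * (\<xi> \<bullet> t)) * cis (s * (\<xi> \<bullet> y))"
        by (simp add: cis_mult inner_add_right ring_distribs)
      moreover have "cnj (cis (s * (\<xi> \<bullet> y))) * cis (s * (\<xi> \<bullet> y)) = 1"
        by (simp add: cis_cnj cis_mult)
      ultimately show "cnj (cis (s * (\<xi> \<bullet> y)) * f y) * (cis (s * (\<xi> \<bullet> (t + y))) * f (t + y)) =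
         cis (s * (\<xi> \<bullet> t)) * (f (y + t) * cnj (f y))"
        by (simp add: mult_ac add.commute)
    qed
    finally show "(\<integral>t. cis (s * (\<xi> \<bullet> t)) * (f (y + t) * cnj (f y)) \<partial>lborel) =
       cnj (cis (s * (\<xi> \<bullet> y)) * f y) * ft s f \<xi>" by simp
  qed
  also have "\<dots> = cnj (ft s f \<xi>) * ft s f \<xi>"
    by (simp add: ft_def flip: Bochner_Integration.integral_cnj)
  finally show ?thesis
    by (simp only: complex_norm_square mult.commute)
qed

lemma autocorr_bounded:
  assumes "L2 f" shows "norm (autocorr f t) \<le> (norm_L2 f)\<^sup>2"
  using norm_integral_mult_le[OF L2_translate[OF assms, of t] L2_cnj[OF assms]]
    norm_L2_translate[of f t] norm_L2_cong[of "\<lambda>x. cnj (f x)" f]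
  by (simp add: autocorr_def power2_eq_square)

lemma autocorr_0: "L2 f \<Longrightarrow> autocorr f 0 = complex_of_real ((norm_L2 f)\<^sup>2)"
  unfolding autocorr_def norm_L2_square
  by (simp add: complex_norm_square[symmetric] del: of_real_power)

text \<open>Only continuity of translations in L1 is used. The unshifted factor is replaced by a
  truncation bounded by \<open>m\<close>: the two replacement terms \<open>?a\<close> and
  \<open>?c\<close> are small by Cauchy-Schwarz, and the remaining term \<open>?b\<close> is at most
  \<open>m\<close> times an L1 distance of translates.\<close>

lemma autocorr_tendsto:
  fixes f :: "'a::euclidean_space \<Rightarrow> complex"
  assumes f: "integrable lborel f" "L2 f" and t: "t \<longlonglongrightarrow> 0"
  shows "(\<lambda>n. autocorr f (t n)) \<longlonglongrightarrow> autocorr f 0"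
proof (rule LIMSEQ_I)
  fix e :: real assume e: "e > 0"
  have fm [measurable]: "f \<in> borel_measurable borel" using f by auto
  have "(\<lambda>m. norm_L2 f * norm_L2 (\<lambda>x. L2_trunc m f x - f x)) \<longlonglongrightarrow> norm_L2 f * 0"
    by (intro tendsto_intros norm_L2_trunc_tendsto f)
  then obtain m where m: "norm_L2 f * norm_L2 (\<lambda>x. L2_trunc m f x - f x) < e / 4"
    using order_tendstoD(2)[of _ 0 sequentially "e/4"] e by (force simp: eventually_sequentially)
  let ?g = "L2_trunc m f"
  have g: "L2 ?g" "?g \<in> borel_measurable borel"
    using bounded_cs_L2_trunc[OF fm, of m] bounded_cs_L2 by auto
  note [measurable] = g(2)
  have "(\<lambda>n. real m * (\<integral>x. norm (f (x + t n) - f x) \<partial>lborel)) \<longlonglongrightarrow> real m * 0"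
    by (intro tendsto_intros translate_L1_tendsto f t)
  then have "\<forall>\<^sub>F n in sequentially. real m * (\<integral>x. norm (f (x + t n) - f x) \<partial>lborel) < e / 2"
    using order_tendstoD(2)[of _ 0 sequentially "e/2"] e by simp
  then obtain N where N: "\<And>n. n \<ge> N \<Longrightarrow> real m * (\<integral>x. norm (f (x + t n) - f x) \<partial>lborel) < e / 2"
    by (auto simp: eventually_sequentially)
  have "norm (autocorr f (t n) - autocorr f 0) < e" if n: "n \<ge> N" for n
  proof -
    let ?a = "\<lambda>y. f (y + t n) * (cnj (f y) - cnj (?g y))"
    let ?b = "\<lambda>y. (f (y + t n) - f y) * cnj (?g y)"
    let ?c = "\<lambda>y. f y * (cnj (f y) - cnj (?g y))"
    have d: "L2 (\<lambda>y. cnj (f y) - cnj (?g y))"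
      by (intro L2_diff L2_cnj f g)
    have nd: "norm_L2 (\<lambda>y. cnj (f y) - cnj (?g y)) = norm_L2 (\<lambda>x. ?g x - f x)"
      by (intro norm_L2_cong) (metis complex_cnj_diff complex_mod_cnj norm_minus_commute)
    have ft: "L2 (\<lambda>y. f (y + t n))" by (rule L2_translate[OF f(2)])
    have ia: "integrable lborel ?a" and ic: "integrable lborel ?c"
      by (intro L2_mult_integrable ft f d)+
    have ib: "integrable lborel ?b"
      by (intro L2_mult_integrable L2_diff L2_cnj ft f g)
    have "autocorr f (t n) - autocorr f 0 = (\<integral>y. f (y + t n) * cnj (f y) - f y * cnj (f y) \<partial>lborel)"
      unfolding autocorr_def using L2_mult_integrable[OF ft L2_cnj[OF f(2)]] L2_mult_integrable[OF f(2) L2_cnj[OF f(2)]]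
      by simp
    also have "\<dots> = (\<integral>y. ?a y + ?b y - ?c y \<partial>lborel)"
      by (intro Bochner_Integration.integral_cong) (auto simp: algebra_simps)
    also have "\<dots> = (\<integral>y. ?a y \<partial>lborel) + (\<integral>y. ?b y \<partial>lborel) - (\<integral>y. ?c y \<partial>lborel)"
      using ia ib ic by simp
    finally have "norm (autocorr f (t n) - autocorr f 0) \<le>
        norm (\<integral>y. ?a y \<partial>lborel) + norm (\<integral>y. ?b y \<partial>lborel) + norm (\<integral>y. ?c y \<partial>lborel)"
      by (simp only:) (intro order_trans[OF norm_triangle_ineq4] add_right_mono norm_triangle_ineq)
    moreover have "norm (\<integral>y. ?a y \<partial>lborel) \<le> norm_L2 f * norm_L2 (\<lambda>x. ?g x - f x)"
      using norm_integral_mult_le[OF ft d] by (simp add: nd norm_L2_translate)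
    moreover have "norm (\<integral>y. ?c y \<partial>lborel) \<le> norm_L2 f * norm_L2 (\<lambda>x. ?g x - f x)"
      using norm_integral_mult_le[OF f(2) d] by (simp add: nd)
    moreover have "norm (\<integral>y. ?b y \<partial>lborel) \<le> (\<integral>y. real m * norm (f (y + t n) - f y) \<partial>lborel)"
    proof (rule Bochner_Integration.integral_norm_bound_integral[OF ib])
      show "integrable lborel (\<lambda>y. real m * norm (f (y + t n) - f y))"
        using f(1) lborel_integrable_translate[OF f(1), of "t n"] by auto
      show "norm (?b y) \<le> real m * norm (f (y + t n) - f y)" for y
      proof -
        have "norm (?g y) \<le> real m" by (simp add: L2_trunc_def)
        then show ?thesis
          using mult_right_mono[of "norm (?g y)" "real m" "norm (f (y + t n) - f y)"]
          by (simp add: norm_mult mult.commute)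
      qed
    qed
    ultimately show ?thesis
      using m N[OF n] by simp
  qed
  then show "\<exists>N. \<forall>n\<ge>N. norm (autocorr f (t n) - autocorr f 0) < e" by blast
qed

section \<open>Plancherel's theorem\<close>

text \<open>The squared modulus of the transform is damped by a wide Gaussian. The multiplication
  formula turns its integral into an average of \<open>autocorr f\<close> against a narrow Gaussian,
  which tends to the value at 0. The damped integrands increase with \<open>n\<close>, so monotone
  convergence yields integrability of the limit together with its integral.\<close>

theorem Plancherel_norm:
  fixes f :: "'a::euclidean_space \<Rightarrow> complex"
  assumes f: "integrable lborel f" "L2 f" and s: "s \<noteq> 0"
  shows "L2 (ft s f)" "(norm_L2 (ft s f))\<^sup>2 = (2 * pi / \<bar>s\<bar>) ^ DIM('a) * (norm_L2 f)\<^sup>2"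
proof -
  have fm [measurable]: "f \<in> borel_measurable borel" using f by auto
  have Fm [measurable]: "ft s f \<in> borel_measurable borel" by measurable
  \<comment> \<open>Any positive sequence decreasing to 0 would do; monotonicity makes the damping
    factors increase.\<close>
  define \<delta> :: "nat \<Rightarrow> real" where "\<delta> n = inverse (real (Suc n))" for n
  have \<delta>: "\<delta> n > 0" for n by (simp add: \<delta>_def)
  have \<delta>_lim: "\<delta> \<longlonglongrightarrow> 0"
    unfolding \<delta>_def by (rule LIMSEQ_inverse_real_of_nat)
  let ?G = "\<lambda>n x. gauss (\<delta> n *\<^sub>R (x::'a))"
  let ?u = "\<lambda>n \<xi>. (norm (ft s f \<xi>))\<^sup>2 * ?G n \<xi>"
  let ?r = "sqrt (2 * pi)"
  have h: "integrable lborel (autocorr f)" by (rule autocorr_integrable[OF f(1)])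
  have hm [measurable]: "autocorr f \<in> borel_measurable borel" using h by auto
  have G: "integrable lborel (\<lambda>x. complex_of_real (?G n x))" for n
    using lborel_integrable_affine[OF integrable_gauss, of "\<delta> n" 0] \<delta>[of n] by simp
  have u_int: "integrable lborel (?u n)" for n
  proof (rule Bochner_Integration.integrable_bound)
    show "integrable lborel (\<lambda>x. (\<integral>x. norm (f x) \<partial>lborel)\<^sup>2 *\<^sub>R complex_of_real (?G n x))"
      using G[of n] by simp
    show "AE x in lborel. norm (?u n x) \<le> norm ((\<integral>x. norm (f x) \<partial>lborel)\<^sup>2 *\<^sub>R complex_of_real (?G n x))"
      using power_mono[OF ft_bounded norm_ge_zero, where n=2]
      by (intro AE_I2) (auto simp: abs_mult intro!: mult_right_mono)
  qed measurable
  \<comment> \<open>The substitution by \<open>\<delta> n / s\<close> cancels all powers of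
    \<open>\<delta> n\<close>, leaving the dependence on \<open>n\<close> in the argument of
    \<open>autocorr f\<close> alone.\<close>
  have int_u: "complex_of_real (\<integral>\<xi>. ?u n \<xi> \<partial>lborel) =
     complex_of_real ((?r / \<bar>s\<bar>) ^ DIM('a)) * (\<integral>\<tau>. autocorr f ((\<delta> n / s) *\<^sub>R \<tau>) * complex_of_real (gauss \<tau>) \<partial>lborel)" for n
  proof -
    have "complex_of_real (\<integral>\<xi>. ?u n \<xi> \<partial>lborel) = (\<integral>\<xi>. ft s (autocorr f) \<xi> * complex_of_real (?G n \<xi>) \<partial>lborel)"
      by (subst integral_complex_of_real[symmetric]) (simp add: ft_autocorr[OF f(1)])
    also have "\<dots> = (\<integral>t. autocorr f t * ft s (\<lambda>\<xi>. complex_of_real (?G n \<xi>)) t \<partial>lborel)"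
      by (rule ft_mult_formula[OF h G])
    also have "\<dots> = (\<integral>t. autocorr f t * complex_of_real ((?r / \<delta> n) ^ DIM('a) * gauss ((s / \<delta> n) *\<^sub>R t)) \<partial>lborel)"
      by (simp only: ft_gauss_scaled[OF \<delta>])
    also have "\<dots> = \<bar>\<delta> n / s\<bar> ^ DIM('a) *\<^sub>R (\<integral>\<tau>. autocorr f (0 + (\<delta> n / s) *\<^sub>R \<tau>) *
        complex_of_real ((?r / \<delta> n) ^ DIM('a) * gauss ((s / \<delta> n) *\<^sub>R (0 + (\<delta> n / s) *\<^sub>R \<tau>))) \<partial>lborel)"
      by (rule lborel_integral_affine) (use \<delta>[of n] s in simp)
    also have "\<dots> = \<bar>\<delta> n / s\<bar> ^ DIM('a) *\<^sub>R (\<integral>\<tau>. complex_of_real ((?r / \<delta> n) ^ DIM('a)) * (autocorr f ((\<delta> n / s) *\<^sub>R \<tau>) *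
        complex_of_real (gauss \<tau>)) \<partial>lborel)"
      using \<delta>[of n] s by (simp add: mult_ac)
    also have "\<dots> = complex_of_real (\<bar>\<delta> n / s\<bar> ^ DIM('a) * (?r / \<delta> n) ^ DIM('a)) *
        (\<integral>\<tau>. autocorr f ((\<delta> n / s) *\<^sub>R \<tau>) * complex_of_real (gauss \<tau>) \<partial>lborel)"
      by (simp only: Bochner_Integration.integral_mult_right_zero scaleR_conv_of_real of_real_mult mult.assoc)
    also have "\<bar>\<delta> n / s\<bar> ^ DIM('a) * (?r / \<delta> n) ^ DIM('a) = (?r / \<bar>s\<bar>) ^ DIM('a)"
      using \<delta>[of n] by (simp add: power_mult_distrib[symmetric])
    finally show ?thesis .
  qed
  have "(\<lambda>n. \<integral>\<tau>. autocorr f ((\<delta> n / s) *\<^sub>R \<tau>) * complex_of_real (gauss \<tau>) \<partial>lborel) \<longlonglongrightarrow>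
     (\<integral>\<tau>. autocorr f 0 * complex_of_real (gauss (\<tau>::'a)) \<partial>lborel)"
  proof (rule integral_dominated_convergence[where w="\<lambda>\<tau>. (norm_L2 f)\<^sup>2 * norm (complex_of_real (gauss \<tau>))"])
    show "integrable lborel (\<lambda>\<tau>::'a. (norm_L2 f)\<^sup>2 * norm (complex_of_real (gauss \<tau>)))"
      by (intro integrable_mult_right integrable_norm integrable_gauss)
    show "AE \<tau> in lborel. (\<lambda>n. autocorr f ((\<delta> n / s) *\<^sub>R \<tau>) * complex_of_real (gauss \<tau>)) \<longlonglongrightarrow> autocorr f 0 * complex_of_real (gauss \<tau>)"
    proof (rule AE_I2)
      fix \<tau> :: 'a
      have "(\<lambda>n. (\<delta> n / s) *\<^sub>R \<tau>) \<longlonglongrightarrow> (0 / s) *\<^sub>R \<tau>"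
        by (intro tendsto_intros \<delta>_lim s)
      then have "(\<lambda>n. autocorr f ((\<delta> n / s) *\<^sub>R \<tau>)) \<longlonglongrightarrow> autocorr f 0"
        by (intro autocorr_tendsto f) simp
      then show "(\<lambda>n. autocorr f ((\<delta> n / s) *\<^sub>R \<tau>) * complex_of_real (gauss \<tau>)) \<longlonglongrightarrow> autocorr f 0 * complex_of_real (gauss \<tau>)"
        by (intro tendsto_intros)
    qed
    show "AE \<tau> in lborel. norm (autocorr f ((\<delta> n / s) *\<^sub>R \<tau>) * complex_of_real (gauss \<tau>)) \<le> (norm_L2 f)\<^sup>2 * norm (complex_of_real (gauss \<tau>))" for n
      using autocorr_bounded[OF f(2)] by (intro AE_I2) (auto simp: norm_mult intro!: mult_right_mono)
  qed measurable
  then have "(\<lambda>n. complex_of_real (\<integral>\<xi>. ?u n \<xi> \<partial>lborel)) \<longlonglongrightarrow>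
     complex_of_real ((?r / \<bar>s\<bar>) ^ DIM('a)) * (\<integral>\<tau>. autocorr f 0 * complex_of_real (gauss (\<tau>::'a)) \<partial>lborel)"
    unfolding int_u by (intro tendsto_intros)
  also have "complex_of_real ((?r / \<bar>s\<bar>) ^ DIM('a)) * (\<integral>\<tau>. autocorr f 0 * complex_of_real (gauss (\<tau>::'a)) \<partial>lborel) =
     complex_of_real ((?r / \<bar>s\<bar>) ^ DIM('a) * ((norm_L2 f)\<^sup>2 * ?r ^ DIM('a)))"
    by (simp only: Bochner_Integration.integral_mult_right_zero integral_gauss autocorr_0[OF f(2)] of_real_mult of_real_power)
  also have "(?r / \<bar>s\<bar>) ^ DIM('a) * ((norm_L2 f)\<^sup>2 * ?r ^ DIM('a)) = (2 * pi / \<bar>s\<bar>) ^ DIM('a) * (norm_L2 f)\<^sup>2"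
  proof -
    have "(?r / \<bar>s\<bar>) ^ DIM('a) * ?r ^ DIM('a) = (2 * pi / \<bar>s\<bar>) ^ DIM('a)"
      unfolding power_mult_distrib[symmetric] by simp
    then show ?thesis by (metis mult.assoc mult.commute)
  qed
  finally have lim: "(\<lambda>n. \<integral>\<xi>. ?u n \<xi> \<partial>lborel) \<longlonglongrightarrow> (2 * pi / \<bar>s\<bar>) ^ DIM('a) * (norm_L2 f)\<^sup>2"
    unfolding tendsto_of_real_iff .
  have mono: "AE \<xi> in lborel. mono (\<lambda>n. ?u n \<xi>)"
  proof (intro AE_I2 monoI mult_left_mono)
    fix \<xi> :: 'a and m n :: nat assume "m \<le> n"
    then have "\<delta> n \<le> \<delta> m" by (simp add: \<delta>_def field_simps)
    then have "norm (\<delta> n *\<^sub>R \<xi>) \<le> norm (\<delta> m *\<^sub>R \<xi>)"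
      using \<delta>[of n] \<delta>[of m] by (simp add: mult_right_mono)
    then show "?G m \<xi> \<le> ?G n \<xi>"
      unfolding gauss_def by (simp add: power_mono)
  qed simp
  have ulim: "AE \<xi> in lborel. (\<lambda>n. ?u n \<xi>) \<longlonglongrightarrow> (norm (ft s f \<xi>))\<^sup>2"
  proof (rule AE_I2)
    fix \<xi> :: 'a
    have "(\<lambda>n. ?u n \<xi>) \<longlonglongrightarrow> (norm (ft s f \<xi>))\<^sup>2 * exp (- (norm (0 *\<^sub>R \<xi>))\<^sup>2 / 2)"
      unfolding gauss_def by (intro tendsto_intros \<delta>_lim) simp
    then show "(\<lambda>n. ?u n \<xi>) \<longlonglongrightarrow> (norm (ft s f \<xi>))\<^sup>2" by simp
  qed
  \<comment> \<open>Integrability is a conclusion here: the damped integrals converge and their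
    integrands are monotone.\<close>
  have 1: "integrable lborel (\<lambda>\<xi>. (norm (ft s f \<xi>))\<^sup>2)"
    by (rule integrable_monotone_convergence[OF u_int mono ulim lim]) measurable
  show "L2 (ft s f)" by (rule L2I[OF Fm 1])
  show "(norm_L2 (ft s f))\<^sup>2 = (2 * pi / \<bar>s\<bar>) ^ DIM('a) * (norm_L2 f)\<^sup>2"
    unfolding norm_L2_square[of "ft s f"]
    by (rule integral_monotone_convergence[OF u_int mono ulim lim]) measurable
qed

text \<open>Every coefficient is displayed as a multiple of \<open>w\<close>, even 1, so that one
  identity for \<open>f + c g\<close> with arbitrary \<open>c\<close> rewrites all four terms in the
  proof of Plancherel's theorem.\<close>

lemma complex_polarization:
  "4 * (z * cnj w) = complex_of_real ((norm (z + 1 * w))\<^sup>2) - complex_of_real ((norm (z + (-1) * w))\<^sup>2)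
     + \<i> * complex_of_real ((norm (z + \<i> * w))\<^sup>2) - \<i> * complex_of_real ((norm (z + (-\<i>) * w))\<^sup>2)"
  by (simp only: complex_norm_square) (simp add: algebra_simps)

lemma L2_polarization:
  assumes "L2 f" "L2 g"
  shows "4 * (\<integral>x. f x * cnj (g x) \<partial>lborel) =
     complex_of_real ((norm_L2 (\<lambda>x. f x + 1 * g x))\<^sup>2) - complex_of_real ((norm_L2 (\<lambda>x. f x + (-1) * g x))\<^sup>2)
     + \<i> * complex_of_real ((norm_L2 (\<lambda>x. f x + \<i> * g x))\<^sup>2) - \<i> * complex_of_real ((norm_L2 (\<lambda>x. f x + (-\<i>) * g x))\<^sup>2)"
proof -
  have i: "integrable lborel (\<lambda>x. complex_of_real ((norm (f x + c * g x))\<^sup>2))" for c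
    unfolding complex_of_real_integrable_eq by (rule L2_integrable[OF L2_add[OF assms(1) L2_cmult[OF assms(2)]]])
  have "4 * (\<integral>x. f x * cnj (g x) \<partial>lborel) = (\<integral>x. 4 * (f x * cnj (g x)) \<partial>lborel)"
    by (rule Bochner_Integration.integral_mult_right_zero[symmetric])
  also have "\<dots> = (\<integral>x. complex_of_real ((norm (f x + 1 * g x))\<^sup>2) - complex_of_real ((norm (f x + (-1) * g x))\<^sup>2)
     + \<i> * complex_of_real ((norm (f x + \<i> * g x))\<^sup>2) - \<i> * complex_of_real ((norm (f x + (-\<i>) * g x))\<^sup>2) \<partial>lborel)"
    by (simp only: complex_polarization)
  also have "\<dots> = (\<integral>x. complex_of_real ((norm (f x + 1 * g x))\<^sup>2) \<partial>lborel) - (\<integral>x. complex_of_real ((norm (f x + (-1) * g x))\<^sup>2) \<partial>lborel)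
     + \<i> * (\<integral>x. complex_of_real ((norm (f x + \<i> * g x))\<^sup>2) \<partial>lborel) - \<i> * (\<integral>x. complex_of_real ((norm (f x + (-\<i>) * g x))\<^sup>2) \<partial>lborel)"
    using i[of 1] i[of "-1"] i[of \<i>] i[of "-\<i>"] by simp
  finally show ?thesis
    by (simp only: norm_L2_square integral_complex_of_real)
qed

lemma ft_add_cmult:
  fixes f :: "'a::euclidean_space \<Rightarrow> complex"
  assumes "integrable lborel f" "integrable lborel g"
  shows "ft s (\<lambda>x. f x + c * g x) \<xi> = ft s f \<xi> + c * ft s g \<xi>"
proof -
  have "(\<lambda>x. s * (\<xi> \<bullet> x)) \<in> borel_measurable borel" by measurable
  note i = integrable_cis_mult[OF assms(1) this] integrable_cis_mult[OF assms(2) this]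
  have "ft s (\<lambda>x. f x + c * g x) \<xi> = (\<integral>x. cis (s * (\<xi> \<bullet> x)) * f x + c * (cis (s * (\<xi> \<bullet> x)) * g x) \<partial>lborel)"
    unfolding ft_def by (simp add: ring_distribs mult_ac)
  then show ?thesis using i by (simp add: ft_def)
qed

theorem Plancherel:
  fixes f g :: "'a::euclidean_space \<Rightarrow> complex"
  assumes f: "integrable lborel f" "L2 f" and g: "integrable lborel g" "L2 g" and s: "s \<noteq> 0"
  shows "(\<integral>\<xi>. ft s f \<xi> * cnj (ft s g \<xi>) \<partial>lborel) = complex_of_real ((2 * pi / \<bar>s\<bar>) ^ DIM('a)) * (\<integral>x. f x * cnj (g x) \<partial>lborel)"
proof -
  have e: "complex_of_real ((norm_L2 (\<lambda>\<xi>. ft s f \<xi> + c * ft s g \<xi>))\<^sup>2) =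
     complex_of_real ((2 * pi / \<bar>s\<bar>) ^ DIM('a)) * complex_of_real ((norm_L2 (\<lambda>x. f x + c * g x))\<^sup>2)" for c
  proof -
    have "ft s (\<lambda>x. f x + c * g x) = (\<lambda>\<xi>. ft s f \<xi> + c * ft s g \<xi>)"
      by (intro ext ft_add_cmult f g)
    moreover have "integrable lborel (\<lambda>x. f x + c * g x)" "L2 (\<lambda>x. f x + c * g x)"
      using f g by (auto intro: L2_add L2_cmult)
    note Plancherel_norm(2)[OF this s]
    ultimately show ?thesis
      by (simp only: of_real_mult[symmetric])
  qed
  have "4 * (\<integral>\<xi>. ft s f \<xi> * cnj (ft s g \<xi>) \<partial>lborel) =
      complex_of_real ((2 * pi / \<bar>s\<bar>) ^ DIM('a)) * (4 * (\<integral>x. f x * cnj (g x) \<partial>lborel))"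
    unfolding L2_polarization[OF Plancherel_norm(1)[OF f s] Plancherel_norm(1)[OF g s]]
      L2_polarization[OF f(2) g(2)] e by (simp only: ring_distribs mult.left_commute mult.assoc)
  then show ?thesis by simp
qed

section \<open>Partial and symplectic Fourier transforms\<close>

lemma borel_measurable_fst_snd [measurable (raw)]:
  fixes f :: "'c \<Rightarrow> 'a::euclidean_space \<times> 'b::euclidean_space"
  assumes "f \<in> borel_measurable M"
  shows "(\<lambda>x. fst (f x)) \<in> borel_measurable M" "(\<lambda>x. snd (f x)) \<in> borel_measurable M"
  by (rule measurable_compose[OF assms borel_measurable_continuous_onI], intro continuous_intros)+

lemma integral_lborel_prod:
  fixes f :: "'a::euclidean_space \<times> 'b::euclidean_space \<Rightarrow> 'c::{banach, second_countable_topology}"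
  assumes "integrable lborel f"
  shows "(\<integral>z. f z \<partial>lborel) = (\<integral>x. \<integral>y. f (x, y) \<partial>lborel \<partial>lborel)"
    "(\<integral>z. f z \<partial>lborel) = (\<integral>y. \<integral>x. f (x, y) \<partial>lborel \<partial>lborel)"
    "integrable lborel (\<lambda>x. \<integral>y. f (x, y) \<partial>lborel)"
    "integrable lborel (\<lambda>y. \<integral>x. f (x, y) \<partial>lborel)"
    "AE x in lborel. integrable lborel (\<lambda>y. f (x, y))"
proof -
  have i: "integrable (lborel \<Otimes>\<^sub>M lborel) (case_prod (\<lambda>x y. f (x, y)))"
    using assms by (simp add: lborel_prod)
  show "(\<integral>z. f z \<partial>lborel) = (\<integral>x. \<integral>y. f (x, y) \<partial>lborel \<partial>lborel)"
    using lborel_pair.integral_fst[OF i] by (simp add: lborel_prod)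
  show "(\<integral>z. f z \<partial>lborel) = (\<integral>y. \<integral>x. f (x, y) \<partial>lborel \<partial>lborel)"
    using lborel_pair.integral_snd[OF i] by (simp add: lborel_prod)
  show "integrable lborel (\<lambda>x. \<integral>y. f (x, y) \<partial>lborel)"
    by (rule lborel_pair.integrable_fst[OF i])
  show "integrable lborel (\<lambda>y. \<integral>x. f (x, y) \<partial>lborel)"
    by (rule lborel_pair.integrable_snd[OF i])
  show "AE x in lborel. integrable lborel (\<lambda>y. f (x, y))"
    by (rule lborel_pair.AE_integrable_fst[OF i])
qed

lemma lborel_Fubini:
  fixes f :: "'a::euclidean_space \<Rightarrow> 'b::euclidean_space \<Rightarrow> 'c::{banach, second_countable_topology}"
  assumes "integrable lborel (\<lambda>z. f (fst z) (snd z))"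
  shows "(\<integral>x. \<integral>y. f x y \<partial>lborel \<partial>lborel) = (\<integral>y. \<integral>x. f x y \<partial>lborel \<partial>lborel)"
  using integral_lborel_prod(1,2)[OF assms] by simp

lemma integrable_lborel_prodI:
  fixes f :: "'a::euclidean_space \<times> 'b::euclidean_space \<Rightarrow> 'c::{banach, second_countable_topology}"
  assumes "f \<in> borel_measurable borel" "\<And>x. integrable lborel (\<lambda>y. f (x, y))"
    "integrable lborel (\<lambda>x. \<integral>y. norm (f (x, y)) \<partial>lborel)"
  shows "integrable lborel f"
  using lborel_pair.Fubini_integrable[of f] assms by (simp add: lborel_prod)

section \<open>Sections, swaps and the transform in one variable of a product\<close>

lemma bounded_cs_section1:
  assumes "bounded_cs R" shows "bounded_cs (\<lambda>x. R (w, x))"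
proof -
  obtain M B where *: "R \<in> borel_measurable borel" "\<And>x. norm (R x) \<le> M" "\<And>x. B < norm x \<Longrightarrow> R x = 0"
    using assms by (rule bounded_csE) blast
  note [measurable] = *(1)
  show ?thesis
  proof (rule bounded_csI[where M=M and R=B])
    show "R (w, x) = 0" if "B < norm x" for x
      using *(3)[of "(w, x)"] norm_snd_le[of x w] that by simp
  qed (measurable, use *(2) in auto)
qed

lemma bounded_cs_swap:
  assumes "bounded_cs R" shows "bounded_cs (\<lambda>z. R (snd z, fst z))"
proof -
  obtain M B where *: "R \<in> borel_measurable borel" "\<And>x. norm (R x) \<le> M" "\<And>x. B < norm x \<Longrightarrow> R x = 0"
    using assms by (rule bounded_csE) blast
  note [measurable] = *(1)
  show ?thesis
    by (rule bounded_csI[where M=M and R=B])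
      (measurable, use * in \<open>auto simp: norm_prod_def add.commute\<close>)
qed

lemma bounded_cs_section2:
  assumes "bounded_cs R" shows "bounded_cs (\<lambda>w. R (w, x))"
  using bounded_cs_section1[OF bounded_cs_swap[OF assms]] by simp

text \<open>Kernels and symbols, Wigner functions and ambiguity functions are all linked by a
  transform in one variable; treating the other as a parameter reduces each of these links to
  \<open>ft\<close> on sections.\<close>

definition pft :: "real \<Rightarrow> ('a::euclidean_space \<times> 'b::euclidean_space \<Rightarrow> complex) \<Rightarrow> 'a \<times> 'b \<Rightarrow> complex" where
  "pft s R z = ft s (\<lambda>x. R (fst z, x)) (snd z)"

lemma pft_measurable [measurable]:
  assumes [measurable]: "R \<in> borel_measurable borel"
  shows "pft s R \<in> borel_measurable borel"
  unfolding pft_def[abs_def] ft_def by measurable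

text \<open>Plancherel on every section, then Tonelli in the parameter; hence only the dimension of
  the transformed factor appears.\<close>

lemma pft_Plancherel:
  fixes R :: "'a::euclidean_space \<times> 'b::euclidean_space \<Rightarrow> complex"
  assumes R: "bounded_cs R" and s: "s \<noteq> 0"
  shows "L2 (pft s R)" "(norm_L2 (pft s R))\<^sup>2 = (2 * pi / \<bar>s\<bar>) ^ DIM('b) * (norm_L2 R)\<^sup>2"
proof -
  let ?C = "(2 * pi / \<bar>s\<bar>) ^ DIM('b)"
  have Rm [measurable]: "R \<in> borel_measurable borel" using R by auto
  have sec: "bounded_cs (\<lambda>x. R (w, x))" for w by (rule bounded_cs_section1[OF R])
  note P = Plancherel_norm[OF bounded_cs_integrable[OF sec] bounded_cs_L2[OF sec] s]
  have I: "(\<integral>p. (norm (pft s R (w, p)))\<^sup>2 \<partial>lborel) = ?C * (\<integral>x. (norm (R (w, x)))\<^sup>2 \<partial>lborel)" for w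
    using P(2)[of w] unfolding norm_L2_square pft_def by simp
  have R2: "integrable lborel (\<lambda>z. (norm (R z))\<^sup>2)"
    by (rule L2_integrable[OF bounded_cs_L2[OF R]])
  have int: "integrable lborel (\<lambda>z. (norm (pft s R z))\<^sup>2)"
  proof (rule integrable_lborel_prodI)
    show "integrable lborel (\<lambda>p. (norm (pft s R (w, p)))\<^sup>2)" for w
      using L2_integrable[OF P(1)[of w]] by (simp add: pft_def)
    show "integrable lborel (\<lambda>w. \<integral>p. norm ((norm (pft s R (w, p)))\<^sup>2) \<partial>lborel)"
      using integral_lborel_prod(3)[OF R2] by (simp add: I)
  qed measurable
  show "L2 (pft s R)" by (rule L2I[OF _ int]) measurable
  show "(norm_L2 (pft s R))\<^sup>2 = ?C * (norm_L2 R)\<^sup>2"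
    unfolding norm_L2_square integral_lborel_prod(1)[OF int] integral_lborel_prod(1)[OF R2] I by simp
qed

text \<open>The standard symplectic matrix: \<open>sympl z z'\<close> is the inner product of
  \<open>sympl_rot z\<close> with \<open>z'\<close>, so the symplectic Fourier transform is the
  ordinary one composed with this map.\<close>

definition sympl_rot :: "'a::euclidean_space \<times> 'a \<Rightarrow> 'a \<times> 'a" where
  "sympl_rot z = (snd z, - fst z)"

lemma sympl_rot_measurable [measurable]: "sympl_rot \<in> borel_measurable borel"
  unfolding sympl_rot_def[abs_def] by measurable

lemma lborel_distr_uminus_euclidean: "distr lborel borel uminus = (lborel :: 'a::euclidean_space measure)"
  by (subst lborel_affine[of "-1" 0]) (auto simp: density_1)

text \<open>The map swaps the two factors and then reflects the second; each of these preserves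
  Lebesgue measure.\<close>

lemma lborel_distr_sympl_rot: "distr lborel borel sympl_rot = (lborel :: ('a::euclidean_space \<times> 'a) measure)"
proof -
  let ?L = "lborel :: 'a measure"
  have sf: "sigma_finite_measure (distr ?L lborel uminus)"
    using lborel_distr_uminus_euclidean[where 'a='a] sigma_finite_lborel
    by (simp cong: distr_cong)
  have u: "distr ?L lborel uminus = ?L"
    using lborel_distr_uminus_euclidean[where 'a='a] by (simp cong: distr_cong)
  have "?L \<Otimes>\<^sub>M ?L = distr ?L ?L (\<lambda>x. x) \<Otimes>\<^sub>M distr ?L lborel uminus"
    by (simp add: u distr_id2)
  also have "\<dots> = distr (?L \<Otimes>\<^sub>M ?L) (?L \<Otimes>\<^sub>M ?L) (\<lambda>(x, y). (x, - y))"
    by (rule pair_measure_distr[OF _ _ sf]) auto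
  also have "\<dots> = distr (distr (?L \<Otimes>\<^sub>M ?L) (?L \<Otimes>\<^sub>M ?L) (\<lambda>(x, y). (y, x))) (?L \<Otimes>\<^sub>M ?L) (\<lambda>(x, y). (x, - y))"
    by (simp only: lborel_pair.distr_pair_swap[symmetric])
  also have "\<dots> = distr (?L \<Otimes>\<^sub>M ?L) (?L \<Otimes>\<^sub>M ?L) ((\<lambda>(x, y). (x, - y)) \<circ> (\<lambda>(x, y). (y, x)))"
    by (rule distr_distr) measurable
  also have "((\<lambda>(x, y). (x, - y)) \<circ> (\<lambda>(x, y). (y, x))) = (sympl_rot :: 'a \<times> 'a \<Rightarrow> _)"
    by (auto simp: sympl_rot_def)
  finally have "lborel = distr lborel (lborel :: ('a \<times> 'a) measure) sympl_rot"
    by (simp only: lborel_prod)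
  also have "\<dots> = distr lborel borel sympl_rot" by (rule distr_cong) auto
  finally show ?thesis by (rule sym)
qed

lemma L2_sympl_rot:
  fixes f :: "'a::euclidean_space \<times> 'a \<Rightarrow> complex"
  assumes "L2 f" shows "L2 (\<lambda>z. f (sympl_rot z))" "norm_L2 (\<lambda>z. f (sympl_rot z)) = norm_L2 f"
proof -
  have [measurable]: "f \<in> borel_measurable borel" using assms by auto
  have "integrable (distr lborel borel sympl_rot) (\<lambda>z. (norm (f z))\<^sup>2)"
    unfolding lborel_distr_sympl_rot by (rule L2_integrable[OF assms])
  then have "integrable lborel (\<lambda>z. (norm (f (sympl_rot z)))\<^sup>2)"
    by (subst (asm) integrable_distr_eq) auto
  then show "L2 (\<lambda>z. f (sympl_rot z))" by (intro L2I) measurable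
  have "(\<integral>z. (norm (f z))\<^sup>2 \<partial>(distr lborel borel sympl_rot)) = (\<integral>z. (norm (f (sympl_rot z)))\<^sup>2 \<partial>lborel)"
    by (subst integral_distr) auto
  then show "norm_L2 (\<lambda>z. f (sympl_rot z)) = norm_L2 f"
    unfolding norm_L2_def lborel_distr_sympl_rot by simp
qed

section \<open>The symplectic Fourier transform and its extension to L2\<close>

lemma exp_minus_i: "exp (- \<i> * complex_of_real t) = cis (- t)"
  by (simp add: cis_conv_exp)

lemma powr_minus_CARD:
  assumes "\<eta> > 0"
  shows "(2 * pi * \<eta>) powr (- real CARD('n::finite)) = 1 / (2 * pi * \<eta>) ^ CARD('n)"
  using assms by (simp add: powr_minus powr_realpow divide_inverse)

lemma sympl_FT_conv_ft:
  fixes a :: "'n::finite phase \<Rightarrow> complex"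
  assumes "\<eta> > 0"
  shows "sympl_FT \<eta> a z = complex_of_real (1 / (2 * pi * \<eta>) ^ CARD('n)) * ft (- 1 / \<eta>) a (sympl_rot z)"
  unfolding sympl_FT_def powr_minus_CARD[OF assms] ft_def exp_minus_i
  by (simp add: sympl_def sympl_rot_def inner_prod_def inner_commute)

lemma sympl_FT_isometry:
  fixes a :: "'n::finite phase \<Rightarrow> complex"
  assumes \<eta>: "\<eta> > 0" and a: "integrable lborel a" "L2 a"
  shows "L2 (sympl_FT \<eta> a)" "norm_L2 (sympl_FT \<eta> a) = norm_L2 a"
proof -
  let ?c = "complex_of_real (1 / (2 * pi * \<eta>) ^ CARD('n))"
  have e: "sympl_FT \<eta> a = (\<lambda>z. ?c * ft (- 1 / \<eta>) a (sympl_rot z))"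
    using sympl_FT_conv_ft[OF \<eta>] by blast
  have s: "- 1 / \<eta> \<noteq> 0" using \<eta> by simp
  note P = Plancherel_norm[OF a s]
  show "L2 (sympl_FT \<eta> a)" unfolding e by (intro L2_cmult L2_sympl_rot P)
  \<comment> \<open>Phase space has dimension \<open>2 * CARD('n)\<close>, so the Plancherel factor
    is the square of \<open>(2 * pi * \<eta>) ^ CARD('n)\<close> and the prefactor of
    \<open>sympl_FT\<close> removes it exactly.\<close>
  have "(norm_L2 (ft (- 1 / \<eta>) a))\<^sup>2 = ((2 * pi * \<eta>) ^ CARD('n) * norm_L2 a)\<^sup>2"
    unfolding P(2) using \<eta> by (simp add: power_mult_distrib power_even_eq power2_eq_square power_add)
  then have "norm_L2 (ft (- 1 / \<eta>) a) = (2 * pi * \<eta>) ^ CARD('n) * norm_L2 a"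
    by (rule power2_eq_imp_eq) (use \<eta> in auto)
  moreover have "norm ?c = 1 / (2 * pi * \<eta>) ^ CARD('n)"
    using \<eta> by (simp only: norm_of_real) simp
  ultimately show "norm_L2 (sympl_FT \<eta> a) = norm_L2 a"
    unfolding e norm_L2_cmult L2_sympl_rot(2)[OF P(1)] using \<eta> by simp
qed

lemma sympl_FT_diff:
  fixes a b :: "'n::finite phase \<Rightarrow> complex"
  assumes \<eta>: "\<eta> > 0" and a: "integrable lborel a" and b: "integrable lborel b"
  shows "sympl_FT \<eta> a z - sympl_FT \<eta> b z = sympl_FT \<eta> (\<lambda>z. a z - b z) z"
  unfolding sympl_FT_conv_ft[OF \<eta>]
  using ft_add_cmult[OF a b, of "- 1 / \<eta>" "-1"] by (simp add: right_diff_distrib)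

lemma L2_integrable_ball:
  fixes a :: "'a::euclidean_space \<Rightarrow> complex"
  assumes "L2 a"
  shows "L2 (\<lambda>w. indicator (cball 0 r) w * a w)" "integrable lborel (\<lambda>w. indicator (cball 0 r) w * a w)"
proof -
  have [measurable]: "a \<in> borel_measurable borel" using assms by auto
  show "L2 (\<lambda>w. indicator (cball 0 r) w * a w)"
    by (rule L2_bound[OF assms, where C=1]) (measurable, auto simp: indicator_def)
  have "bounded_cs (\<lambda>w::'a. indicator (cball 0 r) w :: complex)"
    by (rule bounded_csI[where M=1 and R=r]) (auto simp: indicator_def)
  then show "integrable lborel (\<lambda>w. indicator (cball 0 r) w * a w)"
    by (intro L2_mult_integrable assms bounded_cs_L2)
qed

lemma indicator_ball_tendsto:
  fixes a :: "'a::euclidean_space \<Rightarrow> complex"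
  assumes "L2 a"
  shows "(\<lambda>k. norm_L2 (\<lambda>w. indicator (cball 0 (real k)) w * a w - a w)) \<longlonglongrightarrow> 0"
proof (rule L2_dominated_tendsto[OF assms])
  show "(\<lambda>w. indicator (cball 0 (real k)) w * a w) \<in> borel_measurable borel" for k
    using L2_integrable_ball(1)[OF assms] by auto
  show "norm (indicator (cball 0 (real k)) x * a x) \<le> norm (a x)" for k x
    by (auto simp: indicator_def)
  fix x :: 'a
  obtain N :: nat where N: "norm x \<le> real N"
    using real_arch_simple by blast
  have "\<forall>\<^sub>F k in sequentially. indicator (cball 0 (real k)) x * a x = a x"
    using N by (intro eventually_sequentiallyI[of N]) (auto simp: indicator_def)
  then show "(\<lambda>k. indicator (cball 0 (real k)) x * a x) \<longlonglongrightarrow> a x"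
    by (rule tendsto_eventually)
qed

text \<open>The transforms of the truncations form a Cauchy sequence by the isometry, so
  completeness provides a limit for the choice operator to pick. Limits agree up to null sets, which
  pairings do not see.\<close>

lemma is_sympl_FT_L2_sympl_FT_L2:
  fixes a :: "'n::finite phase \<Rightarrow> complex"
  assumes \<eta>: "\<eta> > 0" and a: "L2 a"
  shows "is_sympl_FT_L2 \<eta> a (sympl_FT_L2 \<eta> a)"
proof -
  let ?a = "\<lambda>k w. indicator (cball 0 (real k)) w * a w"
  note aL = L2_integrable_ball[OF a]
  have b: "L2 (sympl_FT \<eta> (?a k))" for k
    by (rule sympl_FT_isometry(1)[OF \<eta> aL(2,1)])
  have d: "norm_L2 (\<lambda>z. sympl_FT \<eta> (?a i) z - sympl_FT \<eta> (?a j) z) = norm_L2 (\<lambda>z. ?a i z - ?a j z)" for i j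
    unfolding sympl_FT_diff[OF \<eta> aL(2) aL(2)]
    by (rule sympl_FT_isometry(2)[OF \<eta> Bochner_Integration.integrable_diff[OF aL(2) aL(2)] L2_diff[OF aL(1) aL(1)]])
  have "\<exists>N. \<forall>i\<ge>N. \<forall>j\<ge>N. norm_L2 (\<lambda>z. sympl_FT \<eta> (?a i) z - sympl_FT \<eta> (?a j) z) < e" if "e > 0" for e
  proof -
    obtain N where N: "\<And>k. k \<ge> N \<Longrightarrow> norm_L2 (\<lambda>w. ?a k w - a w) < e / 2"
      using LIMSEQ_D[OF indicator_ball_tendsto[OF a], of "e/2"] \<open>e > 0\<close> by auto
    have "norm_L2 (\<lambda>z. ?a i z - ?a j z) < e" if "i \<ge> N" "j \<ge> N" for i j
      using norm_L2_triangle_diff[OF aL(1) a aL(1), of "real i" "real j"] N[OF that(1)] N[OF that(2)]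
        norm_L2_minus_commute[of a "?a j"] by simp
    then show ?thesis unfolding d by blast
  qed
  from L2_complete[OF b this] obtain g where g: "L2 g"
    "(\<lambda>k. norm_L2 (\<lambda>z. sympl_FT \<eta> (?a k) z - g z)) \<longlonglongrightarrow> 0" by blast
  have "(\<lambda>k. (norm_L2 (\<lambda>z. sympl_FT \<eta> (?a k) z - g z))\<^sup>2) \<longlonglongrightarrow> 0\<^sup>2"
    by (intro tendsto_intros g)
  then have "is_sympl_FT_L2 \<eta> a g"
    unfolding is_sympl_FT_L2_def norm_L2_square using g(1) by simp
  then show ?thesis
    unfolding sympl_FT_L2_def by (rule someI[of "is_sympl_FT_L2 \<eta> a"])
qed

text \<open>The definition cuts to balls, whereas the pairing identity is available for bounded
  functions with bounded support. By the isometry the transforms of the two truncations differ as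
  little as the truncations themselves.\<close>

lemma sympl_FT_L2_trunc_tendsto:
  fixes a :: "'n::finite phase \<Rightarrow> complex"
  assumes \<eta>: "\<eta> > 0" and a: "L2 a"
  shows "L2 (sympl_FT_L2 \<eta> a)"
    "(\<lambda>k. norm_L2 (\<lambda>z. sympl_FT \<eta> (L2_trunc k a) z - sympl_FT_L2 \<eta> a z)) \<longlonglongrightarrow> 0"
proof -
  let ?a = "\<lambda>k w. indicator (cball 0 (real k)) w * a w"
  let ?b = "sympl_FT_L2 \<eta> a"
  note aL = L2_integrable_ball[OF a]
  have "is_sympl_FT_L2 \<eta> a ?b" by (rule is_sympl_FT_L2_sympl_FT_L2[OF assms])
  then have b: "L2 ?b" "(\<lambda>k. (norm_L2 (\<lambda>z. sympl_FT \<eta> (?a k) z - ?b z))\<^sup>2) \<longlonglongrightarrow> 0"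
    unfolding is_sympl_FT_L2_def norm_L2_square by auto
  show "L2 ?b" by (rule b)
  have "(\<lambda>k. sqrt ((norm_L2 (\<lambda>z. sympl_FT \<eta> (?a k) z - ?b z))\<^sup>2)) \<longlonglongrightarrow> sqrt 0"
    by (intro tendsto_intros b)
  then have b2: "(\<lambda>k. norm_L2 (\<lambda>z. sympl_FT \<eta> (?a k) z - ?b z)) \<longlonglongrightarrow> 0" by simp
  have t: "bounded_cs (L2_trunc k a)" for k by (rule bounded_cs_L2_trunc) (use a in auto)
  note tL = bounded_cs_L2[OF t] bounded_cs_integrable[OF t]
  show "(\<lambda>k. norm_L2 (\<lambda>z. sympl_FT \<eta> (L2_trunc k a) z - ?b z)) \<longlonglongrightarrow> 0"
  proof (rule Lim_null_comparison)
    have "norm_L2 (\<lambda>z. sympl_FT \<eta> (L2_trunc k a) z - ?b z) \<le>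
       norm_L2 (\<lambda>w. L2_trunc k a w - a w) + norm_L2 (\<lambda>w. ?a k w - a w) + norm_L2 (\<lambda>z. sympl_FT \<eta> (?a k) z - ?b z)" for k
    proof -
      have "norm_L2 (\<lambda>z. sympl_FT \<eta> (L2_trunc k a) z - ?b z) \<le>
          norm_L2 (\<lambda>z. sympl_FT \<eta> (L2_trunc k a) z - sympl_FT \<eta> (?a k) z) + norm_L2 (\<lambda>z. sympl_FT \<eta> (?a k) z - ?b z)"
        by (rule norm_L2_triangle_diff[OF sympl_FT_isometry(1)[OF \<eta> tL(2,1)] sympl_FT_isometry(1)[OF \<eta> aL(2,1)] b(1)])
      also have "norm_L2 (\<lambda>z. sympl_FT \<eta> (L2_trunc k a) z - sympl_FT \<eta> (?a k) z) = norm_L2 (\<lambda>w. L2_trunc k a w - ?a k w)"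
        unfolding sympl_FT_diff[OF \<eta> tL(2) aL(2)]
        by (rule sympl_FT_isometry(2)[OF \<eta> Bochner_Integration.integrable_diff[OF tL(2) aL(2)] L2_diff[OF tL(1) aL(1)]])
      also have "\<dots> \<le> norm_L2 (\<lambda>w. L2_trunc k a w - a w) + norm_L2 (\<lambda>w. ?a k w - a w)"
        using norm_L2_triangle_diff[OF tL(1) a aL(1), of k "real k"] norm_L2_minus_commute[of a "?a k"] by simp
      finally show ?thesis by simp
    qed
    then show "\<forall>\<^sub>F k in sequentially. norm (norm_L2 (\<lambda>z. sympl_FT \<eta> (L2_trunc k a) z - ?b z)) \<le>
       norm_L2 (\<lambda>w. L2_trunc k a w - a w) + norm_L2 (\<lambda>w. ?a k w - a w) + norm_L2 (\<lambda>z. sympl_FT \<eta> (?a k) z - ?b z)"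
      by simp
    show "(\<lambda>k. norm_L2 (\<lambda>w. L2_trunc k a w - a w) + norm_L2 (\<lambda>w. ?a k w - a w) + norm_L2 (\<lambda>z. sympl_FT \<eta> (?a k) z - ?b z)) \<longlonglongrightarrow> 0"
      using tendsto_add[OF tendsto_add[OF norm_L2_trunc_tendsto[OF a] indicator_ball_tendsto[OF a]] b2] by simp
  qed
qed

section \<open>Operators with bounded compactly supported kernels\<close>

lemma scaleR_half_add_half: "(1/2) *\<^sub>R x + (1/2) *\<^sub>R x = (x :: 'a::real_vector)"
  by (simp flip: scaleR_left_distrib)

text \<open>The lower bound on \<open>\<phi>\<close> makes preimages of bounded sets bounded, with
  the radius enlarged by \<open>C\<close>.\<close>

lemma bounded_cs_comp:
  fixes f :: "'b::euclidean_space \<Rightarrow> complex" and \<phi> :: "'a::euclidean_space \<Rightarrow> 'b"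
  assumes f: "bounded_cs f" and [measurable]: "\<phi> \<in> borel_measurable borel"
    and C: "C > 0" "\<And>x. norm x \<le> C * norm (\<phi> x)"
  shows "bounded_cs (\<lambda>x. f (\<phi> x))"
proof -
  obtain M B where *: "f \<in> borel_measurable borel" "\<And>x. norm (f x) \<le> M" "\<And>x. B < norm x \<Longrightarrow> f x = 0"
    using f by (rule bounded_csE) blast
  note [measurable] = *(1)
  show ?thesis
  proof (rule bounded_csI[where M=M and R="C * B"])
    fix x :: 'a assume "C * B < norm x"
    then have "C * B < C * norm (\<phi> x)" using C(2)[of x] by linarith
    then show "f (\<phi> x) = 0" using C(1) *(3) by simp
  qed (measurable, use *(2) in auto)
qed

lemma norm_Pair_le_sum: "norm (a, b) \<le> norm a + norm b"
  unfolding norm_prod_def by (simp add: sqrt_sum_squares_le_sum)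

text \<open>In the Weyl calculus a kernel is read in the coordinates difference (here first) and
  midpoint (second). Difference and midpoint together have norm at most 3/2 times the sum of the
  norms of the two endpoints, hence the constant 3.\<close>

lemma bounded_cs_shear:
  fixes k :: "'a::euclidean_space \<times> 'a \<Rightarrow> complex"
  assumes "bounded_cs k"
  shows "bounded_cs (\<lambda>z. k (snd z + (1/2) *\<^sub>R fst z, snd z - (1/2) *\<^sub>R fst z))"
proof (rule bounded_cs_comp[OF assms, where C=3])
  fix z :: "'a \<times> 'a"
  obtain x s where z: "z = (x, s)" by (cases z)
  let ?u = "s + (1/2) *\<^sub>R x" and ?v = "s - (1/2) *\<^sub>R x"
  have "x = ?u - ?v" by (simp add: algebra_simps flip: scaleR_left.add)
  then have "norm x \<le> norm ?u + norm ?v" using norm_triangle_ineq4[of ?u ?v] by simp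
  moreover have "s = (1/2) *\<^sub>R (?u + ?v)" by (simp flip: scaleR_2)
  then have "norm s \<le> (1/2) * (norm ?u + norm ?v)"
    using norm_triangle_ineq[of ?u ?v] by (metis mult_left_mono norm_scaleR abs_of_nonneg zero_le_divide_1_iff zero_le_numeral)
  ultimately show "norm z \<le> 3 * norm (snd z + (1/2) *\<^sub>R fst z, snd z - (1/2) *\<^sub>R fst z)"
    using norm_fst_le[of ?u ?v] norm_snd_le[of ?v ?u] norm_Pair_le_sum[of x s] unfolding z by simp
qed (measurable, simp?)

lemma bounded_cs_translate_fst:
  fixes k :: "'a::euclidean_space \<times> 'a \<Rightarrow> complex"
  assumes "bounded_cs k"
  shows "bounded_cs (\<lambda>z. k (snd z + fst z, snd z))"
proof (rule bounded_cs_comp[OF assms, where C=3])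
  fix z :: "'a \<times> 'a"
  obtain x v where z: "z = (x, v)" by (cases z)
  have "norm x \<le> norm (v + x) + norm v" using norm_triangle_ineq4[of "v + x" v] by simp
  then show "norm z \<le> 3 * norm (snd z + fst z, snd z)"
    using norm_fst_le[of "v + x" v] norm_snd_le[of v "v + x"] norm_Pair_le_sum[of x v] unfolding z by simp
qed (intro borel_measurable_continuous_onI continuous_intros, simp)

text \<open>The shear is a composition of two translations, of the midpoint with the difference
  fixed and then of the difference with the second endpoint fixed; Fubini exchanges the order in
  between.\<close>

lemma integral_shear:
  fixes k :: "'a::euclidean_space \<times> 'a \<Rightarrow> complex"
  assumes k: "bounded_cs k"
  shows "(\<integral>z. k (snd z + (1/2) *\<^sub>R fst z, snd z - (1/2) *\<^sub>R fst z) \<partial>lborel) = (\<integral>z. k z \<partial>lborel)"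
proof -
  have "(\<integral>z. k (snd z + (1/2) *\<^sub>R fst z, snd z - (1/2) *\<^sub>R fst z) \<partial>lborel) =
     (\<integral>x. \<integral>s. k (s + (1/2) *\<^sub>R x, s - (1/2) *\<^sub>R x) \<partial>lborel \<partial>lborel)"
    using integral_lborel_prod(1)[OF bounded_cs_integrable[OF bounded_cs_shear[OF k]]] by simp
  also have "\<dots> = (\<integral>x. \<integral>v. k (v + x, v) \<partial>lborel \<partial>lborel)"
  proof (rule Bochner_Integration.integral_cong[OF refl])
    fix x
    show "(\<integral>s. k (s + (1/2) *\<^sub>R x, s - (1/2) *\<^sub>R x) \<partial>lborel) = (\<integral>v. k (v + x, v) \<partial>lborel)"
      using lborel_integral_translate[of "\<lambda>s. k (s + (1/2) *\<^sub>R x, s - (1/2) *\<^sub>R x)" "(1/2) *\<^sub>R x"]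
      by (simp add: add.assoc flip: scaleR_left.add)
  qed
  also have "\<dots> = (\<integral>v. \<integral>x. k (v + x, v) \<partial>lborel \<partial>lborel)"
    by (rule lborel_Fubini[OF bounded_cs_integrable[OF bounded_cs_translate_fst[OF k]]])
  also have "\<dots> = (\<integral>v. \<integral>u. k (u, v) \<partial>lborel \<partial>lborel)"
  proof (rule Bochner_Integration.integral_cong[OF refl])
    fix v
    show "(\<integral>x. k (v + x, v) \<partial>lborel) = (\<integral>u. k (u, v) \<partial>lborel)"
      using lborel_integral_translate[of "\<lambda>u. k (u, v)" v] by (simp add: add.commute)
  qed
  also have "\<dots> = (\<integral>z. k z \<partial>lborel)"
    using integral_lborel_prod(2)[OF bounded_cs_integrable[OF k]] by simp
  finally show ?thesis .
qed

lemma bounded_cs_norm_square: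
  "bounded_cs f \<Longrightarrow> bounded_cs (\<lambda>x. complex_of_real ((norm (f x))\<^sup>2))"
  using bounded_cs_mult[OF _ bounded_cs_cnj, of f f] by (simp add: complex_norm_square[symmetric] del: of_real_power)

lemma norm_L2_shear:
  fixes k :: "'a::euclidean_space \<times> 'a \<Rightarrow> complex"
  assumes k: "bounded_cs k"
  shows "norm_L2 (\<lambda>z. k (snd z + (1/2) *\<^sub>R fst z, snd z - (1/2) *\<^sub>R fst z)) = norm_L2 k"
  using integral_shear[OF bounded_cs_norm_square[OF k]]
  unfolding norm_L2_def by (simp only: integral_complex_of_real of_real_eq_iff)

lemma bounded_cs_integral:
  fixes K :: "'a::euclidean_space \<times> 'b::euclidean_space \<Rightarrow> complex"
  assumes "bounded_cs K"
  shows "bounded_cs (\<lambda>z. \<integral>u. K (u, z) \<partial>lborel)"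
proof -
  obtain M B where *: "K \<in> borel_measurable borel" "0 \<le> M" "0 \<le> B" "\<And>x. norm (K x) \<le> M" "\<And>x. B < norm x \<Longrightarrow> K x = 0"
    using assms by (rule bounded_csE) blast
  note [measurable] = *(1)
  show ?thesis
  proof (rule bounded_csI[where R=B])
    show "(\<lambda>z. \<integral>u. K (u, z) \<partial>lborel) \<in> borel_measurable borel" by measurable
    show "(\<integral>u. K (u, z) \<partial>lborel) = 0" if "B < norm z" for z
    proof -
      have "K (u, z) = 0" for u using *(5)[of "(u, z)"] norm_snd_le[of z u] that by simp
      then show ?thesis by simp
    qed
    show "norm (\<integral>u. K (u, z) \<partial>lborel) \<le> (\<integral>u. indicator (cball (0::'a) B) u *\<^sub>R M \<partial>lborel)" for z
    proof (rule Bochner_Integration.integral_norm_bound_integral)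
      show "integrable lborel (\<lambda>u. K (u, z))"
        by (rule bounded_cs_integrable[OF bounded_cs_section2[OF assms]])
      show "integrable lborel (\<lambda>u::'a. indicator (cball 0 B) u *\<^sub>R M)"
        by (rule borel_integrable_compact) auto
      show "norm (K (u, z)) \<le> indicator (cball 0 B) u *\<^sub>R M" for u
        using *(4)[of "(u, z)"] *(5)[of "(u, z)"] norm_fst_le[of u z] by (auto simp: indicator_def not_le[symmetric])
    qed
  qed
qed

text \<open>Here \<open>u\<close> labels a slice of \<open>k\<close>, \<open>w\<close> is a midpoint
  and \<open>x\<close> a difference. Transforming in \<open>x\<close> gives a Wigner function,
  transforming in \<open>w\<close> an ambiguity function, of the slice or of its conjugate according
  to the sign.\<close>

definition corr_kernel :: "('a::euclidean_space \<times> 'a \<Rightarrow> complex) \<Rightarrow> 'a \<times> 'a \<times> 'a \<Rightarrow> complex" where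
  "corr_kernel k t = (case t of (u, w, x) \<Rightarrow> k (u, w + (1/2) *\<^sub>R x) * cnj (k (u, w - (1/2) *\<^sub>R x)))"

lemma bounded_cs_corr_kernel:
  fixes k :: "'a::euclidean_space \<times> 'a \<Rightarrow> complex"
  assumes "bounded_cs k"
  shows "bounded_cs (corr_kernel k)"
proof -
  obtain M B where *: "k \<in> borel_measurable borel" "0 \<le> M" "\<And>x. norm (k x) \<le> M" "\<And>x. B < norm x \<Longrightarrow> k x = 0"
    using assms by (rule bounded_csE) blast
  note [measurable] = *(1)
  show ?thesis
  proof (rule bounded_csI[where M="M * M" and R="4 * B"])
    show "corr_kernel k \<in> borel_measurable borel"
      unfolding corr_kernel_def[abs_def] case_prod_beta by measurable
    show "norm (corr_kernel k t) \<le> M * M" for t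
      unfolding corr_kernel_def case_prod_beta norm_mult complex_mod_cnj using * by (intro mult_mono) auto
    fix t :: "'a \<times> 'a \<times> 'a" assume t: "4 * B < norm t"
    obtain u w x where tt: "t = (u, w, x)" by (cases t) auto
    let ?a = "w + (1/2) *\<^sub>R x" and ?b = "w - (1/2) *\<^sub>R x"
    show "corr_kernel k t = 0"
    proof (rule ccontr)
      assume "corr_kernel k t \<noteq> 0"
      then have "k (u, ?a) \<noteq> 0" "k (u, ?b) \<noteq> 0" by (auto simp: corr_kernel_def tt)
      then have n: "norm (u, ?a) \<le> B" "norm (u, ?b) \<le> B" using *(4) not_le by blast+
      then have u: "norm u \<le> B" and ab: "norm ?a \<le> B" "norm ?b \<le> B"
        using norm_fst_le[of u ?a] norm_snd_le[of ?a u] norm_snd_le[of ?b u] by auto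
      have "x = ?a - ?b" by (simp add: algebra_simps flip: scaleR_left.add)
      then have "norm x \<le> norm ?a + norm ?b" using norm_triangle_ineq4[of ?a ?b] by simp
      moreover have "w = (1/2) *\<^sub>R (?a + ?b)" by (simp flip: scaleR_2)
      then have "norm w \<le> (1/2) * (norm ?a + norm ?b)"
        using norm_triangle_ineq[of ?a ?b] by (metis mult_left_mono norm_scaleR abs_of_nonneg zero_le_divide_1_iff zero_le_numeral)
      ultimately show False
        using norm_Pair_le_sum[of u "(w, x)"] norm_Pair_le_sum[of w x] u ab t unfolding tt by simp
    qed
  qed
qed

text \<open>In midpoint and difference coordinates this is the complex conjugate of the kernel of
  K*K, where K is the integral operator with kernel \<open>k\<close>.\<close>

definition corr_fun :: "('a::euclidean_space \<times> 'a \<Rightarrow> complex) \<Rightarrow> 'a \<times> 'a \<Rightarrow> complex" where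
  "corr_fun k z = (\<integral>u. corr_kernel k (u, z) \<partial>lborel)"

lemma bounded_cs_corr_fun: "bounded_cs k \<Longrightarrow> bounded_cs (corr_fun k)"
  unfolding corr_fun_def[abs_def] by (intro bounded_cs_integral bounded_cs_corr_kernel)

text \<open>The twisted symbol \<open>c\<close> of the operator with kernel \<open>k\<close>: the partial Fourier inverse of
  \<open>k(x, y) = \<integral> c(x - y, p) exp (i p (x + y) / 2\<eta>) dp\<close>.\<close>

definition kernel_symbol :: "real \<Rightarrow> ('n::finite phase \<Rightarrow> complex) \<Rightarrow> 'n phase \<Rightarrow> complex" where
  "kernel_symbol \<eta> k z = complex_of_real (1 / (2 * pi * \<eta>) ^ CARD('n)) *
     pft (- 1 / \<eta>) (\<lambda>z. k (snd z + (1/2) *\<^sub>R fst z, snd z - (1/2) *\<^sub>R fst z)) z"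

lemma L2_kernel_symbol:
  assumes "\<eta> > 0" "bounded_cs k"
  shows "L2 (kernel_symbol \<eta> k)"
  unfolding kernel_symbol_def[abs_def]
  by (intro L2_cmult pft_Plancherel(1) bounded_cs_shear assms) (use assms in simp)

text \<open>The symbol map is a multiple of an isometry from kernels: the shear preserves the norm,
  and the partial transform contributes one power of \<open>(2 * pi * \<eta>) ^ CARD('n)\<close>
  against the two from the squared prefactor.\<close>

lemma norm_L2_kernel_symbol:
  fixes k :: "'n::finite phase \<Rightarrow> complex"
  assumes \<eta>: "\<eta> > 0" and k: "bounded_cs k"
  shows "(norm_L2 (kernel_symbol \<eta> k))\<^sup>2 = (norm_L2 k)\<^sup>2 / (2 * pi * \<eta>) ^ CARD('n)"
proof -
  have s: "- 1 / \<eta> \<noteq> 0" using \<eta> by simp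
  define N where "N = (2 * pi * \<eta>) ^ CARD('n)"
  have N: "N > 0" using \<eta> by (simp add: N_def)
  let ?p = "pft (- 1 / \<eta>) (\<lambda>z. k (snd z + (1/2) *\<^sub>R fst z, snd z - (1/2) *\<^sub>R fst z))"
  have "norm_L2 (kernel_symbol \<eta> k) = 1 / N * norm_L2 ?p"
    unfolding kernel_symbol_def[abs_def] norm_L2_cmult N_def[symmetric] using N by (simp add: norm_divide)
  then have "(norm_L2 (kernel_symbol \<eta> k))\<^sup>2 = (1 / N)\<^sup>2 * (norm_L2 ?p)\<^sup>2"
    by (simp only: power_mult_distrib)
  also have "(norm_L2 ?p)\<^sup>2 = N * (norm_L2 k)\<^sup>2"
    unfolding pft_Plancherel(2)[OF bounded_cs_shear[OF k] s] norm_L2_shear[OF k] N_def using \<eta> by simp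
  finally show ?thesis
    unfolding N_def[symmetric] using N by (simp add: power2_eq_square)
qed

text \<open>In the momentum variable p' the integrand is a product of transforms of sections of the
  sheared kernel, so Plancherel trades p' for a midpoint. Two translations then turn the common
  first argument of both kernels into the integration variable \<open>u\<close>. The remaining phase
  transforms \<open>corr_fun k\<close> in its midpoint, which is why the arguments appear swapped:
  the result is a superposition of ambiguity functions.\<close>

lemma twisted_corr_kernel_symbol:
  fixes k :: "'n::finite phase \<Rightarrow> complex"
  assumes \<eta>: "\<eta> > 0" and k: "bounded_cs k"
  shows "twisted_corr \<eta> (kernel_symbol \<eta> k) z =
    complex_of_real (1 / (2 * pi * \<eta>) ^ CARD('n)) * pft (1 / \<eta>) (\<lambda>z. corr_fun k (snd z, fst z)) z"
proof -
  let ?N = "(2 * pi * \<eta>) ^ CARD('n)"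
  let ?n = "complex_of_real (1 / ?N)"
  let ?c = "kernel_symbol \<eta> k"
  obtain x p where z: "z = (x, p)" by (cases z)
  define \<kappa> where "\<kappa> z = k (snd z + (1/2) *\<^sub>R fst z, snd z - (1/2) *\<^sub>R fst z)" for z
  have km [measurable]: "k \<in> borel_measurable borel" using k by auto
  have \<kappa>: "bounded_cs \<kappa>" unfolding \<kappa>_def[abs_def] by (rule bounded_cs_shear[OF k])
  have \<kappa>m [measurable]: "\<kappa> \<in> borel_measurable borel" using \<kappa> by auto
  have c_eq: "?c (x, p) = ?n * ft (- 1 / \<eta>) (\<lambda>s. \<kappa> (x, s)) p" for x p
    unfolding kernel_symbol_def pft_def \<kappa>_def by simp
  have c: "L2 ?c" by (rule L2_kernel_symbol[OF \<eta> k])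
  have cm [measurable]: "?c \<in> borel_measurable borel" using c by auto
  let ?F = "\<lambda>z'. cis (- (sympl z z' / (2 * \<eta>))) * ?c (z' - z) * cnj (?c z')"
  have Fint: "integrable lborel ?F"
  proof -
    have "integrable lborel (\<lambda>z'. ?c (z' + (- z)) * cnj (?c z'))"
      by (intro L2_mult_integrable L2_translate L2_cnj c)
    from integrable_cis_mult[OF this, of "\<lambda>z'. - (sympl z z' / (2 * \<eta>))"]
    show ?thesis unfolding sympl_def by (simp add: mult.assoc)
  qed
  \<comment> \<open>What the integrand becomes after Plancherel in p', apart from a constant;
    \<open>v + x'\<close> is the later variable \<open>u\<close>.\<close>
  define H where "H x' v = cis (p \<bullet> (v + (1/2) *\<^sub>R x) / \<eta>) * k (v + x', v + x) * cnj (k (v + x', v))" for x' v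
  have inner: "(\<integral>p'. ?F (x', p') \<partial>lborel) = ?n * (\<integral>v. H x' v \<partial>lborel)" for x'
  proof -
    define g1 where "g1 \<sigma> = cis (p \<bullet> (\<sigma> + (1/2) *\<^sub>R x) / \<eta>) * \<kappa> (x' - x, \<sigma> + (1/2) *\<^sub>R x)" for \<sigma>
    define g2 where "g2 \<sigma> = \<kappa> (x', \<sigma>)" for \<sigma>
    have g2: "bounded_cs g2" unfolding g2_def[abs_def] by (rule bounded_cs_section1[OF \<kappa>])
    have g1: "integrable lborel g1" "L2 g1"
    proof -
      have b: "bounded_cs (\<lambda>\<sigma>. cis (p \<bullet> \<sigma> / \<eta>) * \<kappa> (x' - x, \<sigma>))"
        by (rule bounded_cs_mult_bounded[OF bounded_cs_section1[OF \<kappa>], where C=1]) (measurable, simp?)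
      show "integrable lborel g1" "L2 g1" unfolding g1_def[abs_def]
        using lborel_integrable_translate[OF bounded_cs_integrable[OF b]] L2_translate[OF bounded_cs_L2[OF b]] by auto
    qed
    \<comment> \<open>Shifting the integration variable by \<open>(1/2) *\<^sub>R x\<close> cancels
      the twisting phase in p', and the shift of the momentum by \<open>p\<close> becomes a
      modulation inside \<open>g1\<close>.\<close>
    have f1: "cis ((p' \<bullet> x) / (2 * \<eta>)) * ?c (x' - x, p' - p) = ?n * ft (- 1 / \<eta>) g1 p'" for p'
    proof -
      have "ft (- 1 / \<eta>) (\<lambda>s. \<kappa> (x' - x, s)) (p' - p) =
         (\<integral>\<sigma>. cis (- 1 / \<eta> * ((p' - p) \<bullet> (\<sigma> + (1/2) *\<^sub>R x))) * \<kappa> (x' - x, \<sigma> + (1/2) *\<^sub>R x) \<partial>lborel)"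
        unfolding ft_def by (rule lborel_integral_translate[symmetric])
      then have "cis ((p' \<bullet> x) / (2 * \<eta>)) * ft (- 1 / \<eta>) (\<lambda>s. \<kappa> (x' - x, s)) (p' - p) =
         (\<integral>\<sigma>. cis ((p' \<bullet> x) / (2 * \<eta>)) * (cis (- 1 / \<eta> * ((p' - p) \<bullet> (\<sigma> + (1/2) *\<^sub>R x))) * \<kappa> (x' - x, \<sigma> + (1/2) *\<^sub>R x)) \<partial>lborel)"
        by simp
      also have "\<dots> = ft (- 1 / \<eta>) g1 p'"
        unfolding ft_def g1_def mult.assoc[symmetric] cis_mult
        by (intro Bochner_Integration.integral_cong refl arg_cong2[where f="(*)"] arg_cong[where f=cis])
           (use \<eta> in \<open>simp add: field_simps inner_diff_left inner_add_right\<close>)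
      finally show ?thesis unfolding c_eq by (simp add: mult_ac)
    qed
    have f2: "?c (x', p') = ?n * ft (- 1 / \<eta>) g2 p'" for p'
      unfolding c_eq g2_def ..
    have "(\<integral>p'. ?F (x', p') \<partial>lborel) =
       (\<integral>p'. (cis (- (p \<bullet> x') / (2 * \<eta>)) * ?n * ?n) * (ft (- 1 / \<eta>) g1 p' * cnj (ft (- 1 / \<eta>) g2 p')) \<partial>lborel)"
    proof (rule Bochner_Integration.integral_cong[OF refl])
      fix p'
      have "?F (x', p') = cis (- (p \<bullet> x') / (2 * \<eta>)) * (cis ((p' \<bullet> x) / (2 * \<eta>)) * ?c (x' - x, p' - p)) * cnj (?c (x', p'))"
        unfolding mult.assoc[symmetric] cis_mult z sympl_def
        by (simp add: diff_divide_distrib)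
      also have "\<dots> = (cis (- (p \<bullet> x') / (2 * \<eta>)) * ?n * ?n) * (ft (- 1 / \<eta>) g1 p' * cnj (ft (- 1 / \<eta>) g2 p'))"
        unfolding f1 f2 complex_cnj_mult complex_cnj_complex_of_real by (simp only: mult_ac)
      finally show "?F (x', p') = (cis (- (p \<bullet> x') / (2 * \<eta>)) * ?n * ?n) * (ft (- 1 / \<eta>) g1 p' * cnj (ft (- 1 / \<eta>) g2 p'))" .
    qed
    also have "\<dots> = (cis (- (p \<bullet> x') / (2 * \<eta>)) * ?n * ?n) * (\<integral>p'. ft (- 1 / \<eta>) g1 p' * cnj (ft (- 1 / \<eta>) g2 p') \<partial>lborel)"
      by (rule Bochner_Integration.integral_mult_right_zero)
    also have "(\<integral>p'. ft (- 1 / \<eta>) g1 p' * cnj (ft (- 1 / \<eta>) g2 p') \<partial>lborel) = complex_of_real ?N * (\<integral>\<sigma>. g1 \<sigma> * cnj (g2 \<sigma>) \<partial>lborel)"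
      using Plancherel[OF g1 bounded_cs_integrable[OF g2] bounded_cs_L2[OF g2], of "- 1 / \<eta>"] \<eta> by simp
    also have "(cis (- (p \<bullet> x') / (2 * \<eta>)) * ?n * ?n) * (complex_of_real ?N * (\<integral>\<sigma>. g1 \<sigma> * cnj (g2 \<sigma>) \<partial>lborel)) =
       ?n * (cis (- (p \<bullet> x') / (2 * \<eta>)) * (\<integral>\<sigma>. g1 \<sigma> * cnj (g2 \<sigma>) \<partial>lborel))"
      using \<eta> by simp
    also have "cis (- (p \<bullet> x') / (2 * \<eta>)) * (\<integral>\<sigma>. g1 \<sigma> * cnj (g2 \<sigma>) \<partial>lborel) =
       (\<integral>\<sigma>. cis (- (p \<bullet> x') / (2 * \<eta>)) * (g1 \<sigma> * cnj (g2 \<sigma>)) \<partial>lborel)"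
      by (rule Bochner_Integration.integral_mult_right_zero[symmetric])
    \<comment> \<open>With the midpoint written as \<open>v + (1/2) *\<^sub>R x'\<close> both
      sheared kernels have unsheared arguments again, and the phase depending on x' cancels.\<close>
    also have "\<dots> = (\<integral>v. cis (- (p \<bullet> x') / (2 * \<eta>)) * (g1 (v + (1/2) *\<^sub>R x') * cnj (g2 (v + (1/2) *\<^sub>R x'))) \<partial>lborel)"
      by (rule lborel_integral_translate[symmetric])
    also have "\<dots> = (\<integral>v. H x' v \<partial>lborel)"
    proof (rule Bochner_Integration.integral_cong[OF refl])
      fix v
      have k1: "\<kappa> (x' - x, v + (1/2) *\<^sub>R x' + (1/2) *\<^sub>R x) = k (v + x', v + x)"
      proof -
        have "v + (1/2) *\<^sub>R x' + (1/2) *\<^sub>R x + (1/2) *\<^sub>R (x' - x) = v + ((1/2) *\<^sub>R x' + (1/2) *\<^sub>R x')"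
          by (simp add: scaleR_diff_right)
        moreover have "v + (1/2) *\<^sub>R x' + (1/2) *\<^sub>R x - (1/2) *\<^sub>R (x' - x) = v + ((1/2) *\<^sub>R x + (1/2) *\<^sub>R x)"
          by (simp add: scaleR_diff_right)
        ultimately show ?thesis unfolding \<kappa>_def by (simp only: fst_conv snd_conv scaleR_half_add_half)
      qed
      have k2: "\<kappa> (x', v + (1/2) *\<^sub>R x') = k (v + x', v)"
        unfolding \<kappa>_def by (simp only: fst_conv snd_conv add.assoc scaleR_half_add_half add_diff_cancel)
      have ph: "cis (- (p \<bullet> x') / (2 * \<eta>)) * cis (p \<bullet> (v + (1/2) *\<^sub>R x' + (1/2) *\<^sub>R x) / \<eta>) = cis (p \<bullet> (v + (1/2) *\<^sub>R x) / \<eta>)"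
        unfolding cis_mult using \<eta> by (intro arg_cong[where f=cis]) (simp add: field_simps inner_add_right)
      show "cis (- (p \<bullet> x') / (2 * \<eta>)) * (g1 (v + (1/2) *\<^sub>R x') * cnj (g2 (v + (1/2) *\<^sub>R x'))) = H x' v"
        unfolding g1_def g2_def H_def k1 k2 ph[symmetric] by (simp only: mult.assoc)
    qed
    finally show ?thesis .
  qed
  have Hn: "bounded_cs (\<lambda>z. H (fst z) (snd z))"
  proof -
    obtain M where M: "\<And>z. norm (k z) \<le> M" using k by (rule bounded_csE) blast
    show ?thesis unfolding H_def
      by (rule bounded_cs_mult_bounded[OF bounded_cs_cnj[OF bounded_cs_translate_fst[OF k]], where C=M])
         (measurable, use M in \<open>simp add: norm_mult\<close>)
  qed
  have "twisted_corr \<eta> ?c z = (\<integral>z'. ?F z' \<partial>lborel)"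
    unfolding twisted_corr_def exp_minus_i ..
  also have "\<dots> = (\<integral>x'. \<integral>p'. ?F (x', p') \<partial>lborel \<partial>lborel)"
    by (rule integral_lborel_prod(1)[OF Fint])
  also have "\<dots> = ?n * (\<integral>x'. \<integral>v. H x' v \<partial>lborel \<partial>lborel)"
    unfolding inner by (rule Bochner_Integration.integral_mult_right_zero)
  also have "(\<integral>x'. \<integral>v. H x' v \<partial>lborel \<partial>lborel) = (\<integral>v. \<integral>x'. H x' v \<partial>lborel \<partial>lborel)"
    by (rule lborel_Fubini[OF bounded_cs_integrable[OF Hn]])
  also have "\<dots> = (\<integral>v. cis (p \<bullet> (v + (1/2) *\<^sub>R x) / \<eta>) * corr_fun k (v + (1/2) *\<^sub>R x, x) \<partial>lborel)"
  proof (rule Bochner_Integration.integral_cong[OF refl])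
    fix v
    \<comment> \<open>Shifting x' by \<open>- v\<close> makes the first argument of both kernels the
      free variable.\<close>
    have "(\<integral>x'. H x' v \<partial>lborel) = (\<integral>x'. H (x' + (- v)) v \<partial>lborel)"
      by (rule lborel_integral_translate[symmetric])
    also have "\<dots> = (\<integral>u. cis (p \<bullet> (v + (1/2) *\<^sub>R x) / \<eta>) * corr_kernel k (u, v + (1/2) *\<^sub>R x, x) \<partial>lborel)"
      by (simp add: H_def corr_kernel_def mult.assoc add.assoc scaleR_half_add_half)
    finally show "(\<integral>x'. H x' v \<partial>lborel) = cis (p \<bullet> (v + (1/2) *\<^sub>R x) / \<eta>) * corr_fun k (v + (1/2) *\<^sub>R x, x)"
      by (simp add: corr_fun_def)
  qed
  also have "\<dots> = (\<integral>w. cis (p \<bullet> w / \<eta>) * corr_fun k (w, x) \<partial>lborel)"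
    using lborel_integral_translate[of "\<lambda>w. cis (p \<bullet> w / \<eta>) * corr_fun k (w, x)" "(1/2) *\<^sub>R x"] by simp
  finally show ?thesis
    by (simp add: z pft_def ft_def)
qed

section \<open>The pairing identity\<close>

text \<open>Bounded support survives in the variable that is not transformed, so Plancherel can
  still be applied in that variable.\<close>

lemma bounded_cs_pft_section:
  fixes a :: "'a::euclidean_space \<times> 'b::euclidean_space \<Rightarrow> complex"
  assumes a: "bounded_cs a"
  shows "bounded_cs (\<lambda>w. pft s a (w, x))"
proof -
  have "bounded_cs (\<lambda>z. cis (s * (x \<bullet> fst z)) * a (snd z, fst z))"
    by (rule bounded_cs_mult_bounded[OF bounded_cs_swap[OF a], where C=1]) (measurable, simp?)
  from bounded_cs_integral[OF this] show ?thesis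
    unfolding pft_def ft_def by simp
qed

lemma pft_bounded:
  fixes a :: "'a::euclidean_space \<times> 'b::euclidean_space \<Rightarrow> complex"
  assumes a: "bounded_cs a"
  obtains C where "\<And>z. norm (pft s a z) \<le> C"
proof -
  have m [measurable]: "a \<in> borel_measurable borel" using a by auto
  obtain M B where MB: "\<And>x. norm (a x) \<le> M" "\<And>x. B < norm x \<Longrightarrow> a x = 0"
    using a by (rule bounded_csE) blast
  have "bounded_cs (\<lambda>z. complex_of_real (norm (a z)))"
    by (rule bounded_csI[where M=M and R=B]) (measurable, use MB in auto)
  from bounded_cs_integral[OF bounded_cs_swap[OF this]]
  obtain C where C: "\<And>w. norm (\<integral>x. complex_of_real (norm (a (w, x))) \<partial>lborel) \<le> C"
    by (rule bounded_csE) auto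
  have "norm (pft s a z) \<le> C" for z
    using ft_bounded[of s "\<lambda>x. a (fst z, x)" "snd z"] C[of "fst z"]
    unfolding pft_def integral_complex_of_real by simp
  then show ?thesis using that by blast
qed

lemma ft_uminus: "ft (- s) f \<xi> = cnj (ft s (\<lambda>x. cnj (f x)) \<xi>)"
proof -
  have "cnj (ft s (\<lambda>x. cnj (f x)) \<xi>) = (\<integral>x. cnj (cis (s * (\<xi> \<bullet> x)) * cnj (f x)) \<partial>lborel)"
    unfolding ft_def by (rule Bochner_Integration.integral_cnj[symmetric])
  then show ?thesis by (simp add: ft_def cis_cnj)
qed

text \<open>The symplectic phase is a sum in which momentum is dual to \<open>x\<close> and position
  to \<open>p\<close>, with opposite signs; the transform is therefore two successive partial
  ones.\<close>

lemma sympl_FT_conv_pft: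
  fixes a :: "'n::finite phase \<Rightarrow> complex"
  assumes \<eta>: "\<eta> > 0" and a: "integrable lborel a"
  shows "sympl_FT \<eta> a (x, p) = complex_of_real (1 / (2 * pi * \<eta>) ^ CARD('n)) *
     ft (- 1 / \<eta>) (\<lambda>w. pft (1 / \<eta>) a (w, x)) p"
proof -
  have int: "integrable lborel (\<lambda>z'. cis (- (sympl (x, p) z' / \<eta>)) * a z')"
    by (rule integrable_cis_mult[OF a]) (unfold sympl_def, measurable)
  have "(\<integral>z'. cis (- (sympl (x, p) z' / \<eta>)) * a z' \<partial>lborel) =
     (\<integral>w. \<integral>q. cis (- (sympl (x, p) (w, q) / \<eta>)) * a (w, q) \<partial>lborel \<partial>lborel)"
    by (rule integral_lborel_prod(1)[OF int])
  also have "\<dots> = ft (- 1 / \<eta>) (\<lambda>w. pft (1 / \<eta>) a (w, x)) p"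
    unfolding ft_def pft_def
  proof (rule Bochner_Integration.integral_cong[OF refl])
    fix w
    have "(\<integral>q. cis (- (sympl (x, p) (w, q) / \<eta>)) * a (w, q) \<partial>lborel) =
       (\<integral>q. cis (- 1 / \<eta> * (p \<bullet> w)) * (cis (1 / \<eta> * (x \<bullet> q)) * a (w, q)) \<partial>lborel)"
      unfolding mult.assoc[symmetric] cis_mult
      by (simp add: sympl_def diff_divide_distrib inner_commute)
    then show "(\<integral>q. cis (- (sympl (x, p) (w, q) / \<eta>)) * a (w, q) \<partial>lborel) =
       cis (- 1 / \<eta> * (p \<bullet> w)) * (\<integral>xa. cis (1 / \<eta> * (snd (w, x) \<bullet> xa)) * a (fst (w, x), xa) \<partial>lborel)"
      by simp
  qed
  finally show ?thesis
    unfolding sympl_FT_def powr_minus_CARD[OF \<eta>] exp_minus_i by simp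
qed

text \<open>Plancherel in the position variable undoes one of the two partial transforms of
  \<open>a\<close>; the multiplication formula moves the other one onto \<open>T\<close>. A
  transform of \<open>T\<close> in its first variable is thereby exchanged for one in its second,
  that is, ambiguity functions for Wigner functions.\<close>

lemma sympl_FT_pairing:
  fixes a :: "'n::finite phase \<Rightarrow> complex"
  assumes \<eta>: "\<eta> > 0" and a: "bounded_cs a" and T: "bounded_cs T"
  shows "(\<integral>z. sympl_FT \<eta> a z * pft (1 / \<eta>) (\<lambda>z. T (snd z, fst z)) z \<partial>lborel) =
    (\<integral>z. a z * pft (1 / \<eta>) T z \<partial>lborel)"
proof -
  let ?N = "(2 * pi * \<eta>) ^ CARD('n)"
  let ?s = "1 / \<eta>"
  have s: "?s \<noteq> 0" using \<eta> by simp
  have [measurable]: "a \<in> borel_measurable borel" "T \<in> borel_measurable borel" using a T by auto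
  note aL = bounded_cs_integrable[OF a] bounded_cs_L2[OF a]
  have int: "integrable lborel (\<lambda>z. sympl_FT \<eta> a z * pft ?s (\<lambda>z. T (snd z, fst z)) z)"
    by (intro L2_mult_integrable sympl_FT_isometry(1)[OF \<eta>] aL pft_Plancherel(1) bounded_cs_swap T s)
  have inner: "(\<integral>p. sympl_FT \<eta> a (x, p) * pft ?s (\<lambda>z. T (snd z, fst z)) (x, p) \<partial>lborel) =
     (\<integral>w. T (w, x) * pft ?s a (w, x) \<partial>lborel)" for x
  proof -
    \<comment> \<open>The outer transform in \<open>sympl_FT\<close> has scale
      \<open>- 1 / \<eta>\<close>; by \<open>ft_uminus\<close> it is the conjugate of a transform
      with \<open>?s\<close> of the conjugated function, as Plancherel's formula requires.\<close>
    let ?\<alpha> = "\<lambda>w. cnj (pft ?s a (w, x))"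
    let ?\<tau> = "\<lambda>w. T (w, x)"
    have \<alpha>: "bounded_cs ?\<alpha>" by (rule bounded_cs_cnj[OF bounded_cs_pft_section[OF a]])
    have \<tau>: "bounded_cs ?\<tau>" by (rule bounded_cs_section2[OF T])
    have "(\<integral>p. sympl_FT \<eta> a (x, p) * pft ?s (\<lambda>z. T (snd z, fst z)) (x, p) \<partial>lborel) =
       (\<integral>p. complex_of_real (1 / ?N) * (ft ?s ?\<tau> p * cnj (ft ?s ?\<alpha> p)) \<partial>lborel)"
      unfolding sympl_FT_conv_pft[OF \<eta> aL(1)]
      using ft_uminus[of ?s "\<lambda>w. pft ?s a (w, x)"] by (simp add: pft_def mult_ac)
    also have "\<dots> = complex_of_real (1 / ?N) * (\<integral>p. ft ?s ?\<tau> p * cnj (ft ?s ?\<alpha> p) \<partial>lborel)"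
      by (rule Bochner_Integration.integral_mult_right_zero)
    also have "(\<integral>p. ft ?s ?\<tau> p * cnj (ft ?s ?\<alpha> p) \<partial>lborel) = complex_of_real ?N * (\<integral>w. ?\<tau> w * cnj (?\<alpha> w) \<partial>lborel)"
      using Plancherel[OF bounded_cs_integrable[OF \<tau>] bounded_cs_L2[OF \<tau>] bounded_cs_integrable[OF \<alpha>] bounded_cs_L2[OF \<alpha>] s] \<eta>
      by simp
    finally show ?thesis using \<eta> by simp
  qed
  have n2: "bounded_cs (\<lambda>z. T (snd z, fst z) * pft ?s a (snd z, fst z))"
  proof -
    obtain C where C: "\<And>z. norm (pft ?s a z) \<le> C" using pft_bounded[OF a] by blast
    have "bounded_cs (\<lambda>z. pft ?s a z * T z)"
      by (rule bounded_cs_mult_bounded[OF T _ C]) measurable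
    from bounded_cs_swap[OF this] show ?thesis by (simp add: mult.commute)
  qed
  have "(\<integral>z. sympl_FT \<eta> a z * pft ?s (\<lambda>z. T (snd z, fst z)) z \<partial>lborel) = (\<integral>x. \<integral>w. T (w, x) * pft ?s a (w, x) \<partial>lborel \<partial>lborel)"
    unfolding integral_lborel_prod(1)[OF int] inner ..
  also have "\<dots> = (\<integral>w. \<integral>x. T (w, x) * pft ?s a (w, x) \<partial>lborel \<partial>lborel)"
    by (rule lborel_Fubini[OF bounded_cs_integrable[OF n2]])
  also have "\<dots> = (\<integral>w. \<integral>q. a (w, q) * pft ?s T (w, q) \<partial>lborel \<partial>lborel)"
  proof (rule Bochner_Integration.integral_cong[OF refl])
    fix w
    show "(\<integral>x. T (w, x) * pft ?s a (w, x) \<partial>lborel) = (\<integral>q. a (w, q) * pft ?s T (w, q) \<partial>lborel)"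
      using ft_mult_formula[OF bounded_cs_integrable[OF bounded_cs_section1[OF a]] bounded_cs_integrable[OF bounded_cs_section1[OF T]], of ?s w w]
      by (simp add: pft_def mult.commute)
  qed
  also have "\<dots> = (\<integral>z. a z * pft ?s T z \<partial>lborel)"
    by (rule integral_lborel_prod(1)[symmetric], rule L2_mult_integrable[OF aL(2) pft_Plancherel(1)[OF T s]])
  finally show ?thesis .
qed

text \<open>Replacing \<open>y\<close> by \<open>- y\<close> flips the sign of the phase and
  exchanges the two factors; for the conjugated slice this produces precisely
  \<open>corr_kernel\<close>.\<close>

lemma wigner_conv_pft:
  fixes k :: "'n::finite phase \<Rightarrow> complex"
  assumes \<eta>: "\<eta> > 0"
  shows "wigner \<eta> (\<lambda>y. cnj (k (u, y))) (\<lambda>y. cnj (k (u, y))) z =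
    complex_of_real (1 / (2 * pi * \<eta>) ^ CARD('n)) * pft (1 / \<eta>) (\<lambda>v. corr_kernel k (u, v)) z"
proof -
  let ?g = "\<lambda>y. cis (- ((snd z \<bullet> y) / \<eta>)) * cnj (k (u, fst z + (1/2) *\<^sub>R y)) * cnj (cnj (k (u, fst z - (1/2) *\<^sub>R y)))"
  have "(\<integral>y. ?g y \<partial>lborel) = (\<integral>y. ?g (- y) \<partial>lborel)"
    by (rule lborel_integral_reflect[symmetric])
  also have "\<dots> = pft (1 / \<eta>) (\<lambda>v. corr_kernel k (u, v)) z"
    unfolding pft_def ft_def corr_kernel_def by (simp add: mult_ac)
  finally show ?thesis
    unfolding wigner_def powr_minus_CARD[OF \<eta>] exp_minus_i by simp
qed

lemma pft_corr_fun:
  fixes k :: "'a::euclidean_space \<times> 'a \<Rightarrow> complex"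
  assumes k: "bounded_cs k"
  shows "pft s (corr_fun k) z = (\<integral>u. pft s (\<lambda>v. corr_kernel k (u, v)) z \<partial>lborel)"
proof -
  obtain w p where z: "z = (w, p)" by (cases z)
  note K = bounded_cs_corr_kernel[OF k]
  have Km [measurable]: "corr_kernel k \<in> borel_measurable borel" using K by auto
  have "bounded_cs (\<lambda>t. corr_kernel k (snd t, w, fst t))"
  proof (rule bounded_cs_comp[OF K, where C=1])
    fix t :: "'a \<times> 'a"
    have "norm (snd t, fst t) \<le> norm (snd t, w, fst t)"
      using norm_snd_le[of "fst t" w] by (auto simp: norm_prod_def)
    then show "norm t \<le> 1 * norm (snd t, w, fst t)" by (auto simp: norm_prod_def add.commute)
  qed (measurable, simp?)
  then have b: "bounded_cs (\<lambda>t. cis (s * (p \<bullet> fst t)) * corr_kernel k (snd t, w, fst t))"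
    by (rule bounded_cs_mult_bounded[where C=1]) (measurable, simp?)
  have "pft s (corr_fun k) z = (\<integral>x. \<integral>u. cis (s * (p \<bullet> x)) * corr_kernel k (u, w, x) \<partial>lborel \<partial>lborel)"
    unfolding pft_def ft_def corr_fun_def z by simp
  also have "\<dots> = (\<integral>u. \<integral>x. cis (s * (p \<bullet> x)) * corr_kernel k (u, w, x) \<partial>lborel \<partial>lborel)"
    by (rule lborel_Fubini[OF bounded_cs_integrable[OF b]])
  finally show ?thesis unfolding pft_def ft_def z by simp
qed

text \<open>An exchange of the integrals over \<open>u\<close> and \<open>z\<close>. As
  \<open>a\<close> is merely in L2, absolute integrability in \<open>z\<close> comes from
  Cauchy-Schwarz with a bound uniform in \<open>u\<close>, and integrability in \<open>u\<close>
  from the bounded support of \<open>k\<close>.\<close>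

lemma integral_mult_pft_corr_fun:
  fixes a :: "'n::finite phase \<Rightarrow> complex" and k :: "'n phase \<Rightarrow> complex"
  assumes \<eta>: "\<eta> > 0" and a: "L2 a" and k: "bounded_cs k"
  shows "(\<integral>z. a z * (complex_of_real (1 / (2 * pi * \<eta>) ^ CARD('n)) * pft (1 / \<eta>) (corr_fun k) z) \<partial>lborel) =
    (\<integral>u. \<integral>z. a z * wigner \<eta> (\<lambda>y. cnj (k (u, y))) (\<lambda>y. cnj (k (u, y))) z \<partial>lborel \<partial>lborel)"
proof -
  define N where "N = (2 * pi * \<eta>) ^ CARD('n)"
  let ?s = "1 / \<eta>"
  let ?V = "\<lambda>u z. complex_of_real (1 / N) * pft ?s (\<lambda>v. corr_kernel k (u, v)) z"
  have s: "?s \<noteq> 0" using \<eta> by simp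
  have N: "N > 0" using \<eta> by (simp add: N_def)
  note K = bounded_cs_corr_kernel[OF k]
  obtain M B where *: "corr_kernel k \<in> borel_measurable borel" "0 \<le> M" "\<And>x. norm (corr_kernel k x) \<le> M"
      "\<And>x. B < norm x \<Longrightarrow> corr_kernel k x = 0"
    using K by (rule bounded_csE) blast
  note [measurable] = *(1)
  have am [measurable]: "a \<in> borel_measurable borel" using a by auto
  have Ku: "bounded_cs (\<lambda>v. corr_kernel k (u, v))" for u by (rule bounded_cs_section1[OF K])
  have V: "L2 (?V u)" for u by (intro L2_cmult pft_Plancherel(1) Ku s)
  \<comment> \<open>One profile dominating every slice of \<open>corr_kernel k\<close>, so that the
    bound on \<open>?V u\<close> is independent of \<open>u\<close>.\<close>
  define D where "D v = complex_of_real (if norm v \<le> B then M else 0)" for v :: "'n phase"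
  have D: "bounded_cs D" unfolding D_def[abs_def]
    by (rule bounded_csI[where M=M and R=B]) (measurable, use \<open>0 \<le> M\<close> in auto)
  have nD: "norm_L2 (\<lambda>v. corr_kernel k (u, v)) \<le> norm_L2 D" for u
  proof (rule norm_L2_mono[OF bounded_cs_L2[OF D]])
    show "norm (corr_kernel k (u, v)) \<le> norm (D v)" for v
      using *(2) *(3)[of "(u, v)"] *(4)[of "(u, v)"] norm_snd_le[of v u] by (auto simp: D_def not_le[symmetric])
  qed measurable
  define C where "C = norm_L2 a * (1 / N * sqrt (N * (norm_L2 D)\<^sup>2))"
  have nV: "norm_L2 (?V u) \<le> 1 / N * sqrt (N * (norm_L2 D)\<^sup>2)" for u
  proof -
    have "(norm_L2 (pft ?s (\<lambda>v. corr_kernel k (u, v))))\<^sup>2 = N * (norm_L2 (\<lambda>v. corr_kernel k (u, v)))\<^sup>2"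
      using pft_Plancherel(2)[OF Ku s, of u] \<eta> by (simp add: N_def)
    also have "\<dots> \<le> N * (norm_L2 D)\<^sup>2"
      using N nD[of u] by (intro mult_left_mono power_mono) auto
    finally have "norm_L2 (pft ?s (\<lambda>v. corr_kernel k (u, v))) \<le> sqrt (N * (norm_L2 D)\<^sup>2)"
      by (rule real_le_rsqrt)
    then have "1 / N * norm_L2 (pft ?s (\<lambda>v. corr_kernel k (u, v))) \<le> 1 / N * sqrt (N * (norm_L2 D)\<^sup>2)"
      using N by (intro mult_left_mono) auto
    then show ?thesis unfolding norm_L2_cmult using N by (simp add: norm_divide)
  qed
  have int: "integrable lborel (\<lambda>t. a (snd t) * ?V (fst t) (snd t))"
  proof (rule integrable_lborel_prodI)
    show "(\<lambda>t. a (snd t) * ?V (fst t) (snd t)) \<in> borel_measurable borel"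
      unfolding pft_def ft_def by measurable
    show "integrable lborel (\<lambda>z. a (snd (u, z)) * ?V (fst (u, z)) (snd (u, z)))" for u
      using L2_mult_integrable[OF a V] by simp
    show "integrable lborel (\<lambda>u. \<integral>z. norm (a (snd (u, z)) * ?V (fst (u, z)) (snd (u, z))) \<partial>lborel)"
    proof (rule Bochner_Integration.integrable_bound)
      show "integrable lborel (\<lambda>u::real^'n. indicator (cball 0 B) u *\<^sub>R C)"
        by (rule borel_integrable_compact) auto
      show "(\<lambda>u. \<integral>z. norm (a (snd (u, z)) * ?V (fst (u, z)) (snd (u, z))) \<partial>lborel) \<in> borel_measurable lborel"
        unfolding pft_def ft_def by measurable
      show "AE u in lborel. norm (\<integral>z. norm (a (snd (u, z)) * ?V (fst (u, z)) (snd (u, z))) \<partial>lborel)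
          \<le> norm (indicator (cball 0 B) u *\<^sub>R C)"
      proof (rule AE_I2)
        fix u :: "real^'n"
        show "norm (\<integral>z. norm (a (snd (u, z)) * ?V (fst (u, z)) (snd (u, z))) \<partial>lborel) \<le> norm (indicator (cball 0 B) u *\<^sub>R C)"
        proof (cases "norm u \<le> B")
          case True
          have "norm (\<integral>z. norm (a z * ?V u z) \<partial>lborel) = (\<integral>z. norm (a z * ?V u z) \<partial>lborel)"
            by simp
          also have "\<dots> = (\<integral>z. norm (a z) * norm (?V u z) \<partial>lborel)"
            by (simp only: norm_mult)
          also have "\<dots> \<le> norm_L2 a * norm_L2 (?V u)"
            by (rule norm_L2_Cauchy_Schwarz[OF a V])
          also have "\<dots> \<le> C" unfolding C_def by (intro mult_left_mono nV) auto
          finally show ?thesis using True by simp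
        next
          case False
          then have "corr_kernel k (u, v) = 0" for v
            using *(4)[of "(u, v)"] norm_fst_le[of u v] by simp
          then show ?thesis using False by (simp add: pft_def ft_def)
        qed
      qed
    qed
  qed
  have "(\<integral>z. a z * (complex_of_real (1 / N) * pft ?s (corr_fun k) z) \<partial>lborel) = (\<integral>z. \<integral>u. a z * ?V u z \<partial>lborel \<partial>lborel)"
    unfolding pft_corr_fun[OF k] by simp
  also have "\<dots> = (\<integral>u. \<integral>z. a z * ?V u z \<partial>lborel \<partial>lborel)"
    by (rule lborel_Fubini[OF int, symmetric])
  finally show ?thesis
    unfolding wigner_conv_pft[OF \<eta>] N_def .
qed

text \<open>For truncations of \<open>a\<close> this is \<open>sympl_FT_pairing\<close>. Both sides
  are continuous in \<open>a\<close> for the L2 norm because \<open>?tw\<close> and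
  \<open>?W\<close> are in L2, and the L2 transform is the limit of the transforms of the
  truncations.\<close>

lemma twisted_corr_pairing:
  fixes a :: "'n::finite phase \<Rightarrow> complex" and k :: "'n phase \<Rightarrow> complex"
  assumes \<eta>: "\<eta> > 0" and a: "L2 a" and k: "bounded_cs k"
  shows "(\<integral>z. sympl_FT_L2 \<eta> a z * twisted_corr \<eta> (kernel_symbol \<eta> k) z \<partial>lborel) =
    (\<integral>u. \<integral>z. a z * wigner \<eta> (\<lambda>y. cnj (k (u, y))) (\<lambda>y. cnj (k (u, y))) z \<partial>lborel \<partial>lborel)"
proof -
  let ?s = "1 / \<eta>"
  let ?n = "complex_of_real (1 / (2 * pi * \<eta>) ^ CARD('n))"
  let ?tw = "\<lambda>z. ?n * pft ?s (\<lambda>z. corr_fun k (snd z, fst z)) z"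
  let ?W = "\<lambda>z. ?n * pft ?s (corr_fun k) z"
  have s: "?s \<noteq> 0" using \<eta> by simp
  note T = bounded_cs_corr_fun[OF k]
  have t: "bounded_cs (L2_trunc j a)" for j by (rule bounded_cs_L2_trunc) (use a in auto)
  have tw: "L2 ?tw" by (intro L2_cmult pft_Plancherel(1) bounded_cs_swap T s)
  have W: "L2 ?W" by (intro L2_cmult pft_Plancherel(1) T s)
  have "(\<lambda>j. \<integral>z. sympl_FT \<eta> (L2_trunc j a) z * ?tw z \<partial>lborel) \<longlonglongrightarrow> (\<integral>z. sympl_FT_L2 \<eta> a z * ?tw z \<partial>lborel)"
    by (rule tendsto_integral_mult_L2[OF sympl_FT_isometry(1)[OF \<eta> bounded_cs_integrable[OF t] bounded_cs_L2[OF t]]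
        sympl_FT_L2_trunc_tendsto(1)[OF \<eta> a] tw sympl_FT_L2_trunc_tendsto(2)[OF \<eta> a]])
  moreover have "(\<integral>z. sympl_FT \<eta> (L2_trunc j a) z * ?tw z \<partial>lborel) = (\<integral>z. L2_trunc j a z * ?W z \<partial>lborel)" for j
    using sympl_FT_pairing[OF \<eta> t T, of j] by (simp only: mult.left_commute[of _ ?n] Bochner_Integration.integral_mult_right_zero)
  moreover have "(\<lambda>j. \<integral>z. L2_trunc j a z * ?W z \<partial>lborel) \<longlonglongrightarrow> (\<integral>z. a z * ?W z \<partial>lborel)"
    by (rule tendsto_integral_mult_L2[OF bounded_cs_L2[OF t] a W norm_L2_trunc_tendsto[OF a]])
  ultimately have "(\<integral>z. sympl_FT_L2 \<eta> a z * ?tw z \<partial>lborel) = (\<integral>z. a z * ?W z \<partial>lborel)"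
    by (simp only: LIMSEQ_unique)
  then show ?thesis
    unfolding twisted_corr_kernel_symbol[OF \<eta> k] integral_mult_pft_corr_fun[OF \<eta> a k] .
qed

section \<open>Density of the symbols of such kernels\<close>

lemma bounded_cs_tensor:
  fixes f :: "'a::euclidean_space \<Rightarrow> complex" and g :: "'b::euclidean_space \<Rightarrow> complex"
  assumes "bounded_cs f" "bounded_cs g"
  shows "bounded_cs (\<lambda>z. f (fst z) * g (snd z))"
proof -
  obtain M B where f: "f \<in> borel_measurable borel" "0 \<le> M" "\<And>x. norm (f x) \<le> M" "\<And>x. B < norm x \<Longrightarrow> f x = 0"
    using assms(1) by (rule bounded_csE) blast
  obtain M' B' where g: "g \<in> borel_measurable borel" "0 \<le> M'" "\<And>x. norm (g x) \<le> M'" "\<And>x. B' < norm x \<Longrightarrow> g x = 0"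
    using assms(2) by (rule bounded_csE) blast
  note [measurable] = f(1) g(1)
  show ?thesis
  proof (rule bounded_csI[where M="M * M'" and R="B + B'"])
    show "norm (f (fst z) * g (snd z)) \<le> M * M'" for z
      unfolding norm_mult using f g by (intro mult_mono) auto
    fix z :: "'a \<times> 'b" assume "B + B' < norm z"
    then have "B < norm (fst z) \<or> B' < norm (snd z)"
      using norm_Pair_le_sum[of "fst z" "snd z"] by auto
    then show "f (fst z) * g (snd z) = 0" using f(4) g(4) by auto
  qed measurable
qed

lemma integral_swap:
  fixes f :: "'a::euclidean_space \<times> 'b::euclidean_space \<Rightarrow> complex"
  assumes f: "bounded_cs f"
  shows "(\<integral>z. f (snd z, fst z) \<partial>lborel) = (\<integral>z. f z \<partial>lborel)"
  using integral_lborel_prod(1)[OF bounded_cs_integrable[OF bounded_cs_swap[OF f]]]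
    integral_lborel_prod(2)[OF bounded_cs_integrable[OF f]] by simp

lemma norm_L2_swap:
  fixes f :: "'a::euclidean_space \<times> 'b::euclidean_space \<Rightarrow> complex"
  assumes f: "bounded_cs f"
  shows "norm_L2 (\<lambda>z. f (snd z, fst z)) = norm_L2 f"
  using integral_swap[OF bounded_cs_norm_square[OF f]]
  unfolding norm_L2_def by (simp only: integral_complex_of_real of_real_eq_iff)

lemma norm_L2_tensor:
  fixes f :: "'a::euclidean_space \<Rightarrow> complex" and g :: "'b::euclidean_space \<Rightarrow> complex"
  assumes f: "bounded_cs f" and g: "bounded_cs g"
  shows "norm_L2 (\<lambda>z. f (fst z) * g (snd z)) = norm_L2 f * norm_L2 g"
proof -
  note i = L2_integrable[OF bounded_cs_L2[OF bounded_cs_tensor[OF f g]]]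
  show ?thesis
    unfolding norm_L2_def integral_lborel_prod(1)[OF i]
    by (simp add: norm_mult power_mult_distrib real_sqrt_mult)
qed

text \<open>The Hilbert-Schmidt norm of K*K is at most the square of that of K. Cauchy-Schwarz in
  \<open>u\<close> bounds the correlation by a product of column norms at the two endpoints, and in
  midpoint coordinates that product has the norm of a tensor product.\<close>

lemma norm_L2_corr_fun:
  fixes k :: "'a::euclidean_space \<times> 'a \<Rightarrow> complex"
  assumes k: "bounded_cs k"
  shows "norm_L2 (corr_fun k) \<le> (norm_L2 k)\<^sup>2"
proof -
  \<comment> \<open>Complex-valued so that \<open>bounded_cs\<close> and the results on tensor
    products and shears apply.\<close>
  define m where "m v = complex_of_real (norm_L2 (\<lambda>u. k (u, v)))" for v
  have sec: "bounded_cs (\<lambda>u. k (u, v))" for v by (rule bounded_cs_section2[OF k])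
  have km [measurable]: "k \<in> borel_measurable borel" using k by auto
  have "bounded_cs (\<lambda>v. \<integral>u. complex_of_real ((norm (k (u, v)))\<^sup>2) \<partial>lborel)"
    using bounded_cs_integral[OF bounded_cs_norm_square[OF k]] by simp
  then obtain M B where MB: "0 \<le> M"
    "\<And>v. norm (\<integral>u. complex_of_real ((norm (k (u, v)))\<^sup>2) \<partial>lborel) \<le> M"
    "\<And>v. B < norm v \<Longrightarrow> (\<integral>u. complex_of_real ((norm (k (u, v)))\<^sup>2) \<partial>lborel) = 0"
    by (rule bounded_csE) blast
  have m_sq: "(norm (m v))\<^sup>2 = (\<integral>u. (norm (k (u, v)))\<^sup>2 \<partial>lborel)" for v
    unfolding m_def by (simp add: norm_L2_square)
  have mn: "bounded_cs m"
  proof (rule bounded_csI[where M="sqrt M" and R=B])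
    show "m \<in> borel_measurable borel" unfolding m_def[abs_def] norm_L2_def by measurable
    show "norm (m v) \<le> sqrt M" for v
      using MB(2)[of v] unfolding integral_complex_of_real m_sq[symmetric] norm_of_real
      by (intro real_le_rsqrt) simp
    show "m v = 0" if "B < norm v" for v
      using MB(3)[OF that] unfolding integral_complex_of_real m_sq[symmetric] by simp
  qed
  have "norm_L2 m = norm_L2 k"
    unfolding norm_L2_def m_sq integral_lborel_prod(2)[OF L2_integrable[OF bounded_cs_L2[OF k]]] by simp
  let ?F = "\<lambda>z. m (fst z) * m (snd z)"
  have F: "bounded_cs ?F" by (rule bounded_cs_tensor[OF mn mn])
  let ?G = "\<lambda>z. ?F (snd z + (1/2) *\<^sub>R fst z, snd z - (1/2) *\<^sub>R fst z)"
  have G: "bounded_cs ?G" by (rule bounded_cs_shear[OF F])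
  have "norm_L2 (corr_fun k) \<le> norm_L2 (\<lambda>z. ?G (snd z, fst z))"
  proof (rule norm_L2_mono[OF bounded_cs_L2[OF bounded_cs_swap[OF G]]])
    show "corr_fun k \<in> borel_measurable borel" using bounded_cs_corr_fun[OF k] by auto
    fix z :: "'a \<times> 'a"
    obtain w x where z: "z = (w, x)" by (cases z)
    have "norm (corr_fun k z) \<le> norm_L2 (\<lambda>u. k (u, w + (1/2) *\<^sub>R x)) * norm_L2 (\<lambda>u. cnj (k (u, w - (1/2) *\<^sub>R x)))"
      unfolding corr_fun_def corr_kernel_def z
      using norm_integral_mult_le[OF bounded_cs_L2[OF sec] L2_cnj[OF bounded_cs_L2[OF sec]]] by simp
    also have "norm_L2 (\<lambda>u. cnj (k (u, w - (1/2) *\<^sub>R x))) = norm_L2 (\<lambda>u. k (u, w - (1/2) *\<^sub>R x))"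
      by (rule norm_L2_cong) simp
    finally show "norm (corr_fun k z) \<le> norm (?G (snd z, fst z))"
      by (simp add: z m_def norm_mult)
  qed
  also have "\<dots> = norm_L2 k * norm_L2 k"
    unfolding norm_L2_swap[OF G] norm_L2_shear[OF F] norm_L2_tensor[OF mn mn] \<open>norm_L2 m = norm_L2 k\<close> ..
  finally show ?thesis by (simp add: power2_eq_square)
qed

lemma norm_L2_const_pft:
  fixes R :: "'n::finite phase \<Rightarrow> complex"
  assumes \<eta>: "\<eta> > 0" and R: "bounded_cs R"
  shows "norm_L2 (\<lambda>z. complex_of_real (1 / (2 * pi * \<eta>) ^ CARD('n)) * pft (1 / \<eta>) R z) =
    norm_L2 R / sqrt ((2 * pi * \<eta>) ^ CARD('n))"
proof -
  define N where "N = (2 * pi * \<eta>) ^ CARD('n)"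
  have N: "N > 0" using \<eta> by (simp add: N_def)
  have s: "1 / \<eta> \<noteq> 0" using \<eta> by simp
  have "(norm_L2 (pft (1 / \<eta>) R))\<^sup>2 = N * (norm_L2 R)\<^sup>2"
    using pft_Plancherel(2)[OF R s] \<eta> by (simp add: N_def)
  then have "(norm_L2 (pft (1 / \<eta>) R))\<^sup>2 = (sqrt N * norm_L2 R)\<^sup>2"
    using N by (simp add: power_mult_distrib)
  then have "norm_L2 (pft (1 / \<eta>) R) = sqrt N * norm_L2 R"
    by (rule power2_eq_imp_eq) (use N in auto)
  moreover have "sqrt N * norm_L2 R / N = norm_L2 R / sqrt N"
    using N real_sqrt_mult_self[of N] by (simp add: field_simps)
  ultimately show ?thesis
    unfolding norm_L2_cmult N_def[symmetric] using N by (simp add: norm_divide)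
qed

text \<open>The bound is in terms of the symbol instead of the kernel, so it is uniform along any
  sequence of symbols that converges in L2.\<close>

lemma norm_L2_twisted_corr_kernel_symbol:
  fixes k :: "'n::finite phase \<Rightarrow> complex"
  assumes \<eta>: "\<eta> > 0" and k: "bounded_cs k"
  shows "L2 (twisted_corr \<eta> (kernel_symbol \<eta> k))"
    "norm_L2 (twisted_corr \<eta> (kernel_symbol \<eta> k)) \<le>
      sqrt ((2 * pi * \<eta>) ^ CARD('n)) * (norm_L2 (kernel_symbol \<eta> k))\<^sup>2"
proof -
  define N where "N = (2 * pi * \<eta>) ^ CARD('n)"
  have N: "N > 0" using \<eta> by (simp add: N_def)
  have s: "1 / \<eta> \<noteq> 0" using \<eta> by simp
  note T = bounded_cs_corr_fun[OF k]
  have e: "twisted_corr \<eta> (kernel_symbol \<eta> k) =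
     (\<lambda>z. complex_of_real (1 / (2 * pi * \<eta>) ^ CARD('n)) * pft (1 / \<eta>) (\<lambda>z. corr_fun k (snd z, fst z)) z)"
    by (intro ext twisted_corr_kernel_symbol[OF \<eta> k])
  show "L2 (twisted_corr \<eta> (kernel_symbol \<eta> k))"
    unfolding e by (intro L2_cmult pft_Plancherel(1) bounded_cs_swap T s)
  have "norm_L2 (twisted_corr \<eta> (kernel_symbol \<eta> k)) = norm_L2 (corr_fun k) / sqrt N"
    unfolding e norm_L2_const_pft[OF \<eta> bounded_cs_swap[OF T]] norm_L2_swap[OF T] N_def ..
  also have "\<dots> \<le> (norm_L2 k)\<^sup>2 / sqrt N"
    using N by (intro divide_right_mono norm_L2_corr_fun[OF k]) auto
  also have "\<dots> = sqrt N * (norm_L2 (kernel_symbol \<eta> k))\<^sup>2"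
    unfolding norm_L2_kernel_symbol[OF \<eta> k] N_def[symmetric]
    using N real_sqrt_mult_self[of N] by (simp add: field_simps)
  finally show "norm_L2 (twisted_corr \<eta> (kernel_symbol \<eta> k)) \<le>
      sqrt ((2 * pi * \<eta>) ^ CARD('n)) * (norm_L2 (kernel_symbol \<eta> k))\<^sup>2"
    unfolding N_def .
qed

lemma norm_L2_diff_square:
  assumes f: "L2 f" and g: "L2 g"
  shows "(norm_L2 (\<lambda>x. f x - g x))\<^sup>2 = (norm_L2 f)\<^sup>2 + (norm_L2 g)\<^sup>2 - 2 * Re (\<integral>x. f x * cnj (g x) \<partial>lborel)"
proof -
  have i: "integrable lborel (\<lambda>x. f x * cnj (g x))" by (intro L2_mult_integrable f L2_cnj g)
  have "(norm (f x - g x))\<^sup>2 = (norm (f x))\<^sup>2 + (norm (g x))\<^sup>2 - 2 * Re (f x * cnj (g x))" for x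
    unfolding cmod_power2 by (simp add: power2_eq_square algebra_simps)
  then have "(norm_L2 (\<lambda>x. f x - g x))\<^sup>2 = (\<integral>x. (norm (f x))\<^sup>2 + (norm (g x))\<^sup>2 - 2 * Re (f x * cnj (g x)) \<partial>lborel)"
    unfolding norm_L2_square by simp
  also have "\<dots> = (norm_L2 f)\<^sup>2 + (norm_L2 g)\<^sup>2 - 2 * (\<integral>x. Re (f x * cnj (g x)) \<partial>lborel)"
    unfolding norm_L2_square using L2_integrable[OF f] L2_integrable[OF g] integrable_Re[OF i]
    by (subst Bochner_Integration.integral_diff; (simp del: times_complex.sel)?)
  also have "(\<integral>x. Re (f x * cnj (g x)) \<partial>lborel) = Re (\<integral>x. f x * cnj (g x) \<partial>lborel)"
    by (rule integral_Re[OF i])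
  finally show ?thesis .
qed

lemma bounded_cs_unshear:
  fixes r :: "'a::euclidean_space \<times> 'a \<Rightarrow> complex"
  assumes "bounded_cs r"
  shows "bounded_cs (\<lambda>z. r (fst z - snd z, (1/2) *\<^sub>R (fst z + snd z)))"
proof (rule bounded_cs_comp[OF assms, where C=3])
  fix z :: "'a \<times> 'a"
  obtain u v where z: "z = (u, v)" by (cases z)
  let ?x = "u - v" and ?s = "(1/2) *\<^sub>R (u + v)"
  have u: "u = ?s + (1/2) *\<^sub>R ?x" and v: "v = ?s - (1/2) *\<^sub>R ?x"
    using scaleR_half_add_half[of u] scaleR_half_add_half[of v] by (simp_all add: scaleR_add_right scaleR_diff_right)
  have "norm u \<le> norm ?s + (1/2) * norm ?x"
    using norm_triangle_ineq[of ?s "(1/2) *\<^sub>R ?x"] u[symmetric] by simp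
  moreover have "norm v \<le> norm ?s + (1/2) * norm ?x"
    using norm_triangle_ineq4[of ?s "(1/2) *\<^sub>R ?x"] v[symmetric] by simp
  ultimately show "norm z \<le> 3 * norm (fst z - snd z, (1/2) *\<^sub>R (fst z + snd z))"
    using norm_Pair_le_sum[of u v] norm_fst_le[of ?x ?s] norm_snd_le[of ?s ?x] unfolding z by simp
qed (measurable, simp?)

text \<open>The kernels come from truncating the inverse partial transform of \<open>c\<close>.
  Instead of inverting pointwise, the squared distance from the resulting symbol to \<open>c\<close>
  is expanded: the squared norm of the symbol and its inner product with \<open>c\<close> coincide,
  so the distance is a defect in Plancherel's identity, which vanishes as the truncation is
  removed.\<close>

lemma kernel_symbol_dense_bounded_cs:
  fixes c :: "'n::finite phase \<Rightarrow> complex"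
  assumes \<eta>: "\<eta> > 0" and c: "bounded_cs c"
  obtains k where "\<And>j::nat. bounded_cs (k j)" "(\<lambda>j. norm_L2 (\<lambda>z. kernel_symbol \<eta> (k j) z - c z)) \<longlonglongrightarrow> 0"
proof -
  define N where "N = (2 * pi * \<eta>) ^ CARD('n)"
  have N: "N > 0" using \<eta> by (simp add: N_def)
  have s: "1 / \<eta> \<noteq> 0" using \<eta> by simp
  let ?K = "pft (1 / \<eta>) c"
  \<comment> \<open>Only the transformed variable has to be cut; in the other one the bounded
    support of \<open>c\<close> is inherited.\<close>
  define \<kappa> where "\<kappa> j z = (if norm (snd z) \<le> real j then ?K z else 0)" for j :: nat and z
  have cm [measurable]: "c \<in> borel_measurable borel" using c by auto
  have K: "L2 ?K" by (rule pft_Plancherel(1)[OF c s])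
  have \<kappa>m [measurable]: "\<kappa> j \<in> borel_measurable borel" for j
    unfolding \<kappa>_def[abs_def] by measurable
  have \<kappa>: "bounded_cs (\<kappa> j)" for j
  proof -
    obtain C where C: "\<And>z. norm (?K z) \<le> C" using pft_bounded[OF c] by blast
    have C0: "0 \<le> C" using order_trans[OF norm_ge_zero C] .
    obtain B where B: "\<And>z. B < norm z \<Longrightarrow> c z = 0" using c by (rule bounded_csE) blast
    show ?thesis
    proof (rule bounded_csI[where M=C and R="B + real j"])
      show "norm (\<kappa> j z) \<le> C" for z using C[of z] C0 by (simp add: \<kappa>_def)
      fix z :: "'n phase" assume "B + real j < norm z"
      then have "B < norm (fst z) \<or> real j < norm (snd z)"
        using norm_Pair_le_sum[of "fst z" "snd z"] by auto
      moreover have "?K z = 0" if "B < norm (fst z)"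
      proof -
        have "c (fst z, x) = 0" for x using B[of "(fst z, x)"] norm_fst_le[of "fst z" x] that by simp
        then show ?thesis by (simp add: pft_def ft_def)
      qed
      ultimately show "\<kappa> j z = 0" by (auto simp: \<kappa>_def)
    qed measurable
  qed
  define k where "k j z = \<kappa> j (fst z - snd z, (1/2) *\<^sub>R (fst z + snd z))" for j z
  have k: "bounded_cs (k j)" for j
    unfolding k_def[abs_def] by (rule bounded_cs_unshear[OF \<kappa>])
  have shear: "k j (snd z + (1/2) *\<^sub>R fst z, snd z - (1/2) *\<^sub>R fst z) = \<kappa> j z" for j z
  proof -
    have "snd z + (1/2) *\<^sub>R fst z - (snd z - (1/2) *\<^sub>R fst z) = fst z"
      using scaleR_half_add_half[of "fst z"] by simp
    moreover have "(1/2) *\<^sub>R (snd z + (1/2) *\<^sub>R fst z + (snd z - (1/2) *\<^sub>R fst z)) = snd z"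
      by simp
    ultimately show ?thesis unfolding k_def fst_conv snd_conv by simp
  qed
  let ?q = "\<lambda>j. kernel_symbol \<eta> (k j)"
  have q: "?q j z = complex_of_real (1 / N) * pft (- 1 / \<eta>) (\<kappa> j) z" for j z
    unfolding kernel_symbol_def shear N_def by simp
  have nk: "norm_L2 (k j) = norm_L2 (\<kappa> j)" for j
    using norm_L2_shear[OF k, of j] unfolding shear by simp
  have qL: "L2 (?q j)" for j by (rule L2_kernel_symbol[OF \<eta> k])
  have nq: "(norm_L2 (?q j))\<^sup>2 = (norm_L2 (\<kappa> j))\<^sup>2 / N" for j
    unfolding norm_L2_kernel_symbol[OF \<eta> k] nk N_def ..
  \<comment> \<open>The multiplication formula moves the transform from \<open>\<kappa> j\<close> to
    \<open>c\<close>, and a truncation times the conjugate of the full function is the squared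
    modulus of the truncation.\<close>
  have ip: "(\<integral>z. ?q j z * cnj (c z) \<partial>lborel) = complex_of_real ((norm_L2 (\<kappa> j))\<^sup>2 / N)" for j
  proof -
    have i: "integrable lborel (\<lambda>z. pft (- 1 / \<eta>) (\<kappa> j) z * cnj (c z))"
      by (intro L2_mult_integrable pft_Plancherel(1) \<kappa> L2_cnj bounded_cs_L2 c) (use \<eta> in simp)
    have inner: "(\<integral>p. pft (- 1 / \<eta>) (\<kappa> j) (x, p) * cnj (c (x, p)) \<partial>lborel) =
       (\<integral>\<sigma>. complex_of_real ((norm (\<kappa> j (x, \<sigma>)))\<^sup>2) \<partial>lborel)" for x
    proof -
      have "(\<integral>p. pft (- 1 / \<eta>) (\<kappa> j) (x, p) * cnj (c (x, p)) \<partial>lborel) =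
         (\<integral>\<sigma>. \<kappa> j (x, \<sigma>) * ft (- 1 / \<eta>) (\<lambda>p. cnj (c (x, p))) \<sigma> \<partial>lborel)"
        using ft_mult_formula[OF bounded_cs_integrable[OF bounded_cs_section1[OF \<kappa>]]
            bounded_cs_integrable[OF bounded_cs_cnj[OF bounded_cs_section1[OF c]]], of "- 1 / \<eta>" j x x]
        by (simp add: pft_def)
      also have "\<dots> = (\<integral>\<sigma>. \<kappa> j (x, \<sigma>) * cnj (?K (x, \<sigma>)) \<partial>lborel)"
        using ft_uminus[of "1 / \<eta>" "\<lambda>p. cnj (c (x, p))"] by (simp add: pft_def)
      also have "\<dots> = (\<integral>\<sigma>. complex_of_real ((norm (\<kappa> j (x, \<sigma>)))\<^sup>2) \<partial>lborel)"
        by (intro Bochner_Integration.integral_cong refl)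
           (simp add: \<kappa>_def complex_norm_square del: of_real_power)
      finally show ?thesis .
    qed
    have "(\<integral>z. ?q j z * cnj (c z) \<partial>lborel) = complex_of_real (1 / N) * (\<integral>z. pft (- 1 / \<eta>) (\<kappa> j) z * cnj (c z) \<partial>lborel)"
      unfolding q mult.assoc by (rule Bochner_Integration.integral_mult_right_zero)
    also have "(\<integral>z. pft (- 1 / \<eta>) (\<kappa> j) z * cnj (c z) \<partial>lborel) = (\<integral>x. \<integral>\<sigma>. complex_of_real ((norm (\<kappa> j (x, \<sigma>)))\<^sup>2) \<partial>lborel \<partial>lborel)"
      unfolding integral_lborel_prod(1)[OF i] inner ..
    also have "\<dots> = complex_of_real ((norm_L2 (\<kappa> j))\<^sup>2)"
      unfolding norm_L2_square integral_complex_of_real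
        integral_lborel_prod(1)[OF L2_integrable[OF bounded_cs_L2[OF \<kappa>]]] ..
    finally show ?thesis by simp
  qed
  have d: "(norm_L2 (\<lambda>z. ?q j z - c z))\<^sup>2 = (norm_L2 c)\<^sup>2 - (norm_L2 (\<kappa> j))\<^sup>2 / N" for j
    unfolding norm_L2_diff_square[OF qL bounded_cs_L2[OF c]] nq ip by simp
  have "(\<lambda>j. norm_L2 (\<lambda>z. \<kappa> j z - ?K z)) \<longlonglongrightarrow> 0"
  proof (rule L2_dominated_tendsto[OF K \<kappa>m])
    show "norm (\<kappa> j z) \<le> norm (?K z)" for j z by (simp add: \<kappa>_def)
    fix z :: "'n phase"
    obtain J :: nat where J: "norm (snd z) \<le> real J" using real_arch_simple by blast
    have "\<forall>\<^sub>F j in sequentially. \<kappa> j z = ?K z"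
      using J by (intro eventually_sequentiallyI[of J]) (auto simp: \<kappa>_def)
    then show "(\<lambda>j. \<kappa> j z) \<longlonglongrightarrow> ?K z" by (rule tendsto_eventually)
  qed
  then have "(\<lambda>j. norm_L2 (\<kappa> j)) \<longlonglongrightarrow> norm_L2 ?K"
    by (rule tendsto_norm_L2[OF bounded_cs_L2[OF \<kappa>] K])
  then have "(\<lambda>j. (norm_L2 c)\<^sup>2 - (norm_L2 (\<kappa> j))\<^sup>2 / N) \<longlonglongrightarrow> (norm_L2 c)\<^sup>2 - (norm_L2 ?K)\<^sup>2 / N"
    using N by (intro tendsto_intros) auto
  also have "(norm_L2 ?K)\<^sup>2 = N * (norm_L2 c)\<^sup>2"
    using pft_Plancherel(2)[OF c s] \<eta> by (simp add: N_def)
  finally have "(\<lambda>j. (norm_L2 (\<lambda>z. ?q j z - c z))\<^sup>2) \<longlonglongrightarrow> 0"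
    unfolding d using N by simp
  then have "(\<lambda>j. sqrt ((norm_L2 (\<lambda>z. ?q j z - c z))\<^sup>2)) \<longlonglongrightarrow> sqrt 0"
    by (rule tendsto_real_sqrt)
  then show ?thesis using that[of k] k by simp
qed

text \<open>Half of the tolerance is spent on truncating \<open>c\<close>, half on the preceding
  density result; one kernel is then chosen for each tolerance
  \<open>inverse (real (Suc j))\<close>.\<close>

lemma kernel_symbol_dense:
  fixes c :: "'n::finite phase \<Rightarrow> complex"
  assumes \<eta>: "\<eta> > 0" and c: "L2 c"
  obtains k where "\<And>j::nat. bounded_cs (k j)" "(\<lambda>j. norm_L2 (\<lambda>z. kernel_symbol \<eta> (k j) z - c z)) \<longlonglongrightarrow> 0"
proof -
  have "\<exists>k. bounded_cs k \<and> norm_L2 (\<lambda>z. kernel_symbol \<eta> k z - c z) < e" if e: "e > 0" for e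
  proof -
    obtain n where n: "norm_L2 (\<lambda>z. L2_trunc n c z - c z) < e / 2"
      using order_tendstoD(2)[OF norm_L2_trunc_tendsto[OF c], of "e/2"] e by (force simp: eventually_sequentially)
    have t: "bounded_cs (L2_trunc n c)" by (rule bounded_cs_L2_trunc) (use c in auto)
    obtain k where k: "\<And>j::nat. bounded_cs (k j)"
      "(\<lambda>j. norm_L2 (\<lambda>z. kernel_symbol \<eta> (k j) z - L2_trunc n c z)) \<longlonglongrightarrow> 0"
      by (rule kernel_symbol_dense_bounded_cs[OF \<eta> t]) blast
    obtain j where j: "norm_L2 (\<lambda>z. kernel_symbol \<eta> (k j) z - L2_trunc n c z) < e / 2"
      using order_tendstoD(2)[OF k(2), of "e/2"] e by (force simp: eventually_sequentially)
    have "norm_L2 (\<lambda>z. kernel_symbol \<eta> (k j) z - c z) < e"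
      using norm_L2_triangle_diff[OF L2_kernel_symbol[OF \<eta> k(1)] bounded_cs_L2[OF t] c, of j] n j by linarith
    then show ?thesis using k(1) by blast
  qed
  then have "\<exists>k. bounded_cs k \<and> norm_L2 (\<lambda>z. kernel_symbol \<eta> k z - c z) < inverse (real (Suc j))" for j
    by simp
  then obtain k where k: "\<And>j. bounded_cs (k j)" "\<And>j. norm_L2 (\<lambda>z. kernel_symbol \<eta> (k j) z - c z) < inverse (real (Suc j))"
    by metis
  have "(\<lambda>j. norm_L2 (\<lambda>z. kernel_symbol \<eta> (k j) z - c z)) \<longlonglongrightarrow> 0"
    by (rule Lim_null_comparison[OF always_eventually LIMSEQ_inverse_real_of_nat])
       (use k(2) in \<open>auto intro: less_imp_le\<close>)
  then show ?thesis using that[of k] k(1) by blast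
qed

section \<open>Continuity of the two quadratic forms\<close>

text \<open>The common form of twisted correlations and Wigner functions: a phase
  \<open>\<theta>\<close> times two moved copies of a function. The difference of products is
  telescoped, changing one factor at a time.\<close>

lemma bilinear_integral_diff_bound:
  fixes f g f' g' \<theta> :: "'a::euclidean_space \<Rightarrow> complex"
  assumes L2: "L2 f" "L2 g" "L2 f'" "L2 g'"
    and \<theta> [measurable]: "\<theta> \<in> borel_measurable borel" and bd: "\<And>x. norm (\<theta> x) \<le> 1"
  shows "norm ((\<integral>x. \<theta> x * f x * g x \<partial>lborel) - (\<integral>x. \<theta> x * f' x * g' x \<partial>lborel)) \<le>
    norm_L2 (\<lambda>x. f x - f' x) * norm_L2 g + norm_L2 f' * norm_L2 (\<lambda>x. g x - g' x)"
proof -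
  have fm [measurable]: "f \<in> borel_measurable borel" "f' \<in> borel_measurable borel" using L2 by auto
  have t: "L2 (\<lambda>x. \<theta> x * h x)" "norm_L2 (\<lambda>x. \<theta> x * h x) \<le> norm_L2 h" if h: "L2 h" for h
  proof -
    have [measurable]: "h \<in> borel_measurable borel" using h by auto
    have le: "norm (\<theta> x * h x) \<le> norm (h x)" for x
      using mult_right_mono[OF bd[of x] norm_ge_zero[of "h x"]] by (simp add: norm_mult)
    show "L2 (\<lambda>x. \<theta> x * h x)" by (rule L2_bound[OF h, where C=1]) (use le in auto)
    show "norm_L2 (\<lambda>x. \<theta> x * h x) \<le> norm_L2 h" by (rule norm_L2_mono[OF h _ le]) measurable
  qed
  note d = L2_diff[OF L2(1,3)] L2_diff[OF L2(2,4)]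
  have "(\<integral>x. \<theta> x * f x * g x \<partial>lborel) - (\<integral>x. \<theta> x * f' x * g' x \<partial>lborel) =
     (\<integral>x. \<theta> x * f x * g x - \<theta> x * f' x * g' x \<partial>lborel)"
    by (rule Bochner_Integration.integral_diff[symmetric]) (intro L2_mult_integrable t L2)+
  also have "\<dots> = (\<integral>x. \<theta> x * (f x - f' x) * g x + \<theta> x * f' x * (g x - g' x) \<partial>lborel)"
    by (intro Bochner_Integration.integral_cong refl) (simp add: algebra_simps)
  also have "\<dots> = (\<integral>x. \<theta> x * (f x - f' x) * g x \<partial>lborel) + (\<integral>x. \<theta> x * f' x * (g x - g' x) \<partial>lborel)"
    by (rule Bochner_Integration.integral_add) (intro L2_mult_integrable t L2 d)+
  finally have "norm ((\<integral>x. \<theta> x * f x * g x \<partial>lborel) - (\<integral>x. \<theta> x * f' x * g' x \<partial>lborel)) \<le>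
     norm (\<integral>x. \<theta> x * (f x - f' x) * g x \<partial>lborel) + norm (\<integral>x. \<theta> x * f' x * (g x - g' x) \<partial>lborel)"
    by (simp only: norm_triangle_ineq)
  also have "norm (\<integral>x. \<theta> x * (f x - f' x) * g x \<partial>lborel) \<le> norm_L2 (\<lambda>x. \<theta> x * (f x - f' x)) * norm_L2 g"
    by (rule norm_integral_mult_le[OF t(1)[OF d(1)] L2(2)])
  also have "\<dots> \<le> norm_L2 (\<lambda>x. f x - f' x) * norm_L2 g"
    by (intro mult_right_mono t d) simp
  also have "norm (\<integral>x. \<theta> x * f' x * (g x - g' x) \<partial>lborel) \<le> norm_L2 (\<lambda>x. \<theta> x * f' x) * norm_L2 (\<lambda>x. g x - g' x)"
    by (rule norm_integral_mult_le[OF t(1)[OF L2(3)] d(2)])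
  also have "\<dots> \<le> norm_L2 f' * norm_L2 (\<lambda>x. g x - g' x)"
    by (intro mult_right_mono t L2) simp
  finally show ?thesis by simp
qed

section \<open>The twisted correlation as a quadratic map\<close>

lemma norm_L2_cnj: "norm_L2 (\<lambda>x. cnj (f x)) = norm_L2 f"
  by (rule norm_L2_cong) simp

lemma norm_L2_cnj_diff: "norm_L2 (\<lambda>x. cnj (f x) - cnj (g x)) = norm_L2 (\<lambda>x. f x - g x)"
  by (rule norm_L2_cong) (metis complex_cnj_diff complex_mod_cnj)

text \<open>Translations preserve the L2 norm, so the bound is independent of \<open>z\<close>: L2
  convergence of \<open>c\<close> gives uniform convergence of the correlations.\<close>

lemma twisted_corr_diff_bound:
  fixes c d :: "'n::finite phase \<Rightarrow> complex"
  assumes c: "L2 c" and d: "L2 d"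
  shows "norm (twisted_corr \<eta> c z - twisted_corr \<eta> d z) \<le> norm_L2 (\<lambda>z. c z - d z) * (norm_L2 c + norm_L2 d)"
proof -
  have e: "twisted_corr \<eta> h z = (\<integral>z'. cis (- (sympl z z' / (2 * \<eta>))) * h (z' + (- z)) * cnj (h z') \<partial>lborel)" for h
    unfolding twisted_corr_def exp_minus_i by simp
  have m: "(\<lambda>z'. cis (- (sympl z z' / (2 * \<eta>)))) \<in> borel_measurable borel"
    unfolding sympl_def by measurable
  have "norm (twisted_corr \<eta> c z - twisted_corr \<eta> d z) \<le>
     norm_L2 (\<lambda>x. c (x + - z) - d (x + - z)) * norm_L2 (\<lambda>x. cnj (c x)) +
     norm_L2 (\<lambda>x. d (x + - z)) * norm_L2 (\<lambda>x. cnj (c x) - cnj (d x))"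
    unfolding e by (rule bilinear_integral_diff_bound[OF L2_translate[OF c] L2_cnj[OF c] L2_translate[OF d] L2_cnj[OF d] m]) simp
  also have "\<dots> = norm_L2 (\<lambda>z. c z - d z) * (norm_L2 c + norm_L2 d)"
    unfolding norm_L2_translate[of "\<lambda>x. c x - d x"] norm_L2_translate norm_L2_cnj norm_L2_cnj_diff
    by (simp add: algebra_simps)
  finally show ?thesis .
qed

lemma twisted_corr_measurable:
  assumes [measurable]: "c \<in> borel_measurable borel"
  shows "twisted_corr \<eta> c \<in> borel_measurable borel"
  unfolding twisted_corr_def[abs_def] exp_minus_i sympl_def by measurable

lemma nonneg_c_tendsto:
  assumes "f \<longlonglongrightarrow> l" "\<And>n::nat. nonneg_c (f n)"
  shows "nonneg_c l"
proof -
  have "(\<lambda>n. Re (f n)) \<longlonglongrightarrow> Re l" "(\<lambda>n. Im (f n)) \<longlonglongrightarrow> Im l"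
    by (intro tendsto_intros assms)+
  then show ?thesis
    using assms(2) unfolding nonneg_c_def
    by (auto intro: LIMSEQ_le_const simp: LIMSEQ_const_iff)
qed

lemma nonneg_c_integral:
  assumes "\<And>x. nonneg_c (f x)"
  shows "nonneg_c (\<integral>x. f x \<partial>M)"
proof (cases "integrable M f")
  case True
  have "Re (\<integral>x. f x \<partial>M) = (\<integral>x. Re (f x) \<partial>M)" "Im (\<integral>x. f x \<partial>M) = (\<integral>x. Im (f x) \<partial>M)"
    using True by simp_all
  then show ?thesis using assms by (simp add: nonneg_c_def)
\<comment> \<open>Without integrability the integral has the default value 0, which is nonnegative
  too.\<close>
qed (simp add: not_integrable_integral_eq nonneg_c_def)

text \<open>The correlations of the approximating symbols converge uniformly and are bounded in L2,
  since a convergent sequence of symbols has bounded norms. Hence their pairings with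
  \<open>b\<close> converge, and nonnegativity is a closed condition.\<close>

lemma twisted_corr_pairing_nonneg:
  fixes b c :: "'n::finite phase \<Rightarrow> complex"
  assumes \<eta>: "\<eta> > 0" and b: "L2 b" and c: "L2 c"
    and pos: "\<And>k. bounded_cs k \<Longrightarrow> nonneg_c (\<integral>z. b z * twisted_corr \<eta> (kernel_symbol \<eta> k) z \<partial>lborel)"
  shows "nonneg_c (\<integral>z. b z * twisted_corr \<eta> c z \<partial>lborel)"
proof -
  obtain k where k: "\<And>j::nat. bounded_cs (k j)" and lim: "(\<lambda>j. norm_L2 (\<lambda>z. kernel_symbol \<eta> (k j) z - c z)) \<longlonglongrightarrow> 0"
    by (rule kernel_symbol_dense[OF \<eta> c]) blast
  let ?q = "\<lambda>j. kernel_symbol \<eta> (k j)"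
  let ?N = "sqrt ((2 * pi * \<eta>) ^ CARD('n))"
  have q: "L2 (?q j)" for j by (rule L2_kernel_symbol[OF \<eta> k])
  have nlim: "(\<lambda>j. norm_L2 (?q j)) \<longlonglongrightarrow> norm_L2 c"
    by (rule tendsto_norm_L2[OF q c lim])
  obtain B where B: "\<And>j. norm (norm_L2 (?q j)) \<le> B"
    using convergent_imp_Bseq[OF convergentI[OF nlim]] by (auto simp: Bseq_def)
  have "(\<lambda>j. \<integral>z. b z * twisted_corr \<eta> (?q j) z \<partial>lborel) \<longlonglongrightarrow> (\<integral>z. b z * twisted_corr \<eta> c z \<partial>lborel)"
  proof (rule L2_weak_convergence(2)[OF b norm_L2_twisted_corr_kernel_symbol(1)[OF \<eta> k]])
    show "norm_L2 (twisted_corr \<eta> (?q j)) \<le> ?N * B\<^sup>2" for j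
    proof -
      have "norm_L2 (twisted_corr \<eta> (?q j)) \<le> ?N * (norm_L2 (?q j))\<^sup>2"
        by (rule norm_L2_twisted_corr_kernel_symbol(2)[OF \<eta> k])
      also have "\<dots> \<le> ?N * B\<^sup>2"
        using B[of j] \<eta> by (intro mult_left_mono power_mono) auto
      finally show ?thesis .
    qed
    show "twisted_corr \<eta> c \<in> borel_measurable borel"
      by (rule twisted_corr_measurable[OF L2_measurable[OF c]])
    show "norm (twisted_corr \<eta> (?q j) z - twisted_corr \<eta> c z) \<le> norm_L2 (\<lambda>z. ?q j z - c z) * (norm_L2 (?q j) + norm_L2 c)" for j z
      by (rule twisted_corr_diff_bound[OF q c])
    show "(\<lambda>j. norm_L2 (\<lambda>z. ?q j z - c z) * (norm_L2 (?q j) + norm_L2 c)) \<longlonglongrightarrow> 0"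
      using tendsto_mult[OF lim tendsto_add[OF nlim tendsto_const[of "norm_L2 c"]]] by simp
  qed
  then show ?thesis
    by (rule nonneg_c_tendsto) (rule pos[OF k])
qed

section \<open>The Wigner function as a quadratic map\<close>

lemma L2_affine:
  fixes f :: "'a::euclidean_space \<Rightarrow> complex"
  assumes f: "L2 f" and r: "r \<noteq> 0"
  shows "L2 (\<lambda>x. f (t + r *\<^sub>R x))" "norm_L2 (\<lambda>x. f (t + r *\<^sub>R x)) = norm_L2 f / sqrt (\<bar>r\<bar> ^ DIM('a))"
proof -
  have [measurable]: "f \<in> borel_measurable borel" using f by auto
  show "L2 (\<lambda>x. f (t + r *\<^sub>R x))"
    using lborel_integrable_affine[OF L2_integrable[OF f] r] by (intro L2I) auto
  show "norm_L2 (\<lambda>x. f (t + r *\<^sub>R x)) = norm_L2 f / sqrt (\<bar>r\<bar> ^ DIM('a))"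
    unfolding norm_L2_def using lborel_integral_affine[OF r, of "\<lambda>x. (norm (f x))\<^sup>2" t] r
    by (simp add: real_sqrt_mult)
qed

lemma wigner_diff_bound:
  fixes \<psi> \<phi> :: "real^'n::finite \<Rightarrow> complex"
  assumes \<eta>: "\<eta> > 0" and \<psi>: "L2 \<psi>" and \<phi>: "L2 \<phi>"
  shows "norm (wigner \<eta> \<psi> \<psi> z - wigner \<eta> \<phi> \<phi> z) \<le>
    2 ^ CARD('n) / (2 * pi * \<eta>) ^ CARD('n) * (norm_L2 (\<lambda>x. \<psi> x - \<phi> x) * (norm_L2 \<psi> + norm_L2 \<phi>))"
proof -
  define N where "N = (2 * pi * \<eta>) ^ CARD('n)"
  have N: "N > 0" using \<eta> by (simp add: N_def)
  \<comment> \<open>Halving the argument divides the L2 norm by \<open>h\<close>; this happens in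
    both factors and accounts for the constant \<open>2 ^ CARD('n)\<close>.\<close>
  define h where "h = sqrt ((1/2::real) ^ CARD('n))"
  have h: "h > 0" by (simp add: h_def)
  have hh: "1 / h * (1 / h) = 2 ^ CARD('n)"
    unfolding h_def by (simp add: power_divide)
  let ?\<theta> = "\<lambda>y. cis (- (snd z \<bullet> y / \<eta>))"
  let ?I = "\<lambda>g. \<integral>y. ?\<theta> y * g (fst z + (1/2) *\<^sub>R y) * cnj (g (fst z + (-1/2) *\<^sub>R y)) \<partial>lborel"
  have e: "wigner \<eta> g g z = complex_of_real (1 / N) * ?I g" for g
    unfolding wigner_def exp_minus_i powr_minus_CARD[OF \<eta>] N_def by simp
  have n1: "norm_L2 (\<lambda>y. g (fst z + (1/2) *\<^sub>R y)) = norm_L2 g / h" if "L2 g" for g :: "real^'n \<Rightarrow> complex"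
    using L2_affine(2)[OF that, of "1/2" "fst z"] by (simp add: h_def)
  have n2: "norm_L2 (\<lambda>y. g (fst z + (-1/2) *\<^sub>R y)) = norm_L2 g / h" if "L2 g" for g :: "real^'n \<Rightarrow> complex"
    using L2_affine(2)[OF that, of "-1/2" "fst z"] by (simp add: h_def)
  have p: "L2 (\<lambda>y. g (fst z + (1/2) *\<^sub>R y))" "L2 (\<lambda>y. cnj (g (fst z + (-1/2) *\<^sub>R y)))" if "L2 g" for g :: "real^'n \<Rightarrow> complex"
    using L2_affine(1)[OF that, of "1/2" "fst z"] L2_cnj[OF L2_affine(1)[OF that, of "-1/2" "fst z"]] by simp_all
  have "norm (?I \<psi> - ?I \<phi>) \<le>
     norm_L2 (\<lambda>y. \<psi> (fst z + (1/2) *\<^sub>R y) - \<phi> (fst z + (1/2) *\<^sub>R y)) * norm_L2 (\<lambda>y. cnj (\<psi> (fst z + (-1/2) *\<^sub>R y))) +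
     norm_L2 (\<lambda>y. \<phi> (fst z + (1/2) *\<^sub>R y)) * norm_L2 (\<lambda>y. cnj (\<psi> (fst z + (-1/2) *\<^sub>R y)) - cnj (\<phi> (fst z + (-1/2) *\<^sub>R y)))"
    by (rule bilinear_integral_diff_bound[OF p[OF \<psi>] p[OF \<phi>]]) (measurable, simp?)
  also have "\<dots> = norm_L2 (\<lambda>x. \<psi> x - \<phi> x) / h * (norm_L2 \<psi> / h) + norm_L2 \<phi> / h * (norm_L2 (\<lambda>x. \<psi> x - \<phi> x) / h)"
    unfolding norm_L2_cnj norm_L2_cnj_diff n1[OF L2_diff[OF \<psi> \<phi>]] n2[OF L2_diff[OF \<psi> \<phi>]] n1[OF \<phi>] n2[OF \<psi>] ..
  also have "\<dots> = (1 / h * (1 / h)) * (norm_L2 (\<lambda>x. \<psi> x - \<phi> x) * (norm_L2 \<psi> + norm_L2 \<phi>))"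
    by (simp add: algebra_simps add_divide_distrib)
  finally have I: "norm (?I \<psi> - ?I \<phi>) \<le> 2 ^ CARD('n) * (norm_L2 (\<lambda>x. \<psi> x - \<phi> x) * (norm_L2 \<psi> + norm_L2 \<phi>))"
    unfolding hh .
  have "norm (wigner \<eta> \<psi> \<psi> z - wigner \<eta> \<phi> \<phi> z) = 1 / N * norm (?I \<psi> - ?I \<phi>)"
    unfolding e right_diff_distrib[symmetric] norm_mult using N by (simp add: norm_divide)
  also have "\<dots> \<le> 1 / N * (2 ^ CARD('n) * (norm_L2 (\<lambda>x. \<psi> x - \<phi> x) * (norm_L2 \<psi> + norm_L2 \<phi>)))"
    using N by (intro mult_left_mono I) simp
  finally show ?thesis unfolding N_def by simp
qed

lemma wigner_measurable:
  fixes \<psi> :: "real^'n::finite \<Rightarrow> complex"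
  assumes [measurable]: "\<psi> \<in> borel_measurable borel"
  shows "wigner \<eta> \<psi> \<psi> \<in> borel_measurable borel"
  unfolding wigner_def[abs_def] exp_minus_i by measurable

text \<open>Moyal's identity on the diagonal: the Wigner function is a partial transform of a
  sheared tensor product, and each operation changes the norm by a known factor.\<close>

lemma norm_L2_wigner:
  fixes \<psi> :: "real^'n::finite \<Rightarrow> complex"
  assumes \<eta>: "\<eta> > 0" and \<psi>: "bounded_cs \<psi>"
  shows "L2 (wigner \<eta> \<psi> \<psi>)" "norm_L2 (wigner \<eta> \<psi> \<psi>) = (norm_L2 \<psi>)\<^sup>2 / sqrt ((2 * pi * \<eta>) ^ CARD('n))"
proof -
  have s: "1 / \<eta> \<noteq> 0" using \<eta> by simp
  let ?F = "\<lambda>z. cnj (\<psi> (fst z)) * \<psi> (snd z)"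
  let ?G = "\<lambda>z. ?F (snd z + (1/2) *\<^sub>R fst z, snd z - (1/2) *\<^sub>R fst z)"
  have F: "bounded_cs ?F" by (rule bounded_cs_tensor[OF bounded_cs_cnj[OF \<psi>] \<psi>])
  note G = bounded_cs_shear[OF F]
  \<comment> \<open>The kernel is constant in its first argument and serves only to supply the slice
    at 0; that slice is what has bounded support.\<close>
  have "(\<lambda>v. corr_kernel (\<lambda>t. cnj (\<psi> (snd t))) (0, v)) = (\<lambda>z. ?G (snd z, fst z))"
    by (auto simp: corr_kernel_def)
  then have e: "wigner \<eta> \<psi> \<psi> = (\<lambda>z. complex_of_real (1 / (2 * pi * \<eta>) ^ CARD('n)) * pft (1 / \<eta>) (\<lambda>z. ?G (snd z, fst z)) z)"
    using wigner_conv_pft[OF \<eta>, of "\<lambda>t. cnj (\<psi> (snd t))" 0] by auto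
  show "L2 (wigner \<eta> \<psi> \<psi>)"
    unfolding e by (intro L2_cmult pft_Plancherel(1)[OF bounded_cs_swap[OF G] s])
  show "norm_L2 (wigner \<eta> \<psi> \<psi>) = (norm_L2 \<psi>)\<^sup>2 / sqrt ((2 * pi * \<eta>) ^ CARD('n))"
    unfolding e norm_L2_const_pft[OF \<eta> bounded_cs_swap[OF G]] norm_L2_swap[OF G] norm_L2_shear[OF F]
      norm_L2_tensor[OF bounded_cs_cnj[OF \<psi>] \<psi>] norm_L2_cnj by (simp add: power2_eq_square)
qed

text \<open>The same weak convergence argument, with truncations of \<open>\<psi>\<close> as
  approximants; Moyal's identity supplies the uniform L2 bound.\<close>

lemma wigner_pairing_nonneg:
  fixes a :: "'n::finite phase \<Rightarrow> complex" and \<psi> :: "real^'n \<Rightarrow> complex"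
  assumes \<eta>: "\<eta> > 0" and a: "L2 a" and \<psi>: "L2 \<psi>"
    and pos: "\<And>\<phi>. bounded_cs \<phi> \<Longrightarrow> nonneg_c (\<integral>z. a z * wigner \<eta> \<phi> \<phi> z \<partial>lborel)"
  shows "nonneg_c (\<integral>z. a z * wigner \<eta> \<psi> \<psi> z \<partial>lborel)"
proof -
  let ?t = "\<lambda>j. L2_trunc j \<psi>"
  let ?N = "sqrt ((2 * pi * \<eta>) ^ CARD('n))"
  let ?C = "2 ^ CARD('n) / (2 * pi * \<eta>) ^ CARD('n)"
  have t: "bounded_cs (?t j)" for j by (rule bounded_cs_L2_trunc[OF L2_measurable[OF \<psi>]])
  note lim = norm_L2_trunc_tendsto[OF \<psi>]
  have nlim: "(\<lambda>j. norm_L2 (?t j)) \<longlonglongrightarrow> norm_L2 \<psi>"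
    by (rule tendsto_norm_L2[OF bounded_cs_L2[OF t] \<psi> lim])
  have B: "norm_L2 (?t j) \<le> norm_L2 \<psi>" for j
    by (rule norm_L2_mono[OF \<psi> bounded_cs_measurable[OF t]]) (simp add: L2_trunc_def)
  have "(\<lambda>j. \<integral>z. a z * wigner \<eta> (?t j) (?t j) z \<partial>lborel) \<longlonglongrightarrow> (\<integral>z. a z * wigner \<eta> \<psi> \<psi> z \<partial>lborel)"
  proof (rule L2_weak_convergence(2)[OF a norm_L2_wigner(1)[OF \<eta> t]])
    show "norm_L2 (wigner \<eta> (?t j) (?t j)) \<le> (norm_L2 \<psi>)\<^sup>2 / ?N" for j
      unfolding norm_L2_wigner(2)[OF \<eta> t] using B[of j] \<eta> by (intro divide_right_mono power_mono) auto
    show "wigner \<eta> \<psi> \<psi> \<in> borel_measurable borel"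
      by (rule wigner_measurable[OF L2_measurable[OF \<psi>]])
    show "norm (wigner \<eta> (?t j) (?t j) z - wigner \<eta> \<psi> \<psi> z) \<le>
       ?C * (norm_L2 (\<lambda>x. ?t j x - \<psi> x) * (norm_L2 (?t j) + norm_L2 \<psi>))" for j z
      by (rule wigner_diff_bound[OF \<eta> bounded_cs_L2[OF t] \<psi>])
    show "(\<lambda>j. ?C * (norm_L2 (\<lambda>x. ?t j x - \<psi> x) * (norm_L2 (?t j) + norm_L2 \<psi>))) \<longlonglongrightarrow> 0"
      using tendsto_mult[OF tendsto_const[of ?C] tendsto_mult[OF lim tendsto_add[OF nlim tendsto_const[of "norm_L2 \<psi>"]]]] by simp
  qed
  then show ?thesis
    by (rule nonneg_c_tendsto) (rule pos[OF t])
qed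

theorem mainTheorem11:
  fixes \<eta> :: real and a :: "'n::finite phase \<Rightarrow> real"
  assumes "\<eta> > 0"
    and "L2 (\<lambda>z. complex_of_real (a z))"
    and "weyl_trace_class \<eta> a"
  shows "weyl_nonneg \<eta> a \<longleftrightarrow>
    (\<forall>c :: 'n phase \<Rightarrow> complex. L2 c \<longrightarrow>
       nonneg_c (\<integral>z. sympl_FT_L2 \<eta> (\<lambda>w. complex_of_real (a w)) z * twisted_corr \<eta> c z \<partial>lborel))"
proof
  let ?a = "\<lambda>z. complex_of_real (a z)"
  let ?b = "sympl_FT_L2 \<eta> ?a"
  note \<eta> = assms(1) and a = assms(2)
  have b: "L2 ?b" by (rule sympl_FT_L2_trunc_tendsto(1)[OF \<eta> a])
  note pairing = twisted_corr_pairing[OF \<eta> a, folded weyl_form_def]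
  {
    assume pos: "weyl_nonneg \<eta> a"
    show "\<forall>c. L2 c \<longrightarrow> nonneg_c (\<integral>z. ?b z * twisted_corr \<eta> c z \<partial>lborel)"
    proof (intro allI impI)
      fix c :: "'n phase \<Rightarrow> complex" assume c: "L2 c"
      show "nonneg_c (\<integral>z. ?b z * twisted_corr \<eta> c z \<partial>lborel)"
      proof (rule twisted_corr_pairing_nonneg[OF \<eta> b c])
        fix k :: "'n phase \<Rightarrow> complex" assume k: "bounded_cs k"
        show "nonneg_c (\<integral>z. ?b z * twisted_corr \<eta> (kernel_symbol \<eta> k) z \<partial>lborel)"
          unfolding pairing[OF k]
        proof (rule nonneg_c_integral)
          fix u
          \<comment> \<open>This holds for every \<open>u\<close>, since sections of
            \<open>k\<close> are bounded with bounded support; the integrand is thus nonnegative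
            everywhere.\<close>
          have "L2 (\<lambda>y. cnj (k (u, y)))"
            by (intro bounded_cs_L2 bounded_cs_cnj bounded_cs_section1 k)
          then show "nonneg_c (weyl_form \<eta> a (\<lambda>y. cnj (k (u, y))) (\<lambda>y. cnj (k (u, y))))"
            using pos unfolding weyl_nonneg_def by blast
        qed
      qed
    qed
  next
    assume pos: "\<forall>c. L2 c \<longrightarrow> nonneg_c (\<integral>z. ?b z * twisted_corr \<eta> c z \<partial>lborel)"
    show "weyl_nonneg \<eta> a"
      unfolding weyl_nonneg_def weyl_form_def
    proof (intro allI impI)
      fix \<psi> :: "real^'n \<Rightarrow> complex" assume "L2 \<psi>"
      then show "nonneg_c (\<integral>z. ?a z * wigner \<eta> \<psi> \<psi> z \<partial>lborel)"
      proof (rule wigner_pairing_nonneg[OF \<eta> a])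
        fix \<phi> :: "real^'n \<Rightarrow> complex" assume \<phi>: "bounded_cs \<phi>"
        let ?B = "cball (0 :: real^'n) 1"
        \<comment> \<open>A rank-one kernel whose conjugated slices are \<open>\<phi>\<close> for
          \<open>u\<close> in the unit ball and 0 elsewhere. The integral over \<open>u\<close> then
          collapses to the quadratic form at \<open>\<phi>\<close> times the volume of the ball; a
          bounded ball keeps the kernel in the admissible class.\<close>
        define k where "k z = indicator ?B (fst z) * cnj (\<phi> (snd z))" for z
        have "bounded_cs (\<lambda>u. indicator ?B u :: complex)"
          by (rule bounded_csI[where M=1 and R=1]) (auto simp: indicator_def)
        then have k: "bounded_cs k"
          unfolding k_def[abs_def] by (intro bounded_cs_tensor bounded_cs_cnj \<phi>)
        have "weyl_form \<eta> a (\<lambda>y. cnj (k (u, y))) (\<lambda>y. cnj (k (u, y))) = indicator ?B u *\<^sub>R weyl_form \<eta> a \<phi> \<phi>" for u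
          by (cases "u \<in> ?B") (simp_all add: k_def weyl_form_def wigner_def)
        then have "(\<integral>z. ?b z * twisted_corr \<eta> (kernel_symbol \<eta> k) z \<partial>lborel) = measure lborel ?B *\<^sub>R weyl_form \<eta> a \<phi> \<phi>"
          unfolding pairing[OF k] using emeasure_bounded_finite[of ?B] by simp
        then have "nonneg_c (measure lborel ?B *\<^sub>R weyl_form \<eta> a \<phi> \<phi>)"
          using pos L2_kernel_symbol[OF \<eta> k] by metis
        \<comment> \<open>A positive volume can be divided out without affecting the sign.\<close>
        moreover have "measure lborel ?B > 0"
          by (simp add: content_cball_pos)
        ultimately show "nonneg_c (\<integral>z. ?a z * wigner \<eta> \<phi> \<phi> z \<partial>lborel)"
          by (simp add: nonneg_c_def weyl_form_def zero_le_mult_iff)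
      qed
    qed
  }
qed

end
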